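(* Let $K\subset\mathbb{R}^d$ be the invariant set of an iterated function system $\Phi=\{\phi_1,\dots,\phi_N\}$ ($N\ge 2$) of contracting similarities of $\mathbb{R}^d$ with contraction ratios $r_1,\dots,r_N\in(0,1)$ satisfying the strong separation condition. Let $g\colon\mathcal{U}\to\mathbb{R}^d$ be a conformal diffeomorphism on an open domain $\mathcal{U}\supseteq K_{1/2}$ such that $|g'|$ is $\alpha$-H\"older continuous for some $\alpha>0$, and let $F:=g(K)$. Let $\delta$ denote the Minkowski dimension of $K$ (and hence of $F$) and let $\mu_\delta:=\mathcal{H}^\delta|_K/\mathcal{H}^\delta(K)$ be the normalised $\delta$-dimensional Hausdorff measure on $K$. Then the following hold. (i) The local average Minkowski content $\widetilde{\mathcal{M}}(F,\cdot)$ of $F$ exists and satisfies $$\frac{\mathrm{d}\widetilde{\mathcal{M}}(F,\cdot)}{\mathrm{d}\left(g_\star\mu_\delta\right)(\cdot)}=\frac{|g'\circ g^{-1}|^\delta}{\int_K|g'|^\delta\,\mathrm{d}\mu_\delta}\cdot\widetilde{\mathcal{M}}(F),$$ where $g_\star\mu_\delta$ is the push-forward of $\mu_\delta$ under $g$ and $\widetilde{\mathcal{M}}(F)$ is the average Minkowski content of $F$. (ii) If $\Phi$ is nonlattice, then the local Minkowski content $\mathcal{M}(F,\cdot)$ of $F$ exists and is equal to $\widetilde{\mathcal{M}}(F,\cdot)$.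
   Context: Setting. $\mathbb{R}^d$ carries the Euclidean metric $\rho$ and $\lambda^d$ is $d$-dimensional Lebesgue measure. For a nonempty compact $Y\subset\mathbb{R}^d$ and $\varepsilon>0$, $Y_\varepsilon:=\{x\in\mathbb{R}^d\mid\rho(Y,x)\le\varepsilon\}$ is the $\varepsilon$-parallel neighbourhood of $Y$. The invariant set $K$ of $\Phi$ is the unique nonempty compact set with $K=\bigcup_{i=1}^N\phi_iK$. The strong separation condition means $\phi_iK\cap\phi_jK=\emptyset$ for all $i\ne j$. Conformal means angle preserving: the Jacobian decomposes as $\mathrm{D}g(x)=f(x)\cdot O(x)$ with $O(x)$ an orthogonal matrix and $f(x)$ a scalar; $|g'(x)|:=|f(x)|$ is the length scaling ratio of $g$ at $x$. The diffeomorphism $g$ is understood as a diffeomorphism onto its image. Minkowski dimension. For nonempty compact $Y$, the upper and lower Minkowski dimensions are $\overline{\dim}_M(Y):=d-\liminf_{\varepsilon\searrow0}\frac{\ln\lambda^d(Y_\varepsilon)}{\ln\varepsilon}$ and $\underline{\dim}_M(Y):=d-\limsup_{\varepsilon\searrow0}\frac{\ln\lambda^d(Y_\varepsilon)}{\ln\varepsilon}$; if they coincide the common value is the Minkowski dimension. It is known that the Minkowski dimensions of $K$ and $F$ exist, are equal, and equal the unique $\delta$ with $\sum_{i=1}^N r_i^\delta=1$. $\mathcal{H}^\delta$ is $\delta$-dimensional Hausdorff measure. Contents. Let $Y$ be nonempty compact with Minkowski dimension $\delta$. The average Minkowski content is $\widetilde{\mathcal{M}}(Y):=\lim_{T\searrow0}|\ln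 T|^{-1}\int_T^1\varepsilon^{\delta-d}\lambda^d(Y_\varepsilon)\frac{\mathrm{d}\varepsilon}{\varepsilon}$, provided the limit exists (for $Y=F$ its existence is part of what underlies the statement). The local average Minkowski content of $Y$ is the weak limit of finite Borel measures on $\mathbb{R}^d$, $\widetilde{\mathcal{M}}(Y,\cdot):=\operatorname{w-lim}_{T\searrow0}|\ln T|^{-1}\int_T^1\varepsilon^{\delta-d-1}\lambda^d(Y_\varepsilon\cap\cdot)\,\mathrm{d}\varepsilon$, provided it exists. The local Minkowski content of $Y$ is the weak limit of finite Borel measures $\mathcal{M}(Y,\cdot):=\operatorname{w-lim}_{\varepsilon\searrow0}\varepsilon^{\delta-d}\lambda^d(Y_\varepsilon\cap\cdot)$, whenever it exists. Lattice. $\Phi$ is lattice if there exists $a>0$ such that $\ln r_i\in a\mathbb{Z}$ for all $i\in\{1,\dots,N\}$; otherwise $\Phi$ is nonlattice. *)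

theory Defs
  imports "HOL-Analysis.Analysis"
begin

definition contracting_similarity :: "('a::metric_space \<Rightarrow> 'a) \<Rightarrow> real \<Rightarrow> bool" where
  "contracting_similarity \<phi> r \<longleftrightarrow> 0 < r \<and> r < 1 \<and> (\<forall>x y. dist (\<phi> x) (\<phi> y) = r * dist x y)"

text \<open>The family is indexed by \<open>{1..N}\<close>. By Hutchinson's theorem a contracting family has
  exactly one invariant set.\<close>

definition invariant_set :: "nat \<Rightarrow> (nat \<Rightarrow> 'a::topological_space \<Rightarrow> 'a) \<Rightarrow> 'a set \<Rightarrow> bool" where
  "invariant_set N \<phi> K \<longleftrightarrow> compact K \<and> K \<noteq> {} \<and> K = (\<Union>i\<in>{1..N}. \<phi> i ` K)"

definition strong_separation :: "nat \<Rightarrow> (nat \<Rightarrow> 'a \<Rightarrow> 'a) \<Rightarrow> 'a set \<Rightarrow> bool" where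
  "strong_separation N \<phi> K \<longleftrightarrow>
     (\<forall>i\<in>{1..N}. \<forall>j\<in>{1..N}. i \<noteq> j \<longrightarrow> \<phi> i ` K \<inter> \<phi> j ` K = {})"

definition lattice_ratios :: "nat \<Rightarrow> (nat \<Rightarrow> real) \<Rightarrow> bool" where
  "lattice_ratios N r \<longleftrightarrow> (\<exists>a>0. \<forall>i\<in>{1..N}. \<exists>k::int. ln (r i) = a * of_int k)"

definition C1_on :: "(real^'n) set \<Rightarrow> (real^'n \<Rightarrow> real^'m) \<Rightarrow> bool" where
  "C1_on U g \<longleftrightarrow> (\<forall>x\<in>U. g differentiable (at x)) \<and> continuous_on U (\<lambda>x. jacobian g (at x))"

text \<open>Diffeomorphism onto its image, in the \<open>C\<^sup>1\<close> sense; \<open>g\<close> is a total function whose values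
  outside \<open>U\<close> are irrelevant.\<close>

definition diffeomorphism_on :: "(real^'n) set \<Rightarrow> (real^'n \<Rightarrow> real^'n) \<Rightarrow> bool" where
  "diffeomorphism_on U g \<longleftrightarrow>
     open U \<and> inj_on g U \<and> open (g ` U) \<and> C1_on U g \<and> C1_on (g ` U) (inv_into U g)"

definition conformal_on :: "(real^'n) set \<Rightarrow> (real^'n \<Rightarrow> real^'n) \<Rightarrow> bool" where
  "conformal_on U g \<longleftrightarrow>
     (\<forall>x\<in>U. g differentiable (at x) \<and>
        (\<exists>f Q. orthogonal_matrix Q \<and> jacobian g (at x) = f *\<^sub>R Q))"

text \<open>The length scaling ratio \<open>\<bar>g'(x)\<bar>\<close>: the scalar in the decomposition of the Jacobian is
  determined up to sign, so its absolute value is unique.\<close>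

definition scaling_ratio :: "(real^'n \<Rightarrow> real^'n) \<Rightarrow> real^'n \<Rightarrow> real" where
  "scaling_ratio g x =
     (THE c. \<exists>f Q. orthogonal_matrix Q \<and> jacobian g (at x) = f *\<^sub>R Q \<and> c = \<bar>f\<bar>)"

definition holder_on :: "real \<Rightarrow> 'a::metric_space set \<Rightarrow> ('a \<Rightarrow> real) \<Rightarrow> bool" where
  "holder_on \<alpha> U h \<longleftrightarrow> (\<exists>C. \<forall>x\<in>U. \<forall>y\<in>U. \<bar>h x - h y\<bar> \<le> C * dist x y powr \<alpha>)"

text \<open>\<open>diameter\<close> is a junk value for unbounded sets, hence the boundedness requirement in the
  covers below. The case distinctions give the conventions \<open>diam {} ^ s = 0\<close> and, for nonempty
  sets, \<open>diam A ^ 0 = 1\<close>.\<close>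

definition hausdorff_weight :: "real \<Rightarrow> 'a::metric_space set \<Rightarrow> ennreal" where
  "hausdorff_weight s A =
     (if A = {} then 0 else if s = 0 then 1 else ennreal (diameter A powr s))"

definition hausdorff_pre :: "real \<Rightarrow> real \<Rightarrow> 'a::metric_space set \<Rightarrow> ennreal" where
  "hausdorff_pre s \<eta> A =
     (INF C\<in>{C :: nat \<Rightarrow> 'a set. A \<subseteq> (\<Union>n. C n) \<and> (\<forall>n. bounded (C n) \<and> diameter (C n) \<le> \<eta>)}.
        \<Sum>n. hausdorff_weight s (C n))"

definition hausdorff_outer :: "real \<Rightarrow> 'a::metric_space set \<Rightarrow> ennreal" where
  "hausdorff_outer s A = (SUP \<eta>\<in>{0<..}. hausdorff_pre s \<eta> A)"

definition hausdorff_measure :: "real \<Rightarrow> 'a::metric_space measure" where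
  "hausdorff_measure s = measure_of UNIV (sets borel) (hausdorff_outer s)"

text \<open>Push-forward under a map that is only meaningful on \<open>U\<close>; it may be non-measurable elsewhere.\<close>

definition push_forward ::
    "'a set \<Rightarrow> ('a \<Rightarrow> 'b::topological_space) \<Rightarrow> 'a measure \<Rightarrow> 'b measure" where
  "push_forward U g \<mu> = distr (restrict_space \<mu> U) borel g"

definition parallel_nbhd :: "'a::metric_space set \<Rightarrow> real \<Rightarrow> 'a set" where
  "parallel_nbhd Y \<epsilon> = {x. infdist x Y \<le> \<epsilon>}"

definition upper_minkowski_dim :: "(real^'d) set \<Rightarrow> ereal" where
  "upper_minkowski_dim Y = ereal (real CARD('d)) -
     Liminf (at_right 0) (\<lambda>\<epsilon>. ereal (ln (measure lborel (parallel_nbhd Y \<epsilon>)) / ln \<epsilon>))"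

definition lower_minkowski_dim :: "(real^'d) set \<Rightarrow> ereal" where
  "lower_minkowski_dim Y = ereal (real CARD('d)) -
     Limsup (at_right 0) (\<lambda>\<epsilon>. ereal (ln (measure lborel (parallel_nbhd Y \<epsilon>)) / ln \<epsilon>))"

definition has_minkowski_dim :: "(real^'d) set \<Rightarrow> real \<Rightarrow> bool" where
  "has_minkowski_dim Y \<delta> \<longleftrightarrow>
     upper_minkowski_dim Y = ereal \<delta> \<and> lower_minkowski_dim Y = ereal \<delta>"

definition has_avg_minkowski_content :: "(real^'d) set \<Rightarrow> real \<Rightarrow> bool" where
  "has_avg_minkowski_content Y c \<longleftrightarrow>
     (\<exists>\<delta>. has_minkowski_dim Y \<delta> \<and>
        ((\<lambda>T. (1 / \<bar>ln T\<bar>) *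
           (LINT \<epsilon>:{T..1}|lborel.
              \<epsilon> powr (\<delta> - real CARD('d)) * measure lborel (parallel_nbhd Y \<epsilon>) / \<epsilon>))
         \<longlongrightarrow> c) (at_right 0))"

definition weak_limit ::
    "('b \<Rightarrow> 'a::topological_space measure) \<Rightarrow> 'a measure \<Rightarrow> 'b filter \<Rightarrow> bool" where
  "weak_limit M \<nu> L \<longleftrightarrow>
     (\<forall>\<^sub>F t in L. finite_measure (M t) \<and> sets (M t) = sets borel) \<and>
     finite_measure \<nu> \<and> sets \<nu> = sets borel \<and>
     (\<forall>f :: 'a \<Rightarrow> real. continuous_on UNIV f \<and> bounded (range f) \<longrightarrow>
        ((\<lambda>t. \<integral>x. f x \<partial>M t) \<longlongrightarrow> (\<integral>x. f x \<partial>\<nu>)) L)"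

definition rescaled_measure :: "real \<Rightarrow> (real^'d) set \<Rightarrow> real \<Rightarrow> (real^'d) measure" where
  "rescaled_measure \<delta> Y \<epsilon> = measure_of UNIV (sets borel)
     (\<lambda>B. ennreal (\<epsilon> powr (\<delta> - real CARD('d))) * emeasure lborel (parallel_nbhd Y \<epsilon> \<inter> B))"

definition averaged_measure :: "real \<Rightarrow> (real^'d) set \<Rightarrow> real \<Rightarrow> (real^'d) measure" where
  "averaged_measure \<delta> Y T = measure_of UNIV (sets borel)
     (\<lambda>B. ennreal (1 / \<bar>ln T\<bar>) *
        (\<integral>\<^sup>+\<epsilon>\<in>{T..1}. ennreal (\<epsilon> powr (\<delta> - real CARD('d) - 1)) *
                        emeasure lborel (parallel_nbhd Y \<epsilon> \<inter> B) \<partial>lborel))"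

definition has_local_avg_minkowski_content :: "(real^'d) set \<Rightarrow> (real^'d) measure \<Rightarrow> bool" where
  "has_local_avg_minkowski_content Y \<nu> \<longleftrightarrow>
     (\<exists>\<delta>. has_minkowski_dim Y \<delta> \<and> weak_limit (averaged_measure \<delta> Y) \<nu> (at_right 0))"

definition has_local_minkowski_content :: "(real^'d) set \<Rightarrow> (real^'d) measure \<Rightarrow> bool" where
  "has_local_minkowski_content Y \<nu> \<longleftrightarrow>
     (\<exists>\<delta>. has_minkowski_dim Y \<delta> \<and> weak_limit (rescaled_measure \<delta> Y) \<nu> (at_right 0))"

end

theory Submission
  imports Defs
begin

text \<open>Write \<open>\<epsilon> = exp (-t)\<close> and \<open>V t = \<epsilon>^(\<delta>-d) \<lambda>(K\<^sub>\<epsilon>)\<close>, where \<open>\<delta>\<close> solves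
\<open>\<Sum>\<^sub>i r\<^sub>i^\<delta> = 1\<close>. As soon as the neighbourhoods of the pieces \<open>\<phi>\<^sub>i K\<close> are disjoint, scaling
of volume gives \<open>V t = \<Sum>\<^sub>i r\<^sub>i^\<delta> V (t + ln r\<^sub>i)\<close>, a renewal equation whose weights sum to one.

\<^item> A maximum principle for this equation bounds \<open>V\<close> away from \<open>0\<close> and \<open>\<infinity>\<close>, so that \<open>\<delta>\<close> is the
  Minkowski dimension (\<open>minkowski_dim_K\<close>).

\<^item> The quantity \<open>\<Sum>\<^sub>i r\<^sub>i^\<delta> \<integral> V\<close>, integrated over the window from \<open>t + ln r\<^sub>i\<close> to \<open>t\<close>, is constant
  for large \<open>t\<close>. It determines the limit \<open>M\<close> of the means of \<open>V\<close> (\<open>averaged_renewal\<close>). If the ratios are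
  nonlattice, then \<open>V\<close> itself converges to \<open>M\<close> (\<open>nonlattice_renewal\<close>): along times at which \<open>V\<close>
  approaches its upper limit, \<open>V\<close> also does so after every backward shift by an element of the
  additive semigroup generated by the numbers \<open>- ln r\<^sub>i\<close>. Far out this semigroup is nearly dense,
  and \<open>V\<close> cannot increase quickly, hence \<open>V\<close> is close to its upper limit on a full window and the
  conserved quantity equals that of a constant function. The same holds for the lower limit.

For \<open>F = g ` K\<close>, cut \<open>K\<close> into the pieces \<open>K\<^sub>w\<close> of a large generation. On a small piece \<open>g\<close> is almost
a similarity with ratio \<open>\<bar>g'(x\<^sub>w)\<bar>\<close>: both \<open>g\<close> and its inverse have nearly constant local Lipschitz
constants, and a map with local Lipschitz constant \<open>A\<close> multiplies volumes by at most \<open>A^d\<close>. For a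
continuous function \<open>f \<ge> 1\<close> this squeezes \<open>\<epsilon>^(\<delta>-d) \<integral> f\<close>, integrated over \<open>F\<^sub>\<epsilon>\<close>, between
\<open>\<theta>^(-E)\<close> and \<open>\<theta>^E\<close> times sums of shifted copies of \<open>V\<close> with the weights
\<open>f (g x\<^sub>w) \<bar>g'(x\<^sub>w)\<bar>^\<delta> r\<^sub>w^\<delta>\<close> (\<open>rescaled_integral_sandwich\<close>). Convergence and convergence of means
both ignore shifts, respect sums and are monotone. The weights add up to a Riemann sum for
\<open>\<integral> f(g x) \<bar>g'(x)\<bar>^\<delta> d\<mu>\<close>, because \<open>\<mu> K\<^sub>w = r\<^sub>w^\<delta>\<close>. Letting \<open>\<theta>\<close> tend to \<open>1\<close> yields the limit
\<open>M \<integral> f(g x) \<bar>g'(x)\<bar>^\<delta> d\<mu>\<close> in either sense (\<open>tends_to_weighted_integral\<close>). This identifies the local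
contents as the measure with density \<open>M \<bar>g'(G y)\<bar>^\<delta>\<close>, \<open>G\<close> being the inverse of \<open>g\<close>, with respect to
the image of \<open>\<mu>\<close>, and \<open>f = 1\<close> identifies the average content.

The value \<open>\<mu> K\<^sub>w = r\<^sub>w^\<delta>\<close> comes from the scaling of Hausdorff measure, which has to be a Borel
measure (Caratheodory's criterion) and finite and positive on \<open>K\<close>. Positivity is again a volume
estimate: a set of diameter less than \<open>\<rho>\<close> meets \<open>K\<close> inside a copy of \<open>K\<close> of ratio comparable to
\<open>\<rho>\<close>, whose neighbourhoods have volume at most a constant times \<open>\<rho>^\<delta> \<epsilon>^(d-\<delta>)\<close>, while those of \<open>K\<close>
have volume at least a constant times \<open>\<epsilon>^(d-\<delta>)\<close>.\<close>

section \<open>Additive semigroups of positive reals\<close>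

inductive_set additive_semigroup :: "'i set \<Rightarrow> ('i \<Rightarrow> real) \<Rightarrow> real set" for I a where
  zero: "0 \<in> additive_semigroup I a"
| step: "s \<in> additive_semigroup I a \<Longrightarrow> i \<in> I \<Longrightarrow> s + a i \<in> additive_semigroup I a"

lemma additive_semigroup_add:
  assumes "s \<in> additive_semigroup I a" "t \<in> additive_semigroup I a"
  shows "s + t \<in> additive_semigroup I a"
  using assms(2)
proof induction
  case zero then show ?case using assms by simp
next
  case (step t i)
  then show ?case using additive_semigroup.step[of "s + t" I a i] by (simp add: add.assoc)
qed

lemma additive_semigroup_mult:
  assumes "s \<in> additive_semigroup I a" shows "real n * s \<in> additive_semigroup I a"
  by (induction n) (auto simp: distrib_right intro: additive_semigroup.zero additive_semigroup_add assms)

text \<open>A subgroup of the reals without arbitrarily small positive elements is generated by its least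
positive element; applied to the group of differences of the semigroup.\<close>

lemma additive_semigroup_small_difference:
  assumes "i0 \<in> I" "\<And>i. i \<in> I \<Longrightarrow> a i > 0"
    and nonlattice: "\<not> (\<exists>c>0. \<forall>i\<in>I. \<exists>k::int. a i = c * of_int k)"
    and "\<eta> > 0"
  obtains u v where "u \<in> additive_semigroup I a" "v \<in> additive_semigroup I a" "0 < u - v" "u - v < \<eta>"
proof -
  define S where "S = additive_semigroup I a"
  define G where "G = {u - v | u v. u \<in> S \<and> v \<in> S}"
  have G_add: "x + y \<in> G" if "x \<in> G" "y \<in> G" for x y
  proof -
    from that obtain u v u' v' where "x = u - v" "y = u' - v'" "u \<in> S" "v \<in> S" "u' \<in> S" "v' \<in> S"
      unfolding G_def by blast
    then have "x + y = (u + u') - (v + v')" "u + u' \<in> S" "v + v' \<in> S"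
      by (auto simp: S_def additive_semigroup_add)
    then show ?thesis unfolding G_def by blast
  qed
  have G_minus: "- x \<in> G" if "x \<in> G" for x
    using that unfolding G_def by (auto intro: minus_diff_eq)
  have G_diff: "x - y \<in> G" if "x \<in> G" "y \<in> G" for x y
    using G_add[OF that(1) G_minus[OF that(2)]] by simp
  have gen: "a i \<in> G" if "i \<in> I" for i
  proof -
    have "a i \<in> S" using additive_semigroup.step[OF additive_semigroup.zero that, of a]
      by (simp add: S_def)
    then show ?thesis unfolding G_def S_def using additive_semigroup.zero[of I a] by force
  qed
  have "0 \<in> G" using G_diff[OF gen gen] assms(1) by fastforce
  have G_nat: "real n * x \<in> G" if "x \<in> G" for n x
    by (induction n) (auto simp: distrib_right \<open>0 \<in> G\<close> intro: G_add that)
  have G_int: "of_int k * x \<in> G" if "x \<in> G" for k x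
  proof (cases k)
    case (nonneg n) then show ?thesis using G_nat[OF that, of n] by simp
  next
    case (neg n) then show ?thesis using G_minus[OF G_nat[OF that, of "Suc n"]]
      by (simp only: of_int_minus of_int_of_nat_eq mult_minus_left)
  qed
  have "\<exists>x\<in>G. 0 < x \<and> x < \<eta>"
  proof (rule ccontr)
    assume *: "\<not> ?thesis"
    define P where "P = {x \<in> G. 0 < x}"
    define c where "c = Inf P"
    have P: "P \<noteq> {}" "bdd_below P" using gen assms(1,2) unfolding P_def by (auto intro!: bdd_belowI[of _ 0])
    have "c \<ge> \<eta>" unfolding c_def using * P(1) by (intro cInf_greatest) (auto simp: P_def not_less)
    then have "c > 0" using \<open>\<eta> > 0\<close> by simp
    have "c \<in> G"
    proof -
      obtain g where g: "g \<in> P" "g < c + \<eta>"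
        using cInf_lessD[OF P(1), of "c + \<eta>"] \<open>\<eta> > 0\<close> unfolding c_def by auto
      have "c \<le> g" unfolding c_def using P g by (intro cInf_lower)
      show ?thesis
      proof (cases "g = c")
        case True then show ?thesis using g unfolding P_def by auto
      next
        case False
        then have "c < g" using \<open>c \<le> g\<close> by simp
        then obtain g' where g': "g' \<in> P" "g' < g" using cInf_lessD[OF P(1)] unfolding c_def by auto
        have "c \<le> g'" unfolding c_def using P g' by (intro cInf_lower)
        have "g - g' \<in> G" using G_diff g g' unfolding P_def by auto
        then show ?thesis using * g g' \<open>c \<le> g'\<close> by force
      qed
    qed
    have "\<exists>k::int. x = c * of_int k" if "x \<in> G" for x
    proof -
      define k where "k = \<lfloor>x / c\<rfloor>"
      have 1: "x - of_int k * c \<in> G" using G_diff[OF that G_int[OF \<open>c \<in> G\<close>]] .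
      have "of_int k \<le> x / c" "x / c < of_int k + 1" unfolding k_def by linarith+
      then have 2: "0 \<le> x - of_int k * c" "x - of_int k * c < c"
        using \<open>c > 0\<close> by (auto simp: field_simps)
      have "x - of_int k * c = 0"
      proof (rule ccontr)
        assume "x - of_int k * c \<noteq> 0"
        then have "x - of_int k * c \<in> P" using 1 2 unfolding P_def by auto
        then show False using cInf_lower[OF _ P(2)] 2 unfolding c_def[symmetric] by force
      qed
      then show ?thesis by (intro exI[of _ k]) (simp add: mult.commute)
    qed
    then show False using nonlattice gen \<open>c > 0\<close> by blast
  qed
  then show ?thesis using that unfolding G_def S_def by blast
qed

text \<open>If \<open>u - v\<close> is a small positive step, then \<open>n v, (n-1) v + u, \<dots>, n u\<close> is an arithmetic progression
with that step starting at \<open>n v\<close>. Once \<open>n (u - v) \<ge> v\<close>, it reaches the start \<open>(n+1) v\<close> of the next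
one, so that the progressions leave no gaps.\<close>

lemma additive_semigroup_eventually_dense:
  assumes "i0 \<in> I" "\<And>i. i \<in> I \<Longrightarrow> a i > 0"
    and nonlattice: "\<not> (\<exists>c>0. \<forall>i\<in>I. \<exists>k::int. a i = c * of_int k)"
    and "\<eta> > 0"
  obtains B where "\<And>x. x \<ge> B \<Longrightarrow> \<exists>s\<in>additive_semigroup I a. s \<le> x \<and> x \<le> s + \<eta>"
proof -
  define S where "S = additive_semigroup I a"
  obtain u v where uv: "u \<in> S" "v \<in> S" "0 < u - v" "u - v < \<eta>"
    using additive_semigroup_small_difference[OF assms] unfolding S_def by metis
  define h where "h = u - v"
  have h: "0 < h" "h < \<eta>" using uv unfolding h_def by auto
  have nonneg: "s \<ge> 0" if "s \<in> S" for s
    using that unfolding S_def by induction (auto dest: assms(2) intro: add_nonneg_nonneg less_imp_le)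
  have "v \<ge> 0" using nonneg uv by auto
  obtain n0 :: nat where n0: "real n0 * h \<ge> v"
    using reals_Archimedean3[OF h(1)] by (metis less_imp_le)
  have grid: "\<exists>s\<in>S. s \<le> x \<and> x \<le> s + h" if "real n * v \<le> x" "x \<le> real n * v + real n * h" for n x
  proof -
    define j where "j = min n (nat \<lfloor>(x - real n * v) / h\<rfloor>)"
    have q: "(x - real n * v) / h \<ge> 0" "(x - real n * v) / h \<le> real n" using that h by (auto simp: field_simps)
    have "real j \<le> (x - real n * v) / h \<and> (x - real n * v) / h \<le> real j + 1"
      unfolding j_def using q by (auto simp: min_def) linarith+
    then have j: "real n * v + real j * h \<le> x" "x \<le> real n * v + real j * h + h"
      using h by (auto simp: field_simps)
    have "real (n - j) * v + real j * u \<in> S"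
      using uv unfolding S_def by (intro additive_semigroup_add additive_semigroup_mult)
    moreover have "j \<le> n" by (simp add: j_def)
    then have "real (n - j) * v + real j * u = real n * v + real j * h"
      unfolding h_def by (simp add: of_nat_diff algebra_simps)
    ultimately show ?thesis using j by (auto intro!: bexI[of _ "real n * v + real j * h"])
  qed
  have "\<exists>s\<in>S. s \<le> x \<and> x \<le> s + h" if x: "x \<ge> real n0 * v" for x
  proof (cases "v = 0")
    case True
    obtain n :: nat where "x / h \<le> real n" using real_arch_simple by blast
    then show ?thesis using grid[of n x] True x h by (auto simp: field_simps)
  next
    case False
    then have "v > 0" using \<open>v \<ge> 0\<close> by simp
    define n where "n = nat \<lfloor>x / v\<rfloor>"
    have xv: "x / v \<ge> real n0" using x \<open>v > 0\<close> by (simp add: field_simps)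
    then have n: "real n \<le> x / v" "x / v \<le> real n + 1" "n \<ge> n0" unfolding n_def by linarith+
    have "real n * h \<ge> v" using n0 n(3) h by (meson less_imp_le mult_right_mono of_nat_mono order_trans)
    moreover have "real n * v \<le> x" "x \<le> real n * v + v" using n \<open>v > 0\<close> by (auto simp: field_simps)
    ultimately show ?thesis using grid[of n x] by simp
  qed
  then have "\<exists>s\<in>S. s \<le> x \<and> x \<le> s + \<eta>" if "x \<ge> real n0 * v" for x using that h by force
  then show ?thesis using that unfolding S_def by blast
qed

section \<open>The renewal equation\<close>

text \<open>A value at \<open>t > t0\<close> is a convex combination of values at times that are earlier by at least the
smallest \<open>a\<^sub>i\<close> and at most \<open>b\<close>, so a bound on one window of length \<open>b\<close> propagates in steps of the
smallest \<open>a\<^sub>i\<close>.\<close>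

lemma renewal_maximum_principle:
  fixes a p :: "'i \<Rightarrow> real" and X :: "real \<Rightarrow> real"
  assumes fin: "finite I" and ne: "I \<noteq> {}" and p: "\<And>i. i \<in> I \<Longrightarrow> p i > 0" "sum p I = 1"
    and a: "\<And>i. i \<in> I \<Longrightarrow> a i > 0" "\<And>i. i \<in> I \<Longrightarrow> a i \<le> b"
    and eq: "\<And>t. t \<ge> t0 \<Longrightarrow> X t = (\<Sum>i\<in>I. p i * X (t - a i))"
    and bound: "\<And>t. t0 - b \<le> t \<Longrightarrow> t \<le> t0 \<Longrightarrow> X t \<le> B"
    and t: "t0 - b \<le> t"
  shows "X t \<le> B"
proof -
  define l where "l = Min (a ` I)"
  have l: "l > 0" "\<And>i. i \<in> I \<Longrightarrow> l \<le> a i" unfolding l_def using fin ne a by auto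
  have *: "\<forall>t. t0 - b \<le> t \<longrightarrow> t \<le> t0 + real n * l \<longrightarrow> X t \<le> B" for n
  proof (induction n)
    case 0 then show ?case using bound by simp
  next
    case (Suc n)
    show ?case
    proof (intro allI impI)
      fix t assume t: "t0 - b \<le> t" "t \<le> t0 + real (Suc n) * l"
      show "X t \<le> B"
      proof (cases "t \<le> t0")
        case True then show ?thesis using bound t by simp
      next
        case False
        have "X t = (\<Sum>i\<in>I. p i * X (t - a i))" using False by (intro eq) simp
        also have "\<dots> \<le> (\<Sum>i\<in>I. p i * B)"
        proof (intro sum_mono mult_left_mono)
          fix i assume i: "i \<in> I"
          have "t0 - b \<le> t - a i" using False a(2)[OF i] by simp
          moreover have "t - a i \<le> t0 + real n * l" using t(2) l(2)[OF i] by (simp add: algebra_simps)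
          ultimately show "X (t - a i) \<le> B" using Suc by simp
        qed (use p less_imp_le in auto)
        also have "\<dots> = B" by (simp add: sum_distrib_right[symmetric] p)
        finally show ?thesis .
      qed
    qed
  qed
  obtain n :: nat where "t - t0 \<le> real n * l"
    using reals_Archimedean3[OF l(1)] less_imp_le by metis
  then show ?thesis using *[of n] t by simp
qed

text \<open>A form of the upper limit suited to the renewal argument: a sequence of times that attains it,
together with the bound that holds eventually.\<close>

lemma limsup_sequence:
  fixes X :: "real \<Rightarrow> real"
  assumes "bounded (X ` {c..})"
  obtains L u where "filterlim u at_top sequentially" "(\<lambda>n. X (u n)) \<longlonglongrightarrow> L"
    "\<And>\<xi>. \<xi> > 0 \<Longrightarrow> eventually (\<lambda>t. X t < L + \<xi>) at_top"
proof -
  obtain B where B: "\<And>t. t \<ge> c \<Longrightarrow> \<bar>X t\<bar> \<le> B" using assms unfolding bounded_iff by auto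
  define s where "s n = Sup (X ` {c + real n..})" for n :: nat
  have bdd: "bdd_above (X ` {c + real n..})" for n
    using B by (intro bdd_aboveI[of _ B]) (fastforce simp: abs_le_iff)
  have up: "X t \<le> s n" if "t \<ge> c + real n" for t n
    unfolding s_def using that by (intro cSUP_upper bdd) auto
  have dec: "decseq s"
    unfolding decseq_def s_def by (intro allI impI cSUP_subset_mono bdd) auto
  have "s n \<ge> - B" for n using up[of n "c + real n"] B[of "c + real n"] by (simp add: abs_le_iff)
  then obtain L where L: "s \<longlonglongrightarrow> L" using decseq_convergent[OF dec, of "-B"] by metis
  have "\<exists>t\<ge>c + real n. s n - 1 / (real n + 1) < X t" for n
  proof -
    have "s n - 1 / (real n + 1) < Sup (X ` {c + real n..})" unfolding s_def by simp
    then show ?thesis by (subst (asm) less_cSUP_iff) (auto simp: bdd)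
  qed
  then obtain u where u: "\<And>n. u n \<ge> c + real n" "\<And>n. s n - 1 / (real n + 1) < X (u n)" by metis
  have "filterlim u at_top sequentially"
  proof (rule filterlim_at_top_mono)
    show "filterlim (\<lambda>n. c + real n) at_top sequentially"
      by (intro filterlim_tendsto_add_at_top[OF tendsto_const] filterlim_real_sequentially)
  qed (use u in auto)
  moreover have "(\<lambda>n. X (u n)) \<longlonglongrightarrow> L"
  proof (rule tendsto_sandwich)
    have "(\<lambda>n. 1 / (real n + 1)) \<longlonglongrightarrow> 0" using LIMSEQ_inverse_real_of_nat by (simp add: inverse_eq_divide add.commute)
    then show "(\<lambda>n. s n - 1 / (real n + 1)) \<longlonglongrightarrow> L" using tendsto_diff[OF L] by fastforce
  qed (use u up L in \<open>auto intro!: always_eventually less_imp_le\<close>)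
  moreover have "eventually (\<lambda>t. X t < L + \<xi>) at_top" if "\<xi> > 0" for \<xi>
  proof -
    have "eventually (\<lambda>n. s n < L + \<xi>) sequentially" using order_tendstoD(2)[OF L, of "L + \<xi>"] that by simp
    then obtain n where "s n < L + \<xi>" unfolding eventually_sequentially by blast
    then show ?thesis using up by (intro eventually_at_top_linorderI[of "c + real n"]) (meson le_less_trans)
  qed
  ultimately show ?thesis using that by blast
qed

text \<open>Near its upper limit \<open>L\<close> a solution is a convex combination of values that are at most slightly above
\<open>L\<close>; since every weight is positive, none of these values can be much below \<open>L\<close>.\<close>

lemma renewal_limsup_propagates:
  fixes a p :: "'i \<Rightarrow> real" and X :: "real \<Rightarrow> real"
  assumes fin: "finite I" and p: "\<And>i. i \<in> I \<Longrightarrow> p i > 0" "sum p I = 1"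
    and eq: "\<And>t. t \<ge> t0 \<Longrightarrow> X t = (\<Sum>i\<in>I. p i * X (t - a i))"
    and u: "filterlim u at_top sequentially" "(\<lambda>n. X (u n)) \<longlonglongrightarrow> L"
    and up: "\<And>\<xi>. \<xi> > 0 \<Longrightarrow> eventually (\<lambda>t. X t < L + \<xi>) at_top"
    and s: "s \<in> additive_semigroup I a"
  shows "(\<lambda>n. X (u n - s)) \<longlonglongrightarrow> L"
  using s
proof induction
  case zero then show ?case using u by simp
next
  case (step s i)
  have shift: "filterlim (\<lambda>n. u n - c) at_top sequentially" for c
    using filterlim_tendsto_add_at_top[OF tendsto_const[of "-c"] u(1)] by simp
  show ?case
  proof (rule order_tendstoI)
    fix y assume "y > L"
    then have "eventually (\<lambda>t. X t < y) at_top" using up[of "y - L"] by simp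
    then show "eventually (\<lambda>n. X (u n - (s + a i)) < y) sequentially"
      using shift unfolding filterlim_iff by blast
  next
    fix y assume y: "y < L"
    \<comment> \<open>If all other terms are at most \<open>L + \<xi>\<close>, a total above \<open>L - \<xi>\<close> leaves
      \<open>p i * X > p i * L - 2 * \<xi>\<close> for the term of \<open>i\<close>; the choice of \<open>\<xi>\<close> turns this into \<open>X > y\<close>.\<close>
    define \<xi> where "\<xi> = (L - y) * p i / 2"
    have \<xi>: "\<xi> > 0" unfolding \<xi>_def using y p step by auto
    have "2 * \<xi> = p i * L - p i * y" unfolding \<xi>_def by (simp add: field_simps)
    have 1: "eventually (\<lambda>n. X (u n - s) > L - \<xi>) sequentially"
      using order_tendstoD(1)[OF step.IH] \<xi> by simp
    have 2: "eventually (\<lambda>n. u n - s \<ge> t0) sequentially"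
      using shift unfolding filterlim_at_top by blast
    have 3: "eventually (\<lambda>n. \<forall>j\<in>I. X (u n - s - a j) < L + \<xi>) sequentially"
    proof (rule eventually_ball_finite[OF fin], intro ballI)
      fix j
      have "filterlim (\<lambda>n. u n - s - a j) at_top sequentially" using shift[of "s + a j"] by (simp add: algebra_simps)
      then show "eventually (\<lambda>n. X (u n - s - a j) < L + \<xi>) sequentially"
        using up[OF \<xi>] unfolding filterlim_iff by blast
    qed
    show "eventually (\<lambda>n. y < X (u n - (s + a i))) sequentially"
      using 1 2 3
    proof eventually_elim
      case (elim n)
      have pi: "sum p (I - {i}) = 1 - p i" using step fin p by (simp add: sum_diff1)
      have "L - \<xi> < p i * X (u n - s - a i) + (\<Sum>j\<in>I - {i}. p j * X (u n - s - a j))"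
        using elim(1) eq[OF elim(2)] step fin by (simp add: sum.remove)
      also have "(\<Sum>j\<in>I - {i}. p j * X (u n - s - a j)) \<le> (\<Sum>j\<in>I - {i}. p j * (L + \<xi>))"
        using elim(3) p by (intro sum_mono mult_left_mono) (auto intro: less_imp_le)
      also have "\<dots> = (1 - p i) * (L + \<xi>)" by (simp add: sum_distrib_right[symmetric] pi)
      finally have "p i * X (u n - s - a i) > p i * L + p i * \<xi> - 2 * \<xi>" by (simp add: algebra_simps)
      moreover have "p i * \<xi> > 0" using \<xi> p step by simp
      ultimately have "p i * X (u n - s - a i) > p i * y"
        using \<open>2 * \<xi> = p i * L - p i * y\<close> by linarith
      then show ?case using p step by (simp add: algebra_simps)
    qed
  qed
qed

section \<open>Convergence and convergence of means\<close>

text \<open>The class of functions for which both notions of convergence below behave well. Nothing is required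
near \<open>- \<infinity>\<close>, where rescaled volumes are unbounded.\<close>

definition tame :: "(real \<Rightarrow> real) \<Rightarrow> bool" where
  "tame H \<longleftrightarrow> H \<in> borel_measurable borel \<and> (\<forall>c. bounded (H ` {c..}))"

text \<open>The flag selects between convergence of the means \<open>(1/L) \<integral>\<^sub>0\<^sup>L H\<close> and ordinary convergence. The
two parts of the theorem differ only in this respect, and all that the argument needs of either
notion is linearity, shift invariance and monotonicity.\<close>

definition tends_to :: "bool \<Rightarrow> (real \<Rightarrow> real) \<Rightarrow> real \<Rightarrow> bool" where
  "tends_to averaged H l \<longleftrightarrow>
     (if averaged then ((\<lambda>L. integral {0..L} H / L) \<longlongrightarrow> l) at_top else (H \<longlongrightarrow> l) at_top)"

lemma tame_bound:
  assumes "tame H" obtains B where "B \<ge> 0" "\<And>t. t \<ge> c \<Longrightarrow> \<bar>H t\<bar> \<le> B"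
proof -
  obtain B where "\<And>t. t \<ge> c \<Longrightarrow> \<bar>H t\<bar> \<le> B"
    using assms unfolding tame_def bounded_iff by (metis atLeast_iff imageI real_norm_def)
  then show ?thesis using that[of "\<bar>B\<bar>"] by fastforce
qed

lemma tameI:
  assumes "H \<in> borel_measurable borel" "\<And>c. \<exists>B. \<forall>t\<ge>c. \<bar>H t\<bar> \<le> B"
  shows "tame H"
  unfolding tame_def bounded_iff using assms by (metis (no_types, lifting) atLeast_iff imageE real_norm_def)

lemma tame_measurable[measurable_dest]: "tame H \<Longrightarrow> H \<in> borel_measurable borel"
  unfolding tame_def by simp

lemma tame_set_integrable:
  assumes "tame H" shows "set_integrable lborel {a..b} H"
proof -
  obtain B where "\<And>t. t \<ge> a \<Longrightarrow> \<bar>H t\<bar> \<le> B" using tame_bound[OF assms] by metis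
  then show ?thesis unfolding set_integrable_def
    using assms by (intro integrableI_bounded_set_indicator[where B=B]) (auto simp: tame_def emeasure_lborel_Icc_eq)
qed

lemma tame_integrable_on: "tame H \<Longrightarrow> H integrable_on {a..b}"
  using set_borel_integral_eq_integral(1)[OF tame_set_integrable] .

lemma tame_shift: assumes "tame H" shows "tame (\<lambda>t. H (t - c))"
proof (rule tameI)
  show "(\<lambda>t. H (t - c)) \<in> borel_measurable borel"
    by (rule measurable_compose[OF _ tame_measurable[OF assms]]) simp
  show "\<exists>B. \<forall>t\<ge>d. \<bar>H (t - c)\<bar> \<le> B" for d using tame_bound[OF assms, of "d - c"] by (metis diff_right_mono)
qed

lemma tame_cmult: assumes "tame H" shows "tame (\<lambda>t. c * H t)"
proof (rule tameI)
  show "(\<lambda>t. c * H t) \<in> borel_measurable borel" using assms by measurable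
  show "\<exists>B. \<forall>t\<ge>d. \<bar>c * H t\<bar> \<le> B" for d
    using tame_bound[OF assms, of d] by (metis abs_ge_zero abs_mult mult_left_mono)
qed

lemma tame_add: assumes "tame H" "tame H'" shows "tame (\<lambda>t. H t + H' t)"
proof (rule tameI)
  show "(\<lambda>t. H t + H' t) \<in> borel_measurable borel" using assms by measurable
  fix d
  obtain B B' where "\<And>t. t \<ge> d \<Longrightarrow> \<bar>H t\<bar> \<le> B" "\<And>t. t \<ge> d \<Longrightarrow> \<bar>H' t\<bar> \<le> B'"
    using tame_bound[OF assms(1)] tame_bound[OF assms(2)] by metis
  then show "\<exists>B. \<forall>t\<ge>d. \<bar>H t + H' t\<bar> \<le> B" by (intro exI[of _ "B + B'"]) (force intro: abs_triangle_ineq[THEN order_trans] add_mono)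
qed

lemma tame_const: "tame (\<lambda>t. c)" by (rule tameI) auto

lemma tame_sum: assumes "\<And>w. w \<in> W \<Longrightarrow> tame (H w)" shows "tame (\<lambda>t. \<Sum>w\<in>W. H w t)"
  using assms by (induction W rule: infinite_finite_induct) (auto intro: tame_add tame_const)

lemma tends_to_cmult: assumes "tends_to av H l" shows "tends_to av (\<lambda>t. c * H t) (c * l)"
proof (cases av)
  case True
  then have "((\<lambda>L. integral {0..L} H / L) \<longlongrightarrow> l) at_top"
    using assms unfolding tends_to_def by simp
  from tendsto_mult_left[OF this, of c] show ?thesis using True unfolding tends_to_def by simp
qed (use assms in \<open>auto simp: tends_to_def intro: tendsto_mult_left\<close>)

lemma tends_to_add:
  assumes "tame H" "tame H'" "tends_to av H l" "tends_to av H' l'"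
  shows "tends_to av (\<lambda>t. H t + H' t) (l + l')"
proof (cases av)
  case True
  then have "((\<lambda>L. integral {0..L} H / L + integral {0..L} H' / L) \<longlongrightarrow> l + l') at_top"
    using assms unfolding tends_to_def by (auto intro: tendsto_add)
  then show ?thesis using True unfolding tends_to_def
    by (simp add: integral_add tame_integrable_on assms add_divide_distrib)
qed (use assms in \<open>auto simp: tends_to_def intro: tendsto_add\<close>)

lemma tends_to_sum:
  assumes "\<And>w. w \<in> W \<Longrightarrow> tame (H w)" "\<And>w. w \<in> W \<Longrightarrow> tends_to av (H w) (l w)"
  shows "tends_to av (\<lambda>t. \<Sum>w\<in>W. H w t) (\<Sum>w\<in>W. l w)"
  using assms
proof (induction W rule: infinite_finite_induct)
  case (insert w W)
  then show ?case by (auto intro!: tends_to_add tame_sum)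
qed (auto simp: tends_to_def)

lemma bounded_over_linear_tendsto_0:
  fixes f :: "real \<Rightarrow> real"
  assumes "eventually (\<lambda>L. \<bar>f L\<bar> \<le> B) at_top"
  shows "((\<lambda>L. f L / L) \<longlongrightarrow> 0) at_top"
proof (rule Lim_null_comparison)
  show "((\<lambda>L. B / L) \<longlongrightarrow> 0) at_top" by (intro tendsto_divide_0[OF tendsto_const] filterlim_at_top_imp_at_infinity filterlim_ident)
  show "eventually (\<lambda>L. norm (f L / L) \<le> B / L) at_top"
    using assms eventually_gt_at_top[of 0] by eventually_elim (simp add: divide_right_mono)
qed

text \<open>For means: shifting changes the integral over \<open>{0..L}\<close> only by two integrals over intervals of
length \<open>\<bar>c\<bar>\<close>, which are bounded independently of \<open>L\<close>.\<close>

lemma tends_to_shift: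
  assumes "tame H" "tends_to av H l" shows "tends_to av (\<lambda>t. H (t - c)) l"
proof (cases av)
  case True
  obtain B where B: "B \<ge> 0" "\<And>t. t \<ge> - \<bar>c\<bar> \<Longrightarrow> \<bar>H t\<bar> \<le> B" using tame_bound[OF assms(1)] by metis
  have le: "\<bar>integral {x..y} H\<bar> \<le> B * \<bar>c\<bar>" if "x \<le> y" "y - x \<le> \<bar>c\<bar>" "x \<ge> - \<bar>c\<bar>" for x y
  proof -
    have "\<bar>integral {x..y} H\<bar> \<le> integral {x..y} (\<lambda>_. B)"
      using integral_norm_bound_integral[OF tame_integrable_on[OF assms(1)], of "\<lambda>_. B" x y] B that by auto
    also have "\<dots> = B * (y - x)" using that by simp
    also have "\<dots> \<le> B * \<bar>c\<bar>" using that B by (intro mult_left_mono) auto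
    finally show ?thesis .
  qed
  have "\<bar>integral {0..L} (\<lambda>t. H (t - c)) - integral {0..L} H\<bar> \<le> 2 * (B * \<bar>c\<bar>)" if "L \<ge> \<bar>c\<bar>" for L
  proof -
    have sh: "integral {0..L} (\<lambda>t. H (t - c)) = integral {-c..L-c} H"
      using integral_shift_real_ivl[of "-c" "-c" "L - c" H] by simp
    have integral_H_split: "integral {x..y} H + integral {y..z} H = integral {x..z} H" if "x \<le> y" "y \<le> z" for x y z
      using that by (intro Henstock_Kurzweil_Integration.integral_combine tame_integrable_on assms)
    show ?thesis
    proof (cases "c \<ge> 0")
      case True
      show ?thesis using sh integral_H_split[of "-c" 0 "L - c"] integral_H_split[of 0 "L - c" L] le[of "-c" 0] le[of "L-c" L] True that
        by auto
    next
      case False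
      show ?thesis using sh integral_H_split[of 0 "-c" "L - c"] integral_H_split[of 0 L "L - c"] le[of 0 "-c"] le[of L "L - c"] False that
        by auto
    qed
  qed
  then have "((\<lambda>L. (integral {0..L} (\<lambda>t. H (t - c)) - integral {0..L} H) / L) \<longlongrightarrow> 0) at_top"
    by (intro bounded_over_linear_tendsto_0[where B="2 * (B * \<bar>c\<bar>)"] eventually_at_top_linorderI)
  from tendsto_add[OF this] have "((\<lambda>L. (integral {0..L} (\<lambda>t. H (t - c)) - integral {0..L} H) / L
      + integral {0..L} H / L) \<longlongrightarrow> 0 + l) at_top" using assms(2) True by (auto simp: tends_to_def)
  then show ?thesis using True unfolding tends_to_def by (simp add: diff_divide_distrib)
next
  case False
  have "filterlim (\<lambda>t. - c + t) at_top at_top" by (rule filterlim_tendsto_add_at_top[OF tendsto_const filterlim_ident])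
  then have "filterlim (\<lambda>t. t - c) at_top at_top" by simp
  then show ?thesis using False assms(2) unfolding tends_to_def by (auto intro: filterlim_compose)
qed

lemma tends_to_mono:
  assumes "tame H" "tame H'" "tends_to av H l" "eventually (\<lambda>t. H t \<le> H' t) at_top" "y < l"
  shows "if av then eventually (\<lambda>L. y < integral {0..L} H' / L) at_top else eventually (\<lambda>t. y < H' t) at_top"
proof (cases av)
  case True
  obtain T0 where T0: "\<And>t. t \<ge> T0 \<Longrightarrow> H t \<le> H' t" using assms(4) unfolding eventually_at_top_linorder by blast
  define T where "T = max 0 T0"
  define D where "D = integral {0..T} H' - integral {0..T} H"
  have ge: "integral {0..L} H + D \<le> integral {0..L} H'" if "L \<ge> T" for L
  proof -
    have "integral {0..T} H + integral {T..L} H = integral {0..L} H"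
      "integral {0..T} H' + integral {T..L} H' = integral {0..L} H'"
      using that unfolding T_def by (auto intro!: Henstock_Kurzweil_Integration.integral_combine tame_integrable_on assms)
    moreover have "integral {T..L} H \<le> integral {T..L} H'"
      by (intro integral_le tame_integrable_on assms) (auto intro!: T0 simp: T_def)
    ultimately show ?thesis unfolding D_def by linarith
  qed
  have "((\<lambda>L. D / L) \<longlongrightarrow> 0) at_top" by (rule bounded_over_linear_tendsto_0[where B="\<bar>D\<bar>"]) auto
  then have "((\<lambda>L. integral {0..L} H / L + D / L) \<longlongrightarrow> l + 0) at_top"
    using assms(3) True by (intro tendsto_add) (auto simp: tends_to_def)
  then have "eventually (\<lambda>L. y < integral {0..L} H / L + D / L) at_top"
    using assms(5) by (intro order_tendstoD(1)[where y="l + 0"]) auto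
  moreover have "eventually (\<lambda>L. integral {0..L} H / L + D / L \<le> integral {0..L} H' / L) at_top"
    using eventually_ge_at_top[of T] eventually_gt_at_top[of 0]
  proof eventually_elim
    case (elim L)
    have "integral {0..L} H / L + D / L = (integral {0..L} H + D) / L" by (simp add: add_divide_distrib)
    also have "\<dots> \<le> integral {0..L} H' / L" using ge elim by (intro divide_right_mono) auto
    finally show ?case .
  qed
  ultimately show ?thesis using True by (auto elim: eventually_elim2)
next
  case False
  then have "eventually (\<lambda>t. y < H t) at_top" using assms(3,5) unfolding tends_to_def by (auto intro: order_tendstoD)
  then show ?thesis using False assms(4) by (auto elim: eventually_elim2)
qed

text \<open>The comparison functions are allowed to depend on \<open>\<theta>\<close>; only their limits have to come together
as \<open>\<theta>\<close> tends to \<open>1\<close>.\<close>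

lemma tends_to_sandwich:
  assumes H: "tame H"
    and sandwich: "\<And>\<theta>. \<theta> > 1 \<Longrightarrow> \<exists>h1 h2 l1 l2. tame h1 \<and> tame h2 \<and> tends_to av h1 l1 \<and> tends_to av h2 l2
        \<and> eventually (\<lambda>t. h1 t \<le> H t) at_top \<and> eventually (\<lambda>t. H t \<le> h2 t) at_top
        \<and> l / \<theta> \<le> l1 \<and> l2 \<le> \<theta> * l"
  shows "tends_to av H l"
proof -
  have low: "\<exists>\<theta>>1. y < l / \<theta>" if "y < l" for y
  proof -
    have "((\<lambda>\<theta>. l / \<theta>) \<longlongrightarrow> l / 1) (at_right 1)" by (intro tendsto_intros) auto
    then have "eventually (\<lambda>\<theta>. y < l / \<theta>) (at_right 1)" using that by (intro order_tendstoD) auto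
    then have "eventually (\<lambda>\<theta>. y < l / \<theta> \<and> \<theta> > 1) (at_right 1)"
      using eventually_at_right_less[of 1] by (rule eventually_conj)
    then show ?thesis using eventually_happens'[of "at_right (1::real)"] by (auto simp: trivial_limit_at_right_real)
  qed
  have up: "\<exists>\<theta>>1. \<theta> * l < y" if "l < y" for y
  proof -
    have "((\<lambda>\<theta>. \<theta> * l) \<longlongrightarrow> 1 * l) (at_right 1)" by (intro tendsto_intros)
    then have "eventually (\<lambda>\<theta>. \<theta> * l < y) (at_right 1)" using that by (intro order_tendstoD) auto
    then have "eventually (\<lambda>\<theta>. \<theta> * l < y \<and> \<theta> > 1) (at_right 1)"
      using eventually_at_right_less[of 1] by (rule eventually_conj)
    then show ?thesis using eventually_happens'[of "at_right (1::real)"] by (auto simp: trivial_limit_at_right_real)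
  qed
  have lower: "if av then eventually (\<lambda>L. y < integral {0..L} H / L) at_top else eventually (\<lambda>t. y < H t) at_top"
    if y: "y < l" for y
  proof -
    obtain \<theta> where "\<theta> > 1" "y < l / \<theta>" using low[OF y] by blast
    moreover from sandwich[OF this(1)] obtain h1 l1 where "tame h1" "tends_to av h1 l1"
      "eventually (\<lambda>t. h1 t \<le> H t) at_top" "l / \<theta> \<le> l1" by metis
    ultimately show ?thesis by (intro tends_to_mono[of h1 H av l1 y] H) auto
  qed
  have upper: "if av then eventually (\<lambda>L. integral {0..L} H / L < y) at_top else eventually (\<lambda>t. H t < y) at_top"
    if y: "l < y" for y
  proof -
    obtain \<theta> where "\<theta> > 1" "\<theta> * l < y" using up[OF y] by blast
    moreover from sandwich[OF this(1)] obtain h2 l2 where "tame h2" "tends_to av h2 l2"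
      "eventually (\<lambda>t. H t \<le> h2 t) at_top" "l2 \<le> \<theta> * l" by metis
    moreover from this have "tame (\<lambda>t. -1 * h2 t)" "tame (\<lambda>t. -1 * H t)" "tends_to av (\<lambda>t. -1 * h2 t) (-1 * l2)"
      using H by (blast intro: tame_cmult tends_to_cmult)+
    ultimately show ?thesis using tends_to_mono[of "\<lambda>t. -1 * h2 t" "\<lambda>t. -1 * H t" av "-1 * l2" "-y"]
      by (auto split: if_splits)
  qed
  show ?thesis
  proof (cases av)
    case True
    then show ?thesis unfolding tends_to_def using lower upper by (auto intro!: order_tendstoI)
  next
    case False
    then show ?thesis unfolding tends_to_def using lower upper by (auto intro!: order_tendstoI)
  qed
qed

section \<open>The renewal theorem\<close>

text \<open>The assumption \<open>slow\<close> says that \<open>H\<close> cannot increase quickly. It replaces uniform continuity and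
comes for free when \<open>H\<close> is a rescaled volume, because volumes of neighbourhoods decrease in \<open>t\<close>.\<close>

locale renewal_equation =
  fixes I :: "'i set" and p a :: "'i \<Rightarrow> real" and H :: "real \<Rightarrow> real" and t0 C :: real
  assumes finite_I: "finite I" and I_nonempty: "I \<noteq> {}"
    and p_pos: "\<And>i. i \<in> I \<Longrightarrow> p i > 0" and p_sum: "sum p I = 1"
    and a_pos: "\<And>i. i \<in> I \<Longrightarrow> a i > 0"
    and tame_H: "tame H" and H_nonneg: "\<And>t. H t \<ge> 0"
    and C_nonneg: "C \<ge> 0"
    and slow: "\<And>t h. h \<ge> 0 \<Longrightarrow> H (t + h) \<le> exp (C * h) * H t"
    and eq: "\<And>t. t \<ge> t0 \<Longrightarrow> H t = (\<Sum>i\<in>I. p i * H (t - a i))"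
begin

definition mean_step :: real where "mean_step = (\<Sum>i\<in>I. p i * a i)"
definition max_step :: real where "max_step = Max (a ` I)"
text \<open>A point to the left of every window that occurs after time \<open>t0\<close>, and to the left of the origin,
from which means are taken.\<close>

definition base :: real where "base = min 0 (t0 - max_step)"
text \<open>The conserved quantity, written with the primitive \<open>P\<close> of \<open>H\<close> that vanishes at \<open>base\<close>: it is
\<open>P t - \<Sum>\<^sub>i p\<^sub>i P (t - a\<^sub>i)\<close> at \<open>t = t0\<close>.\<close>

definition mass :: real where
  "mass = integral {base..t0} H - (\<Sum>i\<in>I. p i * integral {base..t0 - a i} H)"

lemma a_le: "i \<in> I \<Longrightarrow> a i \<le> max_step" unfolding max_step_def using finite_I by auto

lemma mean_step_pos: "mean_step > 0"
  unfolding mean_step_def using finite_I I_nonempty p_pos a_pos by (intro sum_pos) auto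

lemma integral_H_split: "x \<le> y \<Longrightarrow> y \<le> z \<Longrightarrow> integral {x..y} H + integral {y..z} H = integral {x..z} H"
  by (intro Henstock_Kurzweil_Integration.integral_combine tame_integrable_on tame_H)

text \<open>Integrating the renewal equation from \<open>t0\<close> to \<open>t\<close> shows that \<open>P t\<close> and \<open>\<Sum>\<^sub>i p\<^sub>i P (t - a\<^sub>i)\<close> have
the same increment.\<close>

lemma conserved_mass:
  assumes "t \<ge> t0" shows "mass = integral {base..t} H - (\<Sum>i\<in>I. p i * integral {base..t - a i} H)"
proof -
  have base: "base \<le> t0 - a i" if "i \<in> I" for i using a_le[OF that] unfolding base_def by simp
  have base0: "base \<le> t0" using I_nonempty base a_pos by force
  have "integral {t0..t} H = integral {t0..t} (\<lambda>u. \<Sum>i\<in>I. p i * H (u - a i))"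
    by (intro integral_cong eq) auto
  also have "\<dots> = (\<Sum>i\<in>I. integral {t0..t} (\<lambda>u. p i * H (u - a i)))"
    by (intro integral_sum finite_I tame_integrable_on tame_cmult tame_shift tame_H)
  also have "\<dots> = (\<Sum>i\<in>I. p i * integral {t0 - a i..t - a i} H)"
  proof (intro sum.cong refl)
    fix i
    show "integral {t0..t} (\<lambda>u. p i * H (u - a i)) = p i * integral {t0 - a i..t - a i} H"
      using integral_shift_real_ivl[of "t0 - a i" "- a i" "t - a i" H] by simp
  qed
  also have "\<dots> = (\<Sum>i\<in>I. p i * (integral {base..t - a i} H - integral {base..t0 - a i} H))"
    using base assms integral_H_split[of base "t0 - a _" "t - a _"] by (intro sum.cong refl arg_cong2[of _ _ _ _ "(*)"]) (auto simp: algebra_simps)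
  also have "\<dots> = (\<Sum>i\<in>I. p i * integral {base..t - a i} H) - (\<Sum>i\<in>I. p i * integral {base..t0 - a i} H)"
    by (simp add: algebra_simps sum_subtractf)
  finally show ?thesis using integral_H_split[of base t0 t] base0 assms unfolding mass_def by simp
qed

lemma mass_eq_window:
  assumes "t \<ge> t0" shows "mass = (\<Sum>i\<in>I. p i * integral {t - a i..t} H)"
proof -
  have "(\<Sum>i\<in>I. p i * integral {t - a i..t} H) = (\<Sum>i\<in>I. p i * integral {base..t} H - p i * integral {base..t - a i} H)"
  proof (intro sum.cong refl)
    fix i assume i: "i \<in> I"
    then have "base \<le> t - a i" "t - a i \<le> t" using a_le[OF i] a_pos[OF i] assms unfolding base_def by auto
    then show "p i * integral {t - a i..t} H = p i * integral {base..t} H - p i * integral {base..t - a i} H"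
      using integral_H_split[of base "t - a i" t, symmetric] by (simp add: distrib_left)
  qed
  also have "\<dots> = mass" using conserved_mass[OF assms] p_sum by (simp add: sum_subtractf sum_distrib_right[symmetric])
  finally show ?thesis ..
qed

definition limit :: real where "limit = mass / mean_step"

lemma limit_nonneg: "limit \<ge> 0"
proof -
  have "mass \<ge> 0" unfolding mass_eq_window[OF order_refl]
    by (intro sum_nonneg mult_nonneg_nonneg integral_nonneg tame_integrable_on tame_H H_nonneg p_pos less_imp_le)
  then show ?thesis unfolding limit_def using mean_step_pos by simp
qed

text \<open>The primitive \<open>P\<close> satisfies the renewal equation with the additional constant \<open>mass\<close>, and so does
the function \<open>limit * t\<close>. Their difference solves the homogeneous equation and is bounded by the
maximum principle; hence \<open>P t / t\<close> tends to \<open>limit\<close>.\<close>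

theorem averaged_renewal: "tends_to True H limit"
proof -
  define X where "X t = integral {base..t} H - limit * t" for t
  have X_eq: "X t = (\<Sum>i\<in>I. p i * X (t - a i))" if "t \<ge> t0" for t
  proof -
    have "(\<Sum>i\<in>I. p i * X (t - a i)) = (\<Sum>i\<in>I. p i * integral {base..t - a i} H) - limit * t * sum p I + limit * mean_step"
      unfolding X_def mean_step_def by (simp add: algebra_simps sum_subtractf sum.distrib sum_distrib_left sum_distrib_right)
    also have "limit * mean_step = mass" unfolding limit_def using mean_step_pos by simp
    finally show ?thesis using conserved_mass[OF that] p_sum unfolding X_def by simp
  qed
  define B where "B = integral {base..t0} H + \<bar>limit\<bar> * (\<bar>t0\<bar> + \<bar>max_step\<bar>)"
  have start: "\<bar>X t\<bar> \<le> B" if t: "t0 - max_step \<le> t" "t \<le> t0" for t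
  proof -
    have "base \<le> t" using t unfolding base_def by simp
    have "integral {base..t} H + integral {t..t0} H = integral {base..t0} H"
      using \<open>base \<le> t\<close> t by (intro integral_H_split)
    moreover have "integral {t..t0} H \<ge> 0" "integral {base..t} H \<ge> 0"
      by (intro integral_nonneg tame_integrable_on tame_H H_nonneg)+
    moreover have "\<bar>limit * t\<bar> \<le> \<bar>limit\<bar> * (\<bar>t0\<bar> + \<bar>max_step\<bar>)"
      unfolding abs_mult using t by (intro mult_left_mono) auto
    ultimately show ?thesis unfolding X_def B_def by linarith
  qed
  have bound: "\<bar>X t\<bar> \<le> B" if t: "t \<ge> t0 - max_step" for t
  proof -
    have "X t \<le> B"
      by (rule renewal_maximum_principle[OF finite_I I_nonempty p_pos p_sum a_pos a_le X_eq _ t])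
        (use start in \<open>auto simp: abs_le_iff\<close>)
    moreover have "- X t \<le> B"
      by (rule renewal_maximum_principle[where X = "\<lambda>t. - X t", OF finite_I I_nonempty p_pos p_sum a_pos a_le _ _ t])
        (use start X_eq in \<open>auto simp: abs_le_iff sum_negf\<close>)
    ultimately show ?thesis by (simp add: abs_le_iff)
  qed
  have "((\<lambda>L. (X L - integral {base..0} H) / L) \<longlongrightarrow> 0) at_top"
  proof (rule bounded_over_linear_tendsto_0[where B="B + \<bar>integral {base..0} H\<bar>"], rule eventually_at_top_linorderI[of "t0 - max_step"])
    fix L assume "t0 - max_step \<le> L"
    then show "\<bar>X L - integral {base..0} H\<bar> \<le> B + \<bar>integral {base..0} H\<bar>" using bound[of L] by linarith
  qed
  then have lim: "((\<lambda>L. (X L - integral {base..0} H) / L + limit) \<longlongrightarrow> 0 + limit) at_top" by (intro tendsto_intros)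
  have "eventually (\<lambda>L. (X L - integral {base..0} H) / L + limit = integral {0..L} H / L) at_top"
    using eventually_gt_at_top[of 0]
  proof eventually_elim
    case (elim L)
    have "integral {base..L} H = integral {base..0} H + integral {0..L} H"
      using integral_H_split[of base 0 L] elim unfolding base_def by simp
    then show ?case unfolding X_def using elim by (simp add: field_simps)
  qed
  from Lim_transform_eventually[OF lim this] show ?thesis unfolding tends_to_def by simp
qed

text \<open>Finitely many semigroup elements approximate a whole window of length \<open>max_step\<close>, both from below
and from above; finiteness makes the convergence along a sequence uniform on the window.\<close>

lemma window_approximation:
  assumes nonlattice: "\<not> (\<exists>c>0. \<forall>i\<in>I. \<exists>k::int. a i = c * of_int k)" and "\<eta> > 0"
  obtains S Z where "finite Z" "Z \<subseteq> additive_semigroup I a"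
    "\<And>x. S \<le> x \<Longrightarrow> x \<le> S + max_step \<Longrightarrow> \<exists>s\<in>Z. s \<le> x \<and> x \<le> s + \<eta>"
    "\<And>x. S \<le> x \<Longrightarrow> x \<le> S + max_step \<Longrightarrow> \<exists>s\<in>Z. x \<le> s \<and> s \<le> x + \<eta>"
proof -
  obtain i0 where i0: "i0 \<in> I" using I_nonempty by auto
  \<comment> \<open>Elements within \<open>h\<close> below the points of a grid of spacing \<open>h\<close>: the one for the grid point before
    \<open>x\<close> lies below \<open>x\<close>, the one two grid points later lies above, both within \<open>3 * h\<close>.\<close>
  define h where "h = \<eta> / 3"
  have h: "h > 0" using assms unfolding h_def by simp
  obtain B where B: "\<And>x. x \<ge> B \<Longrightarrow> \<exists>s\<in>additive_semigroup I a. s \<le> x \<and> x \<le> s + h"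
    using additive_semigroup_eventually_dense[OF i0 a_pos nonlattice h] by metis
  have "\<exists>s\<in>additive_semigroup I a. s \<le> B + real k * h \<and> B + real k * h \<le> s + h" for k :: nat
    using h by (intro B) simp
  then obtain s where s: "\<And>k. s k \<in> additive_semigroup I a" "\<And>k. s k \<le> B + real k * h" "\<And>k. B + real k * h \<le> s k + h"
    by metis
  obtain n :: nat where n: "max_step \<le> real n * h" using reals_Archimedean3[OF h] less_imp_le by metis
  show ?thesis
  proof (rule that[of "s ` {..n + 2}" B])
    fix x assume x: "B \<le> x" "x \<le> B + max_step"
    define k where "k = nat \<lfloor>(x - B) / h\<rfloor>"
    have "(x - B) / h \<ge> 0" using x h by simp
    then have k: "real k \<le> (x - B) / h" "(x - B) / h < real k + 1" unfolding k_def by linarith+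
    then have k': "B + real k * h \<le> x" "x < B + real k * h + h" using h by (auto simp: field_simps)
    have "real k * h \<le> real n * h" using k'(1) x(2) n by linarith
    then have kn: "k \<le> n" using h by simp
    show "\<exists>t\<in>s ` {..n + 2}. t \<le> x \<and> x \<le> t + \<eta>"
      using kn k' s(2,3)[of k] h by (intro bexI[of _ "s k"]) (auto simp: h_def)
    show "\<exists>t\<in>s ` {..n + 2}. x \<le> t \<and> t \<le> x + \<eta>"
      using kn k' s(2,3)[of "k + 2"] h by (intro bexI[of _ "s (k + 2)"]) (auto simp: h_def algebra_simps)
  qed (use s in auto)
qed

text \<open>By \<open>slow\<close>, closeness to the upper limit \<open>L\<close> at the time \<open>t - s\<close> carries over to slightly earlier times,
so \<open>s\<close> has to be approximated from below; for the lower limit it carries over to slightly later times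
and the approximation is from above. A window on which \<open>H \<ge> y\<close> gives \<open>mass \<ge> mean_step * y\<close>.\<close>

theorem nonlattice_renewal:
  assumes nonlattice: "\<not> (\<exists>c>0. \<forall>i\<in>I. \<exists>k::int. a i = c * of_int k)"
  shows "tends_to False H limit"
proof -
  have C_limit: "((\<lambda>\<eta>. exp (C * \<eta>) * (x + \<eta>)) \<longlongrightarrow> x) (at_right 0)"
    "((\<lambda>\<eta>. exp (- C * \<eta>) * (x - \<eta>)) \<longlongrightarrow> x) (at_right 0)" for x
  proof -
    have "((\<lambda>\<eta>. exp (C * \<eta>) * (x + \<eta>)) \<longlongrightarrow> exp (C * 0) * (x + 0)) (at_right 0)"
      "((\<lambda>\<eta>. exp (- C * \<eta>) * (x - \<eta>)) \<longlongrightarrow> exp (- C * 0) * (x - 0)) (at_right 0)"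
      by (intro tendsto_intros)+
    then show "((\<lambda>\<eta>. exp (C * \<eta>) * (x + \<eta>)) \<longlongrightarrow> x) (at_right 0)"
      "((\<lambda>\<eta>. exp (- C * \<eta>) * (x - \<eta>)) \<longlongrightarrow> x) (at_right 0)" by auto
  qed
  have shift: "filterlim (\<lambda>n. u n - c) at_top sequentially" if "filterlim u at_top sequentially" for u :: "nat \<Rightarrow> real" and c
    using filterlim_tendsto_add_at_top[OF tendsto_const[of "-c"] that] by simp
  have bounded: "bounded (H ` {0..})" using tame_H unfolding tame_def by blast
  have const_int: "(\<Sum>i\<in>I. p i * integral {t - a i..t} (\<lambda>_. y)) = mean_step * y" for t y
    unfolding mean_step_def sum_distrib_right using a_pos less_imp_le
    by (intro sum.cong) (auto simp: content_real)
  have window_ge: "mass \<ge> mean_step * y" if "t \<ge> t0" "\<And>v. t - max_step \<le> v \<Longrightarrow> v \<le> t \<Longrightarrow> y \<le> H v" for t y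
  proof -
    have "mass \<ge> (\<Sum>i\<in>I. p i * integral {t - a i..t} (\<lambda>_. y))"
      unfolding mass_eq_window[OF that(1)] using a_le p_pos
      by (intro sum_mono mult_left_mono integral_le tame_integrable_on tame_H tame_const that(2)) (force intro: less_imp_le)+
    then show ?thesis unfolding const_int .
  qed
  have window_le: "mass \<le> mean_step * y" if "t \<ge> t0" "\<And>v. t - max_step \<le> v \<Longrightarrow> v \<le> t \<Longrightarrow> H v \<le> y" for t y
  proof -
    have "mass \<le> (\<Sum>i\<in>I. p i * integral {t - a i..t} (\<lambda>_. y))"
      unfolding mass_eq_window[OF that(1)] using a_le p_pos
      by (intro sum_mono mult_left_mono integral_le tame_integrable_on tame_H tame_const that(2)) (force intro: less_imp_le)+
    then show ?thesis unfolding const_int .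
  qed
  have upper: "eventually (\<lambda>t. H t < limit + \<xi>) at_top" if "\<xi> > 0" for \<xi>
  proof -
    obtain L u where u: "filterlim u at_top sequentially" "(\<lambda>n. H (u n)) \<longlonglongrightarrow> L"
      and L: "\<And>\<xi>. \<xi> > 0 \<Longrightarrow> eventually (\<lambda>t. H t < L + \<xi>) at_top"
      using limsup_sequence[OF bounded] by metis
    have "exp (- C * \<eta>) * (L - \<eta>) \<le> limit" if \<eta>: "\<eta> > 0" for \<eta>
    proof -
      obtain S Z where Z: "finite Z" "Z \<subseteq> additive_semigroup I a"
        "\<And>x. S \<le> x \<Longrightarrow> x \<le> S + max_step \<Longrightarrow> \<exists>s\<in>Z. s \<le> x \<and> x \<le> s + \<eta>"
        using window_approximation[OF nonlattice \<eta>] by metis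
      have "eventually (\<lambda>n. \<forall>s\<in>Z. H (u n - s) > L - \<eta>) sequentially"
      proof (rule eventually_ball_finite[OF Z(1)], intro ballI)
        fix s assume "s \<in> Z"
        then have "(\<lambda>n. H (u n - s)) \<longlonglongrightarrow> L"
          using renewal_limsup_propagates[OF finite_I p_pos p_sum eq u L] Z(2) by auto
        then show "eventually (\<lambda>n. H (u n - s) > L - \<eta>) sequentially" using \<eta> by (intro order_tendstoD) auto
      qed
      moreover have "eventually (\<lambda>n. u n - S \<ge> t0) sequentially"
        using shift[OF u(1)] unfolding filterlim_at_top by blast
      ultimately obtain n where n: "\<forall>s\<in>Z. H (u n - s) > L - \<eta>" "u n - S \<ge> t0"
        using eventually_happens'[OF sequentially_bot eventually_conj] by blast
      have "mean_step * (exp (- C * \<eta>) * (L - \<eta>)) \<le> mass"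
      proof (rule window_ge[OF n(2)])
        fix v assume v: "u n - S - max_step \<le> v" "v \<le> u n - S"
        obtain s where s: "s \<in> Z" "s \<le> u n - v" "u n - v \<le> s + \<eta>" using Z(3)[of "u n - v"] v by force
        define h where "h = u n - s - v"
        have h: "0 \<le> h" "h \<le> \<eta>" using s unfolding h_def by auto
        have "H (u n - s) \<le> exp (C * h) * H v" using slow[OF h(1), of v] unfolding h_def by simp
        also have "\<dots> \<le> exp (C * \<eta>) * H v" using h C_nonneg H_nonneg by (intro mult_right_mono) (auto intro: mult_left_mono)
        finally have "L - \<eta> \<le> exp (C * \<eta>) * H v" using n(1) s(1) by force
        then show "exp (- C * \<eta>) * (L - \<eta>) \<le> H v" by (simp add: exp_minus field_simps)
      qed
      then show ?thesis unfolding limit_def using mean_step_pos by (simp add: field_simps)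
    qed
    then have "eventually (\<lambda>\<eta>. exp (- C * \<eta>) * (L - \<eta>) \<le> limit) (at_right 0)"
      using eventually_at_right_less[of "0::real"] by (auto elim: eventually_mono)
    then have "L \<le> limit" using tendsto_upperbound[OF C_limit(2)] trivial_limit_at_right_real by blast
    then show ?thesis using L[OF \<open>\<xi> > 0\<close>] by (auto elim: eventually_mono)
  qed
  have lower: "eventually (\<lambda>t. H t > limit - \<xi>) at_top" if "\<xi> > 0" for \<xi>
  proof -
    have "bounded ((\<lambda>t. - H t) ` {0..})" using bounded by (auto simp: bounded_iff)
    from limsup_sequence[OF this] obtain L u where u: "filterlim u at_top sequentially" "(\<lambda>n. - H (u n)) \<longlonglongrightarrow> L"
      and L: "\<And>\<xi>. \<xi> > 0 \<Longrightarrow> eventually (\<lambda>t. - H t < L + \<xi>) at_top"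
      by metis
    have eq': "- H t = (\<Sum>i\<in>I. p i * - H (t - a i))" if "t \<ge> t0" for t using eq[OF that] by (simp add: sum_negf)
    have "limit \<le> exp (C * \<eta>) * (- L + \<eta>)" if \<eta>: "\<eta> > 0" for \<eta>
    proof -
      obtain S Z where Z: "finite Z" "Z \<subseteq> additive_semigroup I a"
        "\<And>x. S \<le> x \<Longrightarrow> x \<le> S + max_step \<Longrightarrow> \<exists>s\<in>Z. x \<le> s \<and> s \<le> x + \<eta>"
        using window_approximation[OF nonlattice \<eta>] by metis
      have "eventually (\<lambda>n. \<forall>s\<in>Z. - H (u n - s) > L - \<eta>) sequentially"
      proof (rule eventually_ball_finite[OF Z(1)], intro ballI)
        fix s assume "s \<in> Z"
        then have "(\<lambda>n. - H (u n - s)) \<longlonglongrightarrow> L"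
          using renewal_limsup_propagates[of I p t0 "\<lambda>t. - H t", OF finite_I p_pos p_sum eq' u L] Z(2) by auto
        then show "eventually (\<lambda>n. - H (u n - s) > L - \<eta>) sequentially" using \<eta> by (intro order_tendstoD) auto
      qed
      moreover have "eventually (\<lambda>n. u n - S \<ge> t0) sequentially"
        using shift[OF u(1)] unfolding filterlim_at_top by blast
      ultimately obtain n where n: "\<forall>s\<in>Z. - H (u n - s) > L - \<eta>" "u n - S \<ge> t0"
        using eventually_happens'[OF sequentially_bot eventually_conj] by blast
      have "mass \<le> mean_step * (exp (C * \<eta>) * (- L + \<eta>))"
      proof (rule window_le[OF n(2)])
        fix v assume v: "u n - S - max_step \<le> v" "v \<le> u n - S"
        obtain s where s: "s \<in> Z" "u n - v \<le> s" "s \<le> u n - v + \<eta>" using Z(3)[of "u n - v"] v by force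
        define h where "h = v - (u n - s)"
        have h: "0 \<le> h" "h \<le> \<eta>" using s unfolding h_def by auto
        have "H v \<le> exp (C * h) * H (u n - s)" using slow[OF h(1), of "u n - s"] unfolding h_def by simp
        also have "\<dots> \<le> exp (C * \<eta>) * H (u n - s)" using h C_nonneg H_nonneg by (intro mult_right_mono) (auto intro: mult_left_mono)
        also have "\<dots> \<le> exp (C * \<eta>) * (- L + \<eta>)" using n(1) s(1) by (intro mult_left_mono) force+
        finally show "H v \<le> exp (C * \<eta>) * (- L + \<eta>)" .
      qed
      then show ?thesis unfolding limit_def using mean_step_pos by (simp add: field_simps)
    qed
    then have "eventually (\<lambda>\<eta>. limit \<le> exp (C * \<eta>) * (- L + \<eta>)) (at_right 0)"
      using eventually_at_right_less[of "0::real"] by (auto elim: eventually_mono)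
    then have "limit \<le> - L" using tendsto_lowerbound[OF C_limit(1)] trivial_limit_at_right_real by blast
    then show ?thesis using L[OF \<open>\<xi> > 0\<close>] by (auto elim: eventually_mono)
  qed
  have "(H \<longlongrightarrow> limit) at_top"
  proof (rule order_tendstoI)
    show "eventually (\<lambda>t. y < H t) at_top" if "y < limit" for y using lower[of "limit - y"] that by simp
    show "eventually (\<lambda>t. H t < y) at_top" if "limit < y" for y using upper[of "y - limit"] that by simp
  qed
  then show ?thesis unfolding tends_to_def by simp
qed

end

section \<open>Volumes under locally Lipschitz maps\<close>

text \<open>Subadditivity with the sum written as an integral over the index set: the covering theorem yields a
countable family without an enumeration.\<close>

lemma emeasure_UN_countable_le:
  assumes C: "countable C" and X: "\<And>i. i \<in> C \<Longrightarrow> X i \<in> sets M"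
  shows "emeasure M (\<Union>i\<in>C. X i) \<le> (\<integral>\<^sup>+i. emeasure M (X i) \<partial>count_space C)"
proof -
  define D where "D i = X i - (\<Union>j\<in>{j \<in> C. to_nat_on C j < to_nat_on C i}. X j)" for i
  have D: "D i \<in> sets M" if "i \<in> C" for i
    unfolding D_def using that X by (intro sets.Diff sets.countable_UN' countable_subset[OF _ C]) auto
  have "(\<Union>i\<in>C. X i) \<subseteq> (\<Union>i\<in>C. D i)"
  proof
    fix x assume "x \<in> (\<Union>i\<in>C. X i)"
    then obtain i where i: "i \<in> C" "x \<in> X i" by blast
    have "\<exists>i. (i \<in> C \<and> x \<in> X i) \<and> (\<forall>j. j \<in> C \<and> x \<in> X j \<longrightarrow> to_nat_on C i \<le> to_nat_on C j)"
      using ex_has_least_nat[of "\<lambda>i. i \<in> C \<and> x \<in> X i" i "to_nat_on C"] i by blast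
    then obtain k where k: "k \<in> C" "x \<in> X k" "\<forall>j. j \<in> C \<and> x \<in> X j \<longrightarrow> to_nat_on C k \<le> to_nat_on C j"
      by blast
    then have "x \<in> D k" unfolding D_def by (auto simp: not_less[symmetric])
    then show "x \<in> (\<Union>i\<in>C. D i)" using k by blast
  qed
  moreover have "D i \<subseteq> X i" for i unfolding D_def by blast
  ultimately have "(\<Union>i\<in>C. X i) = (\<Union>i\<in>C. D i)" by blast
  also have "emeasure M \<dots> = (\<integral>\<^sup>+i. emeasure M (D i) \<partial>count_space C)"
  proof (rule emeasure_UN_countable[OF _ C])
    show "disjoint_family_on D C"
      unfolding disjoint_family_on_def
    proof (intro ballI impI)
      fix i j assume ij: "i \<in> C" "j \<in> C" "i \<noteq> j"
      then have "to_nat_on C i \<noteq> to_nat_on C j" using C by simp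
      then show "D i \<inter> D j = {}" unfolding D_def using ij by (auto simp: neq_iff)
    qed
  qed (use D in auto)
  also have "\<dots> \<le> (\<integral>\<^sup>+i. emeasure M (X i) \<partial>count_space C)"
    using \<open>\<And>i. D i \<subseteq> X i\<close> X by (intro nn_integral_mono emeasure_mono) auto
  finally show ?thesis .
qed

text \<open>By Vitali's covering theorem an open set slightly larger than \<open>S\<close> is, up to a null set, a disjoint
union of balls so small that the image of a ball of radius \<open>\<rho>\<close> lies in a ball of radius \<open>A * \<rho>\<close>. The
null set is mapped to a null set. The balls are centred at points of \<open>U\<close> and have radii below the one
that the Lipschitz condition provides at the centre, which is why this condition can be pointwise.\<close>

lemma emeasure_locally_lipschitz_image_le:
  fixes g :: "'a::euclidean_space \<Rightarrow> 'a"
  assumes "open U" "compact S" "S \<subseteq> U" "A > 0"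
    and lip: "\<And>x. x \<in> U \<Longrightarrow> \<exists>r>0. \<forall>y. dist y x < r \<longrightarrow> dist (g y) (g x) \<le> A * dist y x"
  shows "emeasure lborel (g ` S) \<le> ennreal (A ^ DIM('a)) * emeasure lborel S"
proof (rule ennreal_le_epsilon)
  fix e :: real assume "e > 0"
  define e' where "e' = e / A ^ DIM('a)"
  have e': "e' > 0" "A ^ DIM('a) * e' = e" using \<open>e > 0\<close> \<open>A > 0\<close> unfolding e'_def by auto
  obtain R where R: "\<And>x. x \<in> U \<Longrightarrow> R x > 0"
      "\<And>x y. x \<in> U \<Longrightarrow> dist y x < R x \<Longrightarrow> dist (g y) (g x) \<le> A * dist y x"
    using lip by metis
  have contg: "continuous_on U g"
    unfolding continuous_on_iff
  proof (intro ballI allI impI)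
    fix x and d :: real assume "x \<in> U" "d > 0"
    show "\<exists>r>0. \<forall>y\<in>U. dist y x < r \<longrightarrow> dist (g y) (g x) < d"
    proof (intro exI[of _ "min (R x) (d / A)"] conjI ballI impI)
      fix y assume "dist y x < min (R x) (d / A)"
      then have "dist (g y) (g x) \<le> A * dist y x" "A * dist y x < d"
        using R(2)[OF \<open>x \<in> U\<close>] \<open>A > 0\<close> by (auto simp: field_simps)
      then show "dist (g y) (g x) < d" by simp
    qed (use R(1)[OF \<open>x \<in> U\<close>] \<open>d > 0\<close> \<open>A > 0\<close> in auto)
  qed
  have "S \<in> sets borel" using assms(2) by (simp add: borel_compact)
  then obtain T0 where T0: "open T0" "S \<subseteq> T0" "emeasure lborel (T0 - S) \<le> e'"
    using outer_regular_lborel_le[OF _ e'(1)] by metis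
  define T where "T = T0 \<inter> U"
  have T: "open T" "S \<subseteq> T" "T \<subseteq> U" using T0 assms unfolding T_def by auto
  have ST: "emeasure lborel T \<le> emeasure lborel S + e'"
  proof -
    have "emeasure lborel T \<le> emeasure lborel (S \<union> (T0 - S))"
      unfolding T_def using T0 \<open>S \<in> sets borel\<close> by (intro emeasure_mono) auto
    also have "\<dots> \<le> emeasure lborel S + emeasure lborel (T0 - S)"
      using T0 \<open>S \<in> sets borel\<close> by (intro emeasure_subadditive) auto
    also have "\<dots> \<le> emeasure lborel S + e'" using T0 by (intro add_left_mono)
    finally show ?thesis .
  qed
  define K where "K = {(x, \<rho>). x \<in> T \<and> 0 < \<rho> \<and> \<rho> < R x \<and> cball x \<rho> \<subseteq> T}"
  have cover: "\<exists>i. i \<in> K \<and> x \<in> cball (fst i) (snd i) \<and> snd i < d" if x: "x \<in> T" "0 < d" for x d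
  proof -
    obtain b where b: "b > 0" "cball x b \<subseteq> T" using x(1) T(1) open_contains_cball by blast
    define \<rho> where "\<rho> = min b (min (R x / 2) (d / 2))"
    have "R x > 0" using R(1) x T(3) by auto
    then have \<rho>: "0 < \<rho>" "\<rho> < R x" "\<rho> < d" "\<rho> \<le> b"
      using b(1) x(2) unfolding \<rho>_def by linarith+
    have "cball x \<rho> \<subseteq> T" using subset_cball[OF \<rho>(4), of x] b(2) by (rule subset_trans)
    then have "(x, \<rho>) \<in> K" unfolding K_def using x(1) \<rho> by simp
    then show ?thesis
      using \<rho> by (intro exI[of _ "(x, \<rho>)"]) simp
  qed
  have "0 < snd i" if "i \<in> K" for i using that unfolding K_def by auto
  from Vitali_covering_theorem_cballs[of K snd T fst, OF this cover]
  obtain C where C: "countable C" "C \<subseteq> K"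
    "pairwise (\<lambda>i j. disjnt (cball (fst i) (snd i)) (cball (fst j) (snd j))) C"
    "negligible (T - (\<Union>i\<in>C. cball (fst i) (snd i)))"
    by blast
  define N where "N = T - (\<Union>i\<in>C. cball (fst i) (snd i))"
  have gN: "negligible (g ` N)"
  proof (rule negligible_locally_Lipschitz_image)
    show "negligible N" using C(4) unfolding N_def .
    fix x assume "x \<in> N"
    then have "x \<in> U" unfolding N_def using T by auto
    then show "\<exists>T B. open T \<and> x \<in> T \<and> (\<forall>y\<in>N \<inter> T. norm (g y - g x) \<le> B * norm (y - x))"
      using R[of x] by (intro exI[of _ "ball x (R x)"] exI[of _ A]) (auto simp: dist_norm[symmetric] dist_commute)
  qed simp
  have balls: "g ` cball (fst i) (snd i) \<subseteq> cball (g (fst i)) (A * snd i)" if "i \<in> C" for i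
  proof (intro image_subsetI)
    fix y assume y: "y \<in> cball (fst i) (snd i)"
    have "i \<in> K" using that C(2) by blast
    then have i: "fst i \<in> U" "snd i < R (fst i)" using T(3) unfolding K_def by auto
    then have "dist (g y) (g (fst i)) \<le> A * dist y (fst i)" using y by (intro R) (auto simp: dist_commute)
    also have "\<dots> \<le> A * snd i" using y \<open>A > 0\<close> by (intro mult_left_mono) (auto simp: dist_commute)
    finally show "g y \<in> cball (g (fst i)) (A * snd i)" by (simp add: dist_commute)
  qed
  have vol: "emeasure lborel (cball (g (fst i)) (A * snd i)) = ennreal (A ^ DIM('a)) * emeasure lborel (cball (fst i) (snd i))"
    if "i \<in> C" for i
  proof -
    have "i \<in> K" using that C(2) by blast
    then have "snd i > 0" unfolding K_def by auto
    then show ?thesis using \<open>A > 0\<close> by (simp add: emeasure_cball power_mult_distrib ennreal_mult[symmetric] mult.left_commute)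
  qed
  have "compact (g ` S)" using contg assms by (intro compact_continuous_image) (auto intro: continuous_on_subset)
  then have gS: "g ` S \<in> sets borel" by (simp add: borel_compact)
  define V where "V = (\<Union>i\<in>C. cball (g (fst i)) (A * snd i))"
  have Vb: "V \<in> sets borel" unfolding V_def using C(1) by (intro sets.countable_UN') auto
  have total: "(\<integral>\<^sup>+i. emeasure lborel (cball (fst i) (snd i)) \<partial>count_space C) \<le> emeasure lborel T"
  proof -
    have "(\<integral>\<^sup>+i. emeasure lborel (cball (fst i) (snd i)) \<partial>count_space C) = emeasure lborel (\<Union>i\<in>C. cball (fst i) (snd i))"
    proof (rule emeasure_UN_countable[symmetric, OF _ C(1)])
      show "disjoint_family_on (\<lambda>i. cball (fst i) (snd i)) C"
        using C(3) by (simp add: pairwise_def disjoint_family_on_def disjnt_def)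
    qed simp
    also have "\<dots> \<le> emeasure lborel T"
    proof (rule emeasure_mono)
      have "cball (fst i) (snd i) \<subseteq> T" if "i \<in> C" for i
      proof -
        have "i \<in> K" using that C(2) by blast
        then show ?thesis unfolding K_def by auto
      qed
      then show "(\<Union>i\<in>C. cball (fst i) (snd i)) \<subseteq> T" by blast
    qed (use T(1) in simp)
    finally show ?thesis .
  qed
  have "emeasure lborel (g ` S) = emeasure lebesgue (g ` S)" using gS by simp
  also have "\<dots> \<le> emeasure lebesgue (V \<union> g ` N)"
  proof (rule emeasure_mono)
    show "g ` S \<subseteq> V \<union> g ` N"
    proof (rule image_subsetI)
      fix x assume "x \<in> S"
      then have "x \<in> N \<or> (\<exists>i\<in>C. x \<in> cball (fst i) (snd i))" unfolding N_def using T(2) by blast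
      then show "g x \<in> V \<union> g ` N" unfolding V_def using balls by blast
    qed
    show "V \<union> g ` N \<in> sets lebesgue" using Vb gN by (auto simp: negligible_iff_null_sets)
  qed
  also have "\<dots> = emeasure lebesgue V"
    using gN Vb by (intro emeasure_Un_null_set) (auto simp: negligible_iff_null_sets)
  also have "\<dots> = emeasure lborel V" using Vb by simp
  also have "\<dots> \<le> (\<integral>\<^sup>+i. emeasure lborel (cball (g (fst i)) (A * snd i)) \<partial>count_space C)"
    unfolding V_def using C(1) by (intro emeasure_UN_countable_le) auto
  also have "\<dots> = (\<integral>\<^sup>+i. ennreal (A ^ DIM('a)) * emeasure lborel (cball (fst i) (snd i)) \<partial>count_space C)"
    by (intro nn_integral_cong) (simp add: vol)
  also have "\<dots> = ennreal (A ^ DIM('a)) * (\<integral>\<^sup>+i. emeasure lborel (cball (fst i) (snd i)) \<partial>count_space C)"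
    by (rule nn_integral_cmult) auto
  also have "\<dots> \<le> ennreal (A ^ DIM('a)) * (emeasure lborel S + e')"
    using order_trans[OF total ST] by (intro mult_left_mono) auto
  also have "\<dots> = ennreal (A ^ DIM('a)) * emeasure lborel S + ennreal e"
    using e' \<open>A > 0\<close> by (simp add: distrib_left ennreal_mult[symmetric])
  finally show "emeasure lborel (g ` S) \<le> ennreal (A ^ DIM('a)) * emeasure lborel S + ennreal e"
    by (simp add: mult_left_mono)
qed

lemma measure_locally_lipschitz_image_le:
  fixes g :: "'a::euclidean_space \<Rightarrow> 'a"
  assumes "open U" "compact S" "S \<subseteq> U" "A > 0"
    and lip: "\<And>x. x \<in> U \<Longrightarrow> \<exists>r>0. \<forall>y. dist y x < r \<longrightarrow> dist (g y) (g x) \<le> A * dist y x"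
  shows "measure lborel (g ` S) \<le> A ^ DIM('a) * measure lborel S"
proof -
  have fin: "emeasure lborel S < \<infinity>" using emeasure_compact_finite[OF assms(2)] .
  have "measure lborel (g ` S) \<le> enn2real (ennreal (A ^ DIM('a)) * emeasure lborel S)"
    unfolding measure_def using fin
    by (intro enn2real_mono emeasure_locally_lipschitz_image_le[OF assms]) (auto simp: ennreal_mult_less_top)
  also have "\<dots> = A ^ DIM('a) * measure lborel S" using assms(4) by (simp add: enn2real_mult measure_def)
  finally show ?thesis .
qed

section \<open>Similarities and parallel neighbourhoods\<close>

definition similarity :: "('a::euclidean_space \<Rightarrow> 'a) \<Rightarrow> real \<Rightarrow> bool" where
  "similarity \<psi> \<rho> \<longleftrightarrow> 0 < \<rho> \<and> (\<forall>x y. dist (\<psi> x) (\<psi> y) = \<rho> * dist x y)"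

text \<open>After removing the translation and the ratio, an isometry fixing the origin remains, which is
an orthogonal transformation.\<close>

lemma similarity_bij: assumes "similarity \<psi> \<rho>" shows "bij \<psi>"
proof -
  define T where "T x = (1 / \<rho>) *\<^sub>R (\<psi> x - \<psi> 0)" for x
  have "dist (T x) (T y) = dist x y" for x y
  proof -
    have "dist (T x) (T y) = (1 / \<rho>) * dist (\<psi> x) (\<psi> y)"
      using assms unfolding T_def similarity_def dist_norm by (simp add: scaleR_diff_right[symmetric])
    then show ?thesis using assms by (simp add: similarity_def)
  qed
  then have "orthogonal_transformation T" unfolding orthogonal_transformation_isometry by (simp add: T_def)
  then have "surj T" by (rule orthogonal_transformation_surj)
  have "\<exists>x. \<psi> x = y" for y
  proof -
    obtain x where "T x = (1 / \<rho>) *\<^sub>R (y - \<psi> 0)" using \<open>surj T\<close> by (metis surjD)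
    then show ?thesis using assms unfolding T_def similarity_def by auto
  qed
  moreover have "inj \<psi>"
  proof (rule injI)
    fix x y assume "\<psi> x = \<psi> y"
    then have "\<rho> * dist x y = 0" using assms unfolding similarity_def by (metis dist_self)
    then show "x = y" using assms unfolding similarity_def by simp
  qed
  ultimately show ?thesis unfolding bij_def surj_def by metis
qed

lemma similarity_inv: assumes "similarity \<psi> \<rho>" shows "similarity (inv \<psi>) (1 / \<rho>)"
proof -
  have "dist (inv \<psi> x) (inv \<psi> y) = 1 / \<rho> * dist x y" for x y
  proof -
    have "dist (\<psi> (inv \<psi> x)) (\<psi> (inv \<psi> y)) = \<rho> * dist (inv \<psi> x) (inv \<psi> y)"
      using assms unfolding similarity_def by blast
    then show ?thesis using similarity_bij[OF assms] assms by (simp add: bij_is_surj surj_f_inv_f similarity_def)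
  qed
  then show ?thesis using assms unfolding similarity_def by simp
qed

lemma similarity_compose:
  assumes "similarity \<psi> \<rho>" "similarity \<psi>' \<rho>'" shows "similarity (\<psi> \<circ> \<psi>') (\<rho> * \<rho>')"
  using assms unfolding similarity_def by simp

lemma similarity_id: "similarity id 1" "similarity (\<lambda>x. x) 1" unfolding similarity_def by auto

lemma similarity_continuous: assumes "similarity \<psi> \<rho>" shows "continuous_on S \<psi>"
proof (rule continuous_on_subset[OF lipschitz_on_continuous_on subset_UNIV])
  show "\<rho>-lipschitz_on UNIV \<psi>" using assms by (intro lipschitz_onI) (auto simp: similarity_def)
qed

lemma similarity_compact: "similarity \<psi> \<rho> \<Longrightarrow> compact S \<Longrightarrow> compact (\<psi> ` S)"
  by (intro compact_continuous_image similarity_continuous)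

text \<open>A similarity and its inverse are both Lipschitz with reciprocal constants, so the volume bound is
attained.\<close>

lemma measure_similarity_image:
  fixes \<psi> :: "'a::euclidean_space \<Rightarrow> 'a"
  assumes \<psi>: "similarity \<psi> \<rho>" and S: "compact S"
  shows "measure lborel (\<psi> ` S) = \<rho> ^ DIM('a) * measure lborel S"
proof (rule antisym)
  have le: "measure lborel (\<psi> ` S) \<le> \<rho> ^ DIM('a) * measure lborel S"
    if "similarity \<psi> \<rho>" "compact S" for \<psi> :: "'a \<Rightarrow> 'a" and \<rho> S
    using that by (intro measure_locally_lipschitz_image_le[where U=UNIV]) (auto simp: similarity_def intro: exI[of _ 1])
  show "measure lborel (\<psi> ` S) \<le> \<rho> ^ DIM('a) * measure lborel S" using le[OF assms] .
  have "inv \<psi> ` \<psi> ` S = S" using similarity_bij[OF \<psi>] by (simp add: bij_is_inj image_comp)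
  then have "measure lborel S \<le> (1 / \<rho>) ^ DIM('a) * measure lborel (\<psi> ` S)"
    using le[OF similarity_inv[OF \<psi>] similarity_compact[OF \<psi> S]] by simp
  then have "\<rho> ^ DIM('a) * measure lborel S \<le> \<rho> ^ DIM('a) * ((1 / \<rho>) ^ DIM('a) * measure lborel (\<psi> ` S))"
    using \<psi> by (intro mult_left_mono) (auto simp: similarity_def)
  moreover have "\<rho> ^ DIM('a) * (1 / \<rho>) ^ DIM('a) = 1"
    using \<psi> unfolding similarity_def by (simp flip: power_mult_distrib)
  ultimately show "\<rho> ^ DIM('a) * measure lborel S \<le> measure lborel (\<psi> ` S)"
    by (simp only: mult.assoc[symmetric] mult_1)
qed

lemma parallel_nbhd_iff:
  fixes Y :: "'a::heine_borel set"
  assumes "compact Y" "Y \<noteq> {}"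
  shows "x \<in> parallel_nbhd Y \<epsilon> \<longleftrightarrow> (\<exists>y\<in>Y. dist x y \<le> \<epsilon>)"
proof -
  obtain y where "y \<in> Y" "infdist x Y = dist x y"
    using infdist_attains_inf[OF compact_imp_closed[OF assms(1)] assms(2), of x] by blast
  then show ?thesis unfolding parallel_nbhd_def using infdist_le2[of _ Y x \<epsilon>] by auto
qed

lemma parallel_nbhd_compact:
  fixes Y :: "'a::heine_borel set"
  assumes "compact Y" "Y \<noteq> {}" "\<epsilon> > 0" shows "compact (parallel_nbhd Y \<epsilon>)"
  unfolding parallel_nbhd_def using assms by (intro compact_infdist_le)

lemma parallel_nbhd_borel[measurable]: "parallel_nbhd Y \<epsilon> \<in> sets borel"
  unfolding parallel_nbhd_def by (intro borel_closed closed_Collect_le continuous_intros)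

lemma parallel_nbhd_superset: "\<epsilon> \<ge> 0 \<Longrightarrow> Y \<subseteq> parallel_nbhd Y \<epsilon>"
  unfolding parallel_nbhd_def by auto

lemma parallel_nbhd_mono: "\<epsilon> \<le> \<epsilon>' \<Longrightarrow> parallel_nbhd Y \<epsilon> \<subseteq> parallel_nbhd Y \<epsilon>'"
  unfolding parallel_nbhd_def by auto

lemma parallel_nbhd_UN:
  fixes Y :: "'w \<Rightarrow> 'a::heine_borel set"
  assumes "finite W" "W \<noteq> {}" "\<And>w. w \<in> W \<Longrightarrow> compact (Y w)" "\<And>w. w \<in> W \<Longrightarrow> Y w \<noteq> {}"
  shows "parallel_nbhd (\<Union>w\<in>W. Y w) \<epsilon> = (\<Union>w\<in>W. parallel_nbhd (Y w) \<epsilon>)"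
proof -
  have "compact (\<Union>w\<in>W. Y w)" "(\<Union>w\<in>W. Y w) \<noteq> {}" using assms by auto
  from parallel_nbhd_iff[OF this] show ?thesis
    by (intro set_eqI) (use parallel_nbhd_iff[OF assms(3,4)] in auto)
qed

lemma parallel_nbhd_similarity:
  assumes \<psi>: "similarity \<psi> \<rho>" and Y: "compact Y" "Y \<noteq> {}"
  shows "parallel_nbhd (\<psi> ` Y) \<epsilon> = \<psi> ` parallel_nbhd Y (\<epsilon> / \<rho>)"
proof -
  have "\<rho> > 0" and d: "\<And>x y. dist (\<psi> x) (\<psi> y) = \<rho> * dist x y" using \<psi> unfolding similarity_def by auto
  have image: "compact (\<psi> ` Y)" "\<psi> ` Y \<noteq> {}" using similarity_compact[OF \<psi> Y(1)] Y(2) by auto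
  have iff: "\<psi> x \<in> parallel_nbhd (\<psi> ` Y) \<epsilon> \<longleftrightarrow> x \<in> parallel_nbhd Y (\<epsilon> / \<rho>)" for x
    unfolding parallel_nbhd_iff[OF Y] parallel_nbhd_iff[OF image] using \<open>\<rho> > 0\<close> d by (simp add: field_simps)
  show ?thesis
  proof (intro set_eqI iffI)
    fix z assume z: "z \<in> parallel_nbhd (\<psi> ` Y) \<epsilon>"
    obtain x where "z = \<psi> x" using bij_is_surj[OF similarity_bij[OF \<psi>]] by (rule surjE)
    then show "z \<in> \<psi> ` parallel_nbhd Y (\<epsilon> / \<rho>)" using z iff by blast
  qed (use iff in blast)
qed

lemma parallel_nbhd_subset_open:
  fixes Y :: "'a::heine_borel set"
  assumes "compact Y" "Y \<noteq> {}" "open V" "Y \<subseteq> V"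
  obtains e where "e > 0" "parallel_nbhd Y e \<subseteq> V"
proof (cases "V = UNIV")
  case True then show ?thesis using that[of 1] by simp
next
  case False
  have "Y \<inter> - V = {}" "closed (- V)" using assms by auto
  then obtain d where d: "d > 0" "\<And>x y. x \<in> Y \<Longrightarrow> y \<in> - V \<Longrightarrow> d \<le> dist x y"
    using separate_compact_closed[OF assms(1)] by metis
  show ?thesis
  proof (rule that[of "d / 2"])
    show "parallel_nbhd Y (d / 2) \<subseteq> V"
    proof
      fix x assume "x \<in> parallel_nbhd Y (d / 2)"
      then obtain y where "y \<in> Y" "dist x y \<le> d / 2" using parallel_nbhd_iff[OF assms(1,2)] by blast
      then show "x \<in> V" using d(2)[of y x] d(1) by (auto simp: dist_commute)
    qed
  qed (use d in simp)
qed

lemma parallel_nbhds_disjoint: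
  fixes Y :: "'w \<Rightarrow> 'a::heine_borel set"
  assumes "finite W" "\<And>w. w \<in> W \<Longrightarrow> compact (Y w)" "\<And>w. w \<in> W \<Longrightarrow> Y w \<noteq> {}"
    "disjoint_family_on Y W"
  obtains e where "e > 0" "\<And>\<epsilon>. \<epsilon> \<le> e \<Longrightarrow> disjoint_family_on (\<lambda>w. parallel_nbhd (Y w) \<epsilon>) W"
proof -
  have sep: "\<exists>e>0. parallel_nbhd (Y v) e \<inter> parallel_nbhd (Y w) e = {}" if vw: "v \<in> W" "w \<in> W" "v \<noteq> w" for v w
  proof -
    have "Y v \<inter> Y w = {}" using assms(4) vw unfolding disjoint_family_on_def by auto
    then obtain d where d: "d > 0" "\<And>x y. x \<in> Y v \<Longrightarrow> y \<in> Y w \<Longrightarrow> d \<le> dist x y"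
      using separate_compact_closed[OF assms(2)[OF vw(1)] compact_imp_closed[OF assms(2)[OF vw(2)]]] by blast
    have False if x: "x \<in> parallel_nbhd (Y v) (d / 3)" "x \<in> parallel_nbhd (Y w) (d / 3)" for x
    proof -
      obtain y z where "y \<in> Y v" "z \<in> Y w" "dist x y \<le> d / 3" "dist x z \<le> d / 3"
        using x parallel_nbhd_iff[OF assms(2,3)] vw(1,2) by blast
      then show False using d(2)[of y z] dist_triangle3[of y z x] d(1) by simp
    qed
    then show ?thesis using d(1) by (intro exI[of _ "d / 3"]) auto
  qed
  have "eventually (\<lambda>\<epsilon>. \<forall>v\<in>W. \<forall>w\<in>W. v \<noteq> w \<longrightarrow> parallel_nbhd (Y v) \<epsilon> \<inter> parallel_nbhd (Y w) \<epsilon> = {}) (at_right (0::real))"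
  proof (intro eventually_ball_finite[OF assms(1)] ballI)
    fix v w assume vw: "v \<in> W" "w \<in> W"
    show "eventually (\<lambda>\<epsilon>. v \<noteq> w \<longrightarrow> parallel_nbhd (Y v) \<epsilon> \<inter> parallel_nbhd (Y w) \<epsilon> = {}) (at_right (0::real))"
    proof (cases "v = w")
      case False
      then obtain e where e: "e > 0" "parallel_nbhd (Y v) e \<inter> parallel_nbhd (Y w) e = {}" using sep vw by blast
      show ?thesis using eventually_at_right_real[OF e(1)]
      proof eventually_elim
        case (elim \<epsilon>)
        then show ?case using e(2) parallel_nbhd_mono[of \<epsilon> e] by fastforce
      qed
    qed simp
  qed
  then obtain e where e: "e > 0" "\<And>\<epsilon>. 0 < \<epsilon> \<Longrightarrow> \<epsilon> < e \<Longrightarrow> \<forall>v\<in>W. \<forall>w\<in>W. v \<noteq> w \<longrightarrow> parallel_nbhd (Y v) \<epsilon> \<inter> parallel_nbhd (Y w) \<epsilon> = {}"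
    unfolding eventually_at_right_field by blast
  show ?thesis
  proof (rule that[of "e / 2"])
    fix \<epsilon> assume "\<epsilon> \<le> e / 2"
    then have "parallel_nbhd (Y v) \<epsilon> \<subseteq> parallel_nbhd (Y v) (e / 2)" for v by (rule parallel_nbhd_mono)
    moreover have "\<forall>v\<in>W. \<forall>w\<in>W. v \<noteq> w \<longrightarrow> parallel_nbhd (Y v) (e / 2) \<inter> parallel_nbhd (Y w) (e / 2) = {}"
      using e by simp
    ultimately show "disjoint_family_on (\<lambda>w. parallel_nbhd (Y w) \<epsilon>) W"
      unfolding disjoint_family_on_def by blast
  qed (use e in simp)
qed

section \<open>Rescaled volumes\<close>

text \<open>This is \<open>\<epsilon>^(s-d) \<integral> f\<close>, integrated over \<open>Y\<^sub>\<epsilon>\<close>, at \<open>\<epsilon> = exp (-t)\<close>; the logarithmic scale turns the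
scaling of \<open>\<epsilon>\<close> into a shift of \<open>t\<close>.\<close>

definition rescaled_integral :: "(real^'d \<Rightarrow> real) \<Rightarrow> (real^'d) set \<Rightarrow> real \<Rightarrow> real \<Rightarrow> real" where
  "rescaled_integral f Y s t =
     exp ((real CARD('d) - s) * t) * (LINT x:parallel_nbhd Y (exp (- t))|lborel. f x)"

abbreviation "rescaled_volume \<equiv> rescaled_integral (\<lambda>_. 1)"

lemma rescaled_volume_eq:
  "rescaled_volume (Y :: (real^'d) set) s t =
     exp ((real CARD('d) - s) * t) * measure lborel (parallel_nbhd Y (exp (- t)))"
  unfolding rescaled_integral_def set_lebesgue_integral_def by simp

lemma set_integrable_parallel_nbhd:
  fixes f :: "'a::euclidean_space \<Rightarrow> real"
  assumes "compact Y" "Y \<noteq> {}" "\<epsilon> > 0" "continuous_on UNIV f"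
  shows "set_integrable lborel (parallel_nbhd Y \<epsilon>) f"
  unfolding set_integrable_def
  using borel_integrable_compact[OF parallel_nbhd_compact[OF assms(1-3)] continuous_on_subset[OF assms(4)]] by (simp add: indicator_def if_distrib cong: if_cong)

lemma rescaled_integral_measurable:
  fixes Y :: "(real^'d) set"
  assumes f: "continuous_on UNIV f"
  shows "rescaled_integral f Y s \<in> borel_measurable borel"
proof -
  have [measurable]: "f \<in> borel_measurable borel" using f by (rule borel_measurable_continuous_onI)
  have [measurable]: "(\<lambda>x. infdist x Y) \<in> borel_measurable borel"
    by (intro borel_measurable_continuous_onI continuous_intros)
  have "(\<lambda>t::real. LINT x|lborel. (if infdist x Y \<le> exp (- t) then f x else 0)) \<in> borel_measurable borel"
    by (rule lborel.borel_measurable_lebesgue_integral) measurable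
  then have [measurable]: "(\<lambda>t::real. LINT x:parallel_nbhd Y (exp (- t))|lborel. f x) \<in> borel_measurable borel"
    unfolding set_lebesgue_integral_def parallel_nbhd_def by (simp add: indicator_def if_distrib cong: if_cong)
  show ?thesis unfolding rescaled_integral_def[abs_def] by measurable
qed

lemma rescaled_integral_mono:
  assumes "compact Y" "Y \<noteq> {}" "continuous_on UNIV f" "continuous_on UNIV g"
    and le: "\<And>x. x \<in> parallel_nbhd Y (exp (- t)) \<Longrightarrow> f x \<le> g x"
  shows "rescaled_integral f Y s t \<le> rescaled_integral g Y s t"
  unfolding rescaled_integral_def using assms
  by (intro mult_left_mono set_integral_mono set_integrable_parallel_nbhd) auto

lemma rescaled_integral_cmult: "rescaled_integral (\<lambda>x. c * f x) Y s t = c * rescaled_integral f Y s t"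
  unfolding rescaled_integral_def by simp

lemma rescaled_integral_diff:
  assumes "compact Y" "Y \<noteq> {}" "continuous_on UNIV f" "continuous_on UNIV g"
  shows "rescaled_integral (\<lambda>x. f x - g x) Y s t = rescaled_integral f Y s t - rescaled_integral g Y s t"
  unfolding rescaled_integral_def using assms
  by (subst set_integral_diff) (auto intro!: set_integrable_parallel_nbhd simp: algebra_simps)

lemma rescaled_integral_abs_le:
  assumes "compact Y" "Y \<noteq> {}" "continuous_on UNIV f" "\<And>x. \<bar>f x\<bar> \<le> B"
  shows "\<bar>rescaled_integral f Y s t\<bar> \<le> B * rescaled_volume Y s t"
proof -
  have B: "f x \<le> B * 1" "- B * 1 \<le> f x" for x using assms(4)[of x] by (auto simp: abs_le_iff)
  have "rescaled_integral f Y s t \<le> rescaled_integral (\<lambda>x. B * 1) Y s t"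
    "rescaled_integral (\<lambda>x. - B * 1) Y s t \<le> rescaled_integral f Y s t"
    by (intro rescaled_integral_mono assms(1-3) B continuous_on_const)+
  then show ?thesis unfolding rescaled_integral_cmult by simp
qed

text \<open>Only the behaviour for large \<open>t\<close> has to be controlled: on bounded intervals the volume of a
neighbourhood is at most that of the largest one.\<close>

lemma rescaled_integral_tame:
  fixes Y :: "(real^'d) set"
  assumes Y: "compact Y" "Y \<noteq> {}" and f: "continuous_on UNIV f" "\<And>x. \<bar>f x\<bar> \<le> B"
    and bound: "\<And>t. t \<ge> T \<Longrightarrow> rescaled_volume Y s t \<le> b"
  shows "tame (rescaled_integral f Y s)"
proof (rule tameI)
  show "rescaled_integral f Y s \<in> borel_measurable borel" using f by (intro rescaled_integral_measurable)
  fix c :: real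
  have "B \<ge> 0" using f(2)[of undefined] by simp
  define V where "V = exp (\<bar>real CARD('d) - s\<bar> * (\<bar>c\<bar> + \<bar>T\<bar>)) * measure lborel (parallel_nbhd Y (exp (- c)))"
  have "rescaled_volume Y s t \<le> max b V" if "t \<ge> c" for t
  proof (cases "t \<ge> T")
    case True then show ?thesis using bound by (auto simp: max_def dest: order_trans)
  next
    case False
    have "rescaled_volume Y s t \<le> V"
      unfolding rescaled_volume_eq V_def
    proof (intro mult_mono)
      have "(real CARD('d) - s) * t \<le> \<bar>real CARD('d) - s\<bar> * \<bar>t\<bar>" by (simp add: abs_mult[symmetric])
      also have "\<dots> \<le> \<bar>real CARD('d) - s\<bar> * (\<bar>c\<bar> + \<bar>T\<bar>)" using that False by (intro mult_left_mono) auto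
      finally show "exp ((real CARD('d) - s) * t) \<le> exp (\<bar>real CARD('d) - s\<bar> * (\<bar>c\<bar> + \<bar>T\<bar>))" by simp
      show "measure lborel (parallel_nbhd Y (exp (- t))) \<le> measure lborel (parallel_nbhd Y (exp (- c)))"
        using that Y by (intro measure_mono_fmeasurable parallel_nbhd_mono fmeasurable_compact parallel_nbhd_compact) auto
    qed auto
    then show ?thesis by simp
  qed
  then have "\<bar>rescaled_integral f Y s t\<bar> \<le> B * max b V" if "t \<ge> c" for t
    using rescaled_integral_abs_le[OF Y f] that \<open>B \<ge> 0\<close> by (meson mult_left_mono order_trans)
  then show "\<exists>B. \<forall>t\<ge>c. \<bar>rescaled_integral f Y s t\<bar> \<le> B" by blast
qed

lemma rescaled_integral_split:
  fixes Y :: "'w \<Rightarrow> (real^'d) set"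
  assumes W: "finite W" "W \<noteq> {}" and Y: "\<And>w. w \<in> W \<Longrightarrow> compact (Y w)" "\<And>w. w \<in> W \<Longrightarrow> Y w \<noteq> {}"
    "disjoint_family_on Y W" and f: "continuous_on UNIV f"
  obtains T where "\<And>t. t \<ge> T \<Longrightarrow> rescaled_integral f (\<Union>w\<in>W. Y w) s t = (\<Sum>w\<in>W. rescaled_integral f (Y w) s t)"
proof -
  obtain e where e: "e > 0" "\<And>\<epsilon>. \<epsilon> \<le> e \<Longrightarrow> disjoint_family_on (\<lambda>w. parallel_nbhd (Y w) \<epsilon>) W"
    using parallel_nbhds_disjoint[OF W(1) Y] by metis
  show ?thesis
  proof (rule that[of "- ln e"])
    fix t assume "t \<ge> - ln e"
    then have t: "exp (- t) \<le> e" using e(1) by (metis exp_le_cancel_iff exp_ln minus_le_iff)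
    have "(LINT x:(\<Union>w\<in>W. parallel_nbhd (Y w) (exp (- t)))|lborel. f x) = (\<Sum>w\<in>W. LINT x:parallel_nbhd (Y w) (exp (- t))|lborel. f x)"
      using W Y f e(2)[OF t] by (intro set_integral_finite_Union set_integrable_parallel_nbhd) (auto)
    then show "rescaled_integral f (\<Union>w\<in>W. Y w) s t = (\<Sum>w\<in>W. rescaled_integral f (Y w) s t)"
      unfolding rescaled_integral_def by (simp add: parallel_nbhd_UN[OF W Y(1,2)] sum_distrib_left)
  qed
qed

text \<open>Since \<open>(\<psi> Y)\<^sub>\<epsilon> = \<psi> (Y\<^sub>\<epsilon>\<^sub>/\<^sub>\<rho>)\<close>, the volume scales by \<open>\<rho>^d\<close>, and \<open>\<rho>^d (\<epsilon>/\<rho>)^(d-s) = \<rho>^s \<epsilon>^(d-s)\<close>.\<close>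

lemma rescaled_volume_similarity:
  fixes \<psi> :: "real^'d \<Rightarrow> real^'d"
  assumes \<psi>: "similarity \<psi> \<rho>" and Y: "compact Y" "Y \<noteq> {}"
  shows "rescaled_volume (\<psi> ` Y) s t = \<rho> powr s * rescaled_volume Y s (t + ln \<rho>)"
proof -
  have \<rho>: "\<rho> > 0" using \<psi> unfolding similarity_def by simp
  have e: "exp (- t) / \<rho> = exp (- (t + ln \<rho>))" using \<rho> by (simp add: exp_diff exp_minus field_simps)
  have "measure lborel (parallel_nbhd (\<psi> ` Y) (exp (- t))) = \<rho> ^ CARD('d) * measure lborel (parallel_nbhd Y (exp (- (t + ln \<rho>))))"
    unfolding parallel_nbhd_similarity[OF \<psi> Y] e using Y
    by (subst measure_similarity_image[OF \<psi> parallel_nbhd_compact]) auto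
  moreover have "exp ((real CARD('d) - s) * t) * \<rho> ^ CARD('d) = \<rho> powr s * exp ((real CARD('d) - s) * (t + ln \<rho>))"
    using \<rho> by (simp add: powr_def powr_realpow[symmetric] exp_add[symmetric] algebra_simps)
  ultimately show ?thesis unfolding rescaled_volume_eq by (simp add: mult.assoc[symmetric])
qed

text \<open>A bounded factor of the volume disappears from \<open>ln \<lambda>(Y\<^sub>\<epsilon>) / ln \<epsilon>\<close> in the limit.\<close>

lemma minkowski_dim_of_volume_bounds:
  fixes Y :: "(real^'d) set"
  assumes "c1 > 0" and bounds: "\<And>t. t \<ge> T \<Longrightarrow> c1 \<le> rescaled_volume Y s t \<and> rescaled_volume Y s t \<le> c2"
  shows "has_minkowski_dim Y s"
proof -
  define q where "q \<epsilon> = ln (measure lborel (parallel_nbhd Y \<epsilon>)) / ln \<epsilon>" for \<epsilon>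
  define B where "B = max \<bar>ln c1\<bar> \<bar>ln c2\<bar>"
  have small: "\<bar>q \<epsilon> - (real CARD('d) - s)\<bar> \<le> B / \<bar>ln \<epsilon>\<bar>" if e: "0 < \<epsilon>" "\<epsilon> < 1" "\<epsilon> \<le> exp (- T)" for \<epsilon>
  proof -
    define v where "v = rescaled_volume Y s (- ln \<epsilon>)"
    have "ln \<epsilon> < 0" using e by simp
    have "- ln \<epsilon> \<ge> T" using e by (metis exp_ln exp_le_cancel_iff le_minus_iff)
    then have v: "c1 \<le> v" "v \<le> c2" using bounds unfolding v_def by auto
    then have "ln c1 \<le> ln v" "ln v \<le> ln c2" using \<open>c1 > 0\<close> by auto
    then have lnv: "\<bar>ln v\<bar> \<le> B" unfolding B_def by auto
    have "measure lborel (parallel_nbhd Y \<epsilon>) = exp ((real CARD('d) - s) * ln \<epsilon>) * v"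
      unfolding v_def rescaled_volume_eq using e by (simp add: exp_minus)
    then have "ln (measure lborel (parallel_nbhd Y \<epsilon>)) = (real CARD('d) - s) * ln \<epsilon> + ln v"
      using v \<open>c1 > 0\<close> by (simp add: ln_mult)
    then have "q \<epsilon> - (real CARD('d) - s) = ln v / ln \<epsilon>"
      unfolding q_def using \<open>ln \<epsilon> < 0\<close> by (simp add: field_simps)
    then show ?thesis using lnv by (simp add: divide_right_mono)
  qed
  have "((\<lambda>\<epsilon>. q \<epsilon> - (real CARD('d) - s)) \<longlongrightarrow> 0) (at_right 0)"
  proof (rule Lim_null_comparison)
    have "filterlim (\<lambda>\<epsilon>::real. \<bar>ln \<epsilon>\<bar>) at_top (at_right 0)"
      using filterlim_compose[OF filterlim_abs_real ln_at_0[unfolded filterlim_uminus_at_bot]] by simp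
    then show "((\<lambda>\<epsilon>. B / \<bar>ln \<epsilon>\<bar>) \<longlongrightarrow> 0) (at_right 0)"
      by (intro tendsto_divide_0[OF tendsto_const] filterlim_at_top_imp_at_infinity)
    have "eventually (\<lambda>\<epsilon>. 0 < \<epsilon> \<and> \<epsilon> < min 1 (exp (- T))) (at_right (0::real))"
      using eventually_at_right_real[of 0 "min 1 (exp (- T))"] by simp
    then show "eventually (\<lambda>\<epsilon>. norm (q \<epsilon> - (real CARD('d) - s)) \<le> B / \<bar>ln \<epsilon>\<bar>) (at_right 0)"
      by eventually_elim (use small in auto)
  qed
  from tendsto_add[OF this tendsto_const[of "real CARD('d) - s"]]
  have "(q \<longlongrightarrow> real CARD('d) - s) (at_right 0)" by simp
  then have "((\<lambda>\<epsilon>. ereal (q \<epsilon>)) \<longlongrightarrow> ereal (real CARD('d) - s)) (at_right 0)" by simp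
  then have "Liminf (at_right 0) (\<lambda>\<epsilon>. ereal (q \<epsilon>)) = ereal (real CARD('d) - s)"
    "Limsup (at_right 0) (\<lambda>\<epsilon>. ereal (q \<epsilon>)) = ereal (real CARD('d) - s)"
    by (auto intro: lim_imp_Liminf lim_imp_Limsup trivial_limit_at_right_real)
  then show ?thesis
    unfolding has_minkowski_dim_def upper_minkowski_dim_def lower_minkowski_dim_def q_def by simp
qed

lemma minkowski_dim_unique: "has_minkowski_dim Y s \<Longrightarrow> has_minkowski_dim Y s' \<Longrightarrow> s = s'"
  unfolding has_minkowski_dim_def by simp

section \<open>Hausdorff measure\<close>

text \<open>Caratheodory's criterion. To see that a closed set \<open>C\<close> splits \<open>A\<close> additively, exhaust \<open>A - C\<close> by the
sets \<open>D n\<close> of points at distance at least \<open>1/(n+1)\<close> from \<open>C\<close>. The remainder of \<open>A - C\<close> is covered by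
the rings \<open>R k\<close> with \<open>k \<ge> n\<close>. Rings whose indices differ by at least two are separated, so those of
one parity have total measure at most \<open>f A\<close>; hence, when this is finite, the sum over all rings
converges and its tails vanish.\<close>

lemma metric_outer_measure_borel:
  fixes f :: "'a::metric_space set \<Rightarrow> ennreal"
  assumes empty: "f {} = 0" and mono: "\<And>A B. A \<subseteq> B \<Longrightarrow> f A \<le> f B"
    and subadd: "\<And>A :: nat \<Rightarrow> 'a set. f (\<Union>i. A i) \<le> (\<Sum>i. f (A i))"
    and metric: "\<And>A B d. d > 0 \<Longrightarrow> (\<And>x y. x \<in> A \<Longrightarrow> y \<in> B \<Longrightarrow> d \<le> dist x y) \<Longrightarrow> f A + f B \<le> f (A \<union> B)"
  shows "measure_space UNIV (sets borel) f"
proof -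
  interpret sigma_algebra UNIV "UNIV :: 'a set set" using sigma_algebra_Pow[of UNIV] by simp
  have oms: "outer_measure_space UNIV f"
    unfolding outer_measure_space_def positive_def increasing_def countably_subadditive_def
    using empty mono subadd by auto
  have subadd2: "f (A \<union> B) \<le> f A + f B" for A B
  proof -
    have "(\<Union>i. (case i of 0 \<Rightarrow> A | Suc j \<Rightarrow> (case j of 0 \<Rightarrow> B | Suc _ \<Rightarrow> {}))) = A \<union> B"
      by (auto split: nat.splits)
    moreover have "(\<Sum>i. f (case i of 0 \<Rightarrow> A | Suc j \<Rightarrow> (case j of 0 \<Rightarrow> B | Suc _ \<Rightarrow> {}))) = f A + f B"
      by (subst suminf_finite[of "{0, 1}"]) (auto simp: empty split: nat.splits)
    ultimately show ?thesis using subadd[of "\<lambda>i. case i of 0 \<Rightarrow> A | Suc j \<Rightarrow> (case j of 0 \<Rightarrow> B | Suc _ \<Rightarrow> {})"] by simp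
  qed
  have closed_split: "f (A \<inter> C) + f (A - C) \<le> f A" if C: "closed C" for A C
  proof (cases "C = {} \<or> f A = \<infinity>")
    case True then show ?thesis using empty by auto
  next
    case False
    define D where "D n = {x \<in> A. 1 / (real n + 1) \<le> infdist x C}" for n
    define R where "R n = {x \<in> A. 1 / (real n + 2) \<le> infdist x C \<and> infdist x C < 1 / (real n + 1)}" for n
    have away: "d \<le> dist x y" if "infdist x C + d \<le> infdist y C" for x y d
      using infdist_triangle[of y C x] that by (simp add: dist_commute)
    have D_le: "f (A \<inter> C) + f (D n) \<le> f A" for n
    proof -
      have "f (A \<inter> C) + f (D n) \<le> f ((A \<inter> C) \<union> D n)"
        by (rule metric[of "1 / (real n + 1)"]) (auto simp: D_def intro!: away)
      also have "\<dots> \<le> f A" by (rule mono) (auto simp: D_def)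
      finally show ?thesis .
    qed
    have parity: "(\<Sum>k<n. f (R (2 * k + p))) \<le> f A" for n p :: nat
    proof -
      have "(\<Sum>k<n. f (R (2 * k + p))) \<le> f (\<Union>k<n. R (2 * k + p))"
      proof (induction n)
        case (Suc n)
        have "(\<Sum>k<Suc n. f (R (2 * k + p))) \<le> f (\<Union>k<n. R (2 * k + p)) + f (R (2 * n + p))"
          using Suc by (simp add: add_right_mono)
        also have "\<dots> \<le> f ((\<Union>k<n. R (2 * k + p)) \<union> R (2 * n + p))"
        proof (cases "n = 0")
          case False
          define m where "m = real (2 * n + p)"
          have "m > 0" using False unfolding m_def by simp
          show ?thesis
          proof (rule metric[of "1 / m - 1 / (m + 1)"])
            show "1 / m - 1 / (m + 1) > 0" using \<open>m > 0\<close> by (simp add: field_simps add_pos_pos)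
            fix x y assume x: "x \<in> (\<Union>k<n. R (2 * k + p))" and y: "y \<in> R (2 * n + p)"
            from x obtain k where k: "k < n" "1 / (real (2 * k + p) + 2) \<le> infdist x C" unfolding R_def by auto
            have "1 / m \<le> 1 / (real (2 * k + p) + 2)" using k(1) unfolding m_def by (intro divide_left_mono) auto
            then have "1 / m \<le> infdist x C" using k(2) by linarith
            moreover have "infdist y C < 1 / (m + 1)" using y unfolding R_def m_def by simp
            ultimately have "1 / m - 1 / (m + 1) \<le> dist y x" by (intro away) linarith
            then show "1 / m - 1 / (m + 1) \<le> dist x y" by (simp add: dist_commute)
          qed
        qed (simp add: empty)
        also have "(\<Union>k<n. R (2 * k + p)) \<union> R (2 * n + p) = (\<Union>k<Suc n. R (2 * k + p))"
          by (auto simp: lessThan_Suc)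
        finally show ?case .
      qed (simp add: empty)
      also have "\<dots> \<le> f A" by (rule mono) (auto simp: R_def)
      finally show ?thesis .
    qed
    have "(\<Sum>k<n. f (R k)) \<le> 2 * f A" for n
    proof -
      have double: "(\<Sum>k<2 * m. f (R k)) = (\<Sum>k<m. f (R (2 * k))) + (\<Sum>k<m. f (R (2 * k + 1)))" for m
      proof (induction m)
        case (Suc m)
        have "(\<Sum>k<2 * Suc m. f (R k)) = (\<Sum>k<2 * m. f (R k)) + f (R (2 * m)) + f (R (2 * m + 1))" by simp
        then show ?case unfolding Suc.IH by (simp add: add_ac)
      qed simp
      have 1: "(\<Sum>k<n. f (R k)) \<le> (\<Sum>k<2 * n. f (R k))" by (intro sum_mono2) auto
      have p1: "(\<Sum>k<n. f (R (2 * k + 1))) \<le> f A"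
        by (rule parity)
      have p0: "(\<Sum>k<n. f (R (2 * k + 0))) \<le> f A"
        by (rule parity)
      have p0': "(\<Sum>k<n. f (R (2 * k))) \<le> f A"
        using p0
        unfolding add_0_right 
        by assumption
      have 2: "(\<Sum>k<n. f (R (2 * k))) + (\<Sum>k<n. f (R (2 * k + 1))) \<le> f A + f A"
        by (rule add_mono[OF p0' p1])
      have 3: "f A + f A = 2 * f A" 
        by (rule mult_2[symmetric])
      show ?thesis by (rule order_trans[OF 1[unfolded double] 2[unfolded 3]])
    qed
    then have "(\<Sum>k. f (R k)) \<le> 2 * f A" by (intro suminf_le_const) auto
    moreover have "2 * f A < \<infinity>" using False by (simp add: ennreal_mult_less_top less_top)
    ultimately have S_fin: "(\<Sum>k. f (R k)) \<noteq> \<infinity>" by auto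
    have tail: "f (A - C) \<le> f (D n) + (\<Sum>k. f (R (k + n)))" for n
    proof -
      have "A - C \<subseteq> D n \<union> (\<Union>k. R (k + n))"
      proof
        fix x assume x: "x \<in> A - C"
        then have pos: "infdist x C > 0" using C False by (intro infdist_pos_not_in_closed) auto
        show "x \<in> D n \<union> (\<Union>k. R (k + n))"
        proof (cases "x \<in> D n")
          case no: False
          define P where "P m \<longleftrightarrow> 1 / (real m + 1) \<le> infdist x C" for m
          obtain m where "1 / (real m + 1) < infdist x C"
            using nat_approx_posE[OF pos] by (auto simp: field_simps)
          then have m: "P m" unfolding P_def by simp
          define l where "l = (LEAST m. P m)"
          have l: "P l" "\<And>k. k < l \<Longrightarrow> \<not> P k" unfolding l_def using m by (auto intro: LeastI dest: not_less_Least)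
          have "\<not> P n" using no x unfolding D_def P_def by simp
          have mono_P: "P b" if "P a" "a \<le> b" for a b
          proof -
            have "1 / (real b + 1) \<le> 1 / (real a + 1)" using that by (intro divide_left_mono) auto
            then show ?thesis using that unfolding P_def by linarith
          qed
          have "n < l" using mono_P[OF l(1)] \<open>\<not> P n\<close> by (meson not_less)
          then obtain k where k: "l = Suc (k + n)" using less_iff_Suc_add[of n l] by (auto simp: add.commute)
          have "\<not> P (k + n)" using l(2) k by simp
          then have "x \<in> R (k + n)" using l(1) x k unfolding R_def P_def by (auto simp: algebra_simps)
          then show ?thesis by blast
        qed simp
      qed
      then have "f (A - C) \<le> f (D n \<union> (\<Union>k. R (k + n)))" by (rule mono)
      also have "\<dots> \<le> f (D n) + f (\<Union>k. R (k + n))" by (rule subadd2)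
      also have "\<dots> \<le> f (D n) + (\<Sum>k. f (R (k + n)))" by (intro add_left_mono subadd)
      finally show ?thesis .
    qed
    \<comment> \<open>Adding the finite part of the sum to both sides avoids subtraction of extended reals; the
      finite total is cancelled after passing to the limit.\<close>
    have "f (A \<inter> C) + f (A - C) + (\<Sum>k<n. f (R k)) \<le> f A + (\<Sum>k. f (R k))" for n
    proof -
      have "f (A \<inter> C) + f (A - C) + (\<Sum>k<n. f (R k)) \<le> f (A \<inter> C) + (f (D n) + (\<Sum>k. f (R (k + n)))) + (\<Sum>k<n. f (R k))"
        using tail[of n] by (intro add_mono) auto
      also have "\<dots> = (f (A \<inter> C) + f (D n)) + (\<Sum>k. f (R k))"
        using suminf_offset[of "\<lambda>k. f (R k)" n] by (simp add: add.assoc summableI)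
      also have "\<dots> \<le> f A + (\<Sum>k. f (R k))" using D_le by (intro add_right_mono)
      finally show ?thesis .
    qed
    moreover have "(\<lambda>n. f (A \<inter> C) + f (A - C) + (\<Sum>k<n. f (R k))) \<longlonglongrightarrow> f (A \<inter> C) + f (A - C) + (\<Sum>k. f (R k))"
      by (intro tendsto_add tendsto_const summable_LIMSEQ summableI)
    ultimately have "f (A \<inter> C) + f (A - C) + (\<Sum>k. f (R k)) \<le> f A + (\<Sum>k. f (R k))"
      by (intro LIMSEQ_le_const2) auto
    then show ?thesis using S_fin by (simp add: add.commute[of _ "suminf _"])
  qed
  define L where "L = lambda_system UNIV UNIV f"
  have ms: "measure_space UNIV L f" unfolding L_def using caratheodory_lemma[OF oms] .
  have closed_L: "C \<in> L" if "closed C" for C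
    unfolding L_def lambda_system_eq
  proof (intro CollectI conjI ballI)
    fix A
    have "f A \<le> f (A \<inter> C) + f (A - C)" using subadd2[of "A \<inter> C" "A - C"] by (simp add: Int_Diff_Un)
    then show "f (A \<inter> C) + f (A - C) = f A" using closed_split[OF that] by (rule antisym[rotated])
  qed (rule UNIV_I)
  interpret L: sigma_algebra UNIV L using ms unfolding measure_space_def by (rule conjunct1)
  have borel_L: "sets (borel :: 'a measure) \<subseteq> L"
  proof -
    have "sigma_sets UNIV {C :: 'a set. closed C} \<subseteq> L" using closed_L by (intro L.sigma_sets_subset) blast
    then show ?thesis unfolding borel_eq_closed by simp
  qed
  have "countably_additive (sets borel) f"
    unfolding countably_additive_def
  proof (intro allI impI)
    fix A :: "nat \<Rightarrow> 'a set" assume A: "range A \<subseteq> sets borel" "disjoint_family A" "(\<Union>i. A i) \<in> sets borel"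
    have "countably_additive L f" using ms unfolding measure_space_def by blast
    from this[unfolded countably_additive_def, rule_format, OF subset_trans[OF A(1) borel_L] A(2) subsetD[OF borel_L A(3)]]
    show "(\<Sum>i. f (A i)) = f (\<Union>i. A i)" .
  qed
  then show ?thesis unfolding measure_space_def positive_def
    using empty sets.sigma_algebra_axioms[of "borel :: 'a measure"] by simp
qed

lemma hausdorff_weight_eq: "s > 0 \<Longrightarrow> hausdorff_weight s A = ennreal (diameter A powr s)"
  unfolding hausdorff_weight_def by auto

lemma hausdorff_pre_le:
  assumes "A \<subseteq> (\<Union>n. C n)" "\<And>n. bounded (C n)" "\<And>n. diameter (C n) \<le> \<eta>"
  shows "hausdorff_pre s \<eta> A \<le> (\<Sum>n. hausdorff_weight s (C n))"
  unfolding hausdorff_pre_def using assms by (intro INF_lower) auto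

lemma hausdorff_pre_coverE:
  assumes "hausdorff_pre s \<eta> A < x"
  obtains C :: "nat \<Rightarrow> 'a::metric_space set" where "A \<subseteq> (\<Union>n. C n)" "\<And>n. bounded (C n)" "\<And>n. diameter (C n) \<le> \<eta>"
    "(\<Sum>n. hausdorff_weight s (C n)) < x"
  using assms unfolding hausdorff_pre_def INF_less_iff by blast

lemma hausdorff_pre_greatest:
  assumes "\<And>C :: nat \<Rightarrow> 'a::metric_space set. A \<subseteq> (\<Union>n. C n) \<Longrightarrow> (\<And>n. bounded (C n)) \<Longrightarrow> (\<And>n. diameter (C n) \<le> \<eta>)
    \<Longrightarrow> x \<le> (\<Sum>n. hausdorff_weight s (C n))"
  shows "x \<le> hausdorff_pre s \<eta> A"
  unfolding hausdorff_pre_def using assms by (intro INF_greatest) auto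

lemma hausdorff_pre_mono: "A \<subseteq> B \<Longrightarrow> hausdorff_pre s \<eta> A \<le> hausdorff_pre s \<eta> B"
  by (rule hausdorff_pre_greatest, rule hausdorff_pre_le) auto

lemma hausdorff_pre_antimono: "\<eta> \<le> \<eta>' \<Longrightarrow> hausdorff_pre s \<eta>' A \<le> hausdorff_pre s \<eta> A"
  by (rule hausdorff_pre_greatest, rule hausdorff_pre_le) (auto intro: order_trans)

lemma hausdorff_pre_empty: assumes "\<eta> \<ge> 0" shows "hausdorff_pre s \<eta> {} = 0"
proof -
  have "hausdorff_pre s \<eta> ({} :: 'a set) \<le> (\<Sum>n::nat. hausdorff_weight s ({} :: 'a set))"
    using assms by (intro hausdorff_pre_le) auto
  then show ?thesis by (simp add: hausdorff_weight_def)
qed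

lemma hausdorff_pre_subadditive:
  fixes A :: "nat \<Rightarrow> 'a::metric_space set"
  shows "hausdorff_pre s \<eta> (\<Union>i. A i) \<le> (\<Sum>i. hausdorff_pre s \<eta> (A i))"
proof (rule ennreal_le_epsilon)
  fix e :: real assume "0 < e" "(\<Sum>n. hausdorff_pre s \<eta> (A n)) < top"
  then have *: "hausdorff_pre s \<eta> (A n) < hausdorff_pre s \<eta> (A n) + e * (1/2)^Suc n" for n
    by (auto simp add: less_top dest!: ennreal_suminf_lessD)
  have "\<exists>C :: nat \<Rightarrow> 'a set. A n \<subseteq> (\<Union>n. C n) \<and> (\<forall>n. bounded (C n) \<and> diameter (C n) \<le> \<eta>) \<and>
    (\<Sum>n. hausdorff_weight s (C n)) \<le> hausdorff_pre s \<eta> (A n) + e * (1/2)^Suc n" for n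
    using hausdorff_pre_coverE[OF *[of n]] by (metis less_imp_le)
  then obtain B :: "nat \<Rightarrow> nat \<Rightarrow> 'a set" where B: "\<And>n. A n \<subseteq> (\<Union>m. B n m)" "\<And>n m. bounded (B n m) \<and> diameter (B n m) \<le> \<eta>"
    "\<And>n. (\<Sum>m. hausdorff_weight s (B n m)) \<le> hausdorff_pre s \<eta> (A n) + e * (1/2)^Suc n"
    by metis
  define C where "C = case_prod B o prod_decode"
  have "(\<Union>i. A i) \<subseteq> (\<Union>i. C i)"
  proof
    fix x assume "x \<in> (\<Union>i. A i)"
    then obtain n m where "x \<in> B n m" using B(1) by blast
    then have "x \<in> C (prod_encode (n, m))" unfolding C_def by simp
    then show "x \<in> (\<Union>i. C i)" by blast
  qed
  then have "hausdorff_pre s \<eta> (\<Union>i. A i) \<le> (\<Sum>i. hausdorff_weight s (C i))"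
    using B(2) by (intro hausdorff_pre_le) (auto simp: C_def split: prod.split)
  also have "\<dots> = (\<Sum>n. \<Sum>m. hausdorff_weight s (B n m))"
    unfolding C_def comp_def
    using suminf_ennreal_2dimen[of "\<lambda>n. \<Sum>m. hausdorff_weight s (B n m)" "\<lambda>(n, m). hausdorff_weight s (B n m)"]
    by (simp add: case_prod_beta)
  also have "\<dots> \<le> (\<Sum>n. hausdorff_pre s \<eta> (A n) + e * (1/2) ^ Suc n)"
    by (intro suminf_le allI B summableI)
  also have "... = (\<Sum>n. hausdorff_pre s \<eta> (A n)) + (\<Sum>n. ennreal e * ennreal ((1/2) ^ Suc n))"
    using \<open>0 < e\<close> by (subst suminf_add[symmetric])
                     (auto simp del: ennreal_suminf_cmult simp add: ennreal_mult[symmetric])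
  also have "\<dots> = (\<Sum>n. hausdorff_pre s \<eta> (A n)) + e"
    unfolding ennreal_suminf_cmult
    by (subst suminf_ennreal_eq[OF zero_le_power power_half_series]) auto
  finally show "hausdorff_pre s \<eta> (\<Union>i. A i) \<le> (\<Sum>n. hausdorff_pre s \<eta> (A n)) + e" .
qed

lemma hausdorff_pre_finite_subadditive:
  assumes "finite W" "\<eta> \<ge> 0"
  shows "hausdorff_pre s \<eta> (\<Union>w\<in>W. A w) \<le> (\<Sum>w\<in>W. hausdorff_pre s \<eta> (A w))"
proof -
  obtain xs where xs: "distinct xs" "set xs = W" using finite_distinct_list[OF assms(1)] by auto
  define B where "B i = (if i < length xs then A (xs ! i) else {})" for i
  have "(\<Union>w\<in>W. A w) = (\<Union>i. B i)" unfolding B_def xs(2)[symmetric] by (fastforce simp: in_set_conv_nth split: if_splits)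
  then have "hausdorff_pre s \<eta> (\<Union>w\<in>W. A w) \<le> (\<Sum>i. hausdorff_pre s \<eta> (B i))" using hausdorff_pre_subadditive by metis
  also have "\<dots> = (\<Sum>i<length xs. hausdorff_pre s \<eta> (B i))"
    by (rule suminf_finite) (auto simp: B_def hausdorff_pre_empty[OF assms(2)])
  also have "\<dots> = (\<Sum>i<length xs. hausdorff_pre s \<eta> (A (xs ! i)))" by (simp add: B_def)
  also have "\<dots> = (\<Sum>w\<in>W. hausdorff_pre s \<eta> (A w))"
    by (rule sum.reindex_bij_betw[OF bij_betw_nth[OF xs(1) refl xs(2)[symmetric]]])
  finally show ?thesis .
qed

lemma hausdorff_pre_le_outer: "\<eta> > 0 \<Longrightarrow> hausdorff_pre s \<eta> A \<le> hausdorff_outer s A"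
  unfolding hausdorff_outer_def by (rule SUP_upper) simp

lemma hausdorff_outer_least: "(\<And>\<eta>. \<eta> > 0 \<Longrightarrow> hausdorff_pre s \<eta> A \<le> x) \<Longrightarrow> hausdorff_outer s A \<le> x"
  unfolding hausdorff_outer_def by (rule SUP_least) simp

lemma hausdorff_outer_empty: "hausdorff_outer s {} = 0"
  unfolding hausdorff_outer_def by (simp add: hausdorff_pre_empty less_imp_le cong: SUP_cong_simp)

text \<open>A set of diameter below \<open>d\<close> cannot meet both \<open>A\<close> and \<open>B\<close>, so a fine cover of the union splits
into covers of the two sets.\<close>

lemma hausdorff_outer_metric:
  fixes A B :: "'a::metric_space set"
  assumes "d > 0" and sep: "\<And>x y. x \<in> A \<Longrightarrow> y \<in> B \<Longrightarrow> d \<le> dist x y"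
  shows "hausdorff_outer s A + hausdorff_outer s B \<le> hausdorff_outer s (A \<union> B)"
proof -
  have pre: "hausdorff_pre s \<eta> A + hausdorff_pre s \<eta> B \<le> hausdorff_pre s \<eta> (A \<union> B)" if "0 < \<eta>" "\<eta> < d" for \<eta>
  proof (rule hausdorff_pre_greatest)
    fix C :: "nat \<Rightarrow> 'a set" assume C: "A \<union> B \<subseteq> (\<Union>n. C n)" "\<And>n. bounded (C n)" "\<And>n. diameter (C n) \<le> \<eta>"
    define CA where "CA n = (if C n \<inter> A = {} then {} else C n)" for n
    define CB where "CB n = (if C n \<inter> B = {} then {} else C n)" for n
    have "A \<subseteq> (\<Union>n. CA n)" "B \<subseteq> (\<Union>n. CB n)"
      using C(1) unfolding CA_def CB_def by (fastforce simp: disjoint_iff)+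
    have "hausdorff_pre s \<eta> A \<le> (\<Sum>n. hausdorff_weight s (CA n))"
      using C(2,3) \<open>0 < \<eta>\<close> by (intro hausdorff_pre_le \<open>A \<subseteq> (\<Union>n. CA n)\<close>) (auto simp: CA_def)
    moreover have "hausdorff_pre s \<eta> B \<le> (\<Sum>n. hausdorff_weight s (CB n))"
      using C(2,3) \<open>0 < \<eta>\<close> by (intro hausdorff_pre_le \<open>B \<subseteq> (\<Union>n. CB n)\<close>) (auto simp: CB_def)
    ultimately have "hausdorff_pre s \<eta> A + hausdorff_pre s \<eta> B \<le> (\<Sum>n. hausdorff_weight s (CA n)) + (\<Sum>n. hausdorff_weight s (CB n))"
      by (rule add_mono)
    also have "\<dots> = (\<Sum>n. hausdorff_weight s (CA n) + hausdorff_weight s (CB n))" by (intro suminf_add summableI)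
    also have "\<dots> \<le> (\<Sum>n. hausdorff_weight s (C n))"
    proof (intro suminf_le summableI allI)
      fix n
      have "C n \<inter> A = {} \<or> C n \<inter> B = {}"
      proof (rule ccontr)
        assume "\<not> ?thesis"
        then obtain x y where "x \<in> C n" "x \<in> A" "y \<in> C n" "y \<in> B" by auto
        then have "d \<le> diameter (C n)" using sep diameter_bounded_bound[OF C(2)] by (meson order_trans)
        then show False using C(3)[of n] \<open>\<eta> < d\<close> by simp
      qed
      then show "hausdorff_weight s (CA n) + hausdorff_weight s (CB n) \<le> hausdorff_weight s (C n)"
        unfolding CA_def CB_def by (auto simp: hausdorff_weight_def[of s "{}"])
    qed
    finally show "hausdorff_pre s \<eta> A + hausdorff_pre s \<eta> B \<le> (\<Sum>n. hausdorff_weight s (C n))" .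
  qed
  have all: "hausdorff_pre s \<eta>1 A + hausdorff_pre s \<eta>2 B \<le> hausdorff_outer s (A \<union> B)" if "\<eta>1 > 0" "\<eta>2 > 0" for \<eta>1 \<eta>2
  proof -
    define \<eta> where "\<eta> = min (min \<eta>1 \<eta>2) (d / 2)"
    have \<eta>: "0 < \<eta>" "\<eta> < d" "\<eta> \<le> \<eta>1" "\<eta> \<le> \<eta>2" unfolding \<eta>_def using that \<open>d > 0\<close> by auto
    have "hausdorff_pre s \<eta>1 A + hausdorff_pre s \<eta>2 B \<le> hausdorff_pre s \<eta> A + hausdorff_pre s \<eta> B"
      using \<eta> by (intro add_mono hausdorff_pre_antimono)
    also have "\<dots> \<le> hausdorff_outer s (A \<union> B)" using pre[OF \<eta>(1,2)] hausdorff_pre_le_outer[OF \<eta>(1)] by (rule order_trans)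
    finally show ?thesis .
  qed
  have "hausdorff_outer s A + hausdorff_outer s B = (SUP \<eta>2\<in>{0<..}. hausdorff_outer s A + hausdorff_pre s \<eta>2 B)"
    unfolding hausdorff_outer_def[of s B] by (rule ennreal_SUP_add_right) auto
  also have "\<dots> \<le> hausdorff_outer s (A \<union> B)"
  proof (rule SUP_least)
    fix \<eta>2 :: real assume "\<eta>2 \<in> {0<..}"
    have "hausdorff_outer s A + hausdorff_pre s \<eta>2 B = (SUP \<eta>1\<in>{0<..}. hausdorff_pre s \<eta>1 A + hausdorff_pre s \<eta>2 B)"
      unfolding hausdorff_outer_def[of s A] by (rule ennreal_SUP_add_left[symmetric]) auto
    also have "\<dots> \<le> hausdorff_outer s (A \<union> B)" using all \<open>\<eta>2 \<in> {0<..}\<close> by (intro SUP_least) auto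
    finally show "hausdorff_outer s A + hausdorff_pre s \<eta>2 B \<le> hausdorff_outer s (A \<union> B)" .
  qed
  finally show ?thesis .
qed

text \<open>Without this fact \<open>hausdorff_measure\<close> would be the zero measure, the value of \<open>measure_of\<close> at
functions that are not countably additive.\<close>

theorem hausdorff_outer_measure_space:
  "measure_space (UNIV :: 'a::metric_space set) (sets borel) (hausdorff_outer s)"
proof (rule metric_outer_measure_borel)
  show "hausdorff_outer s ({} :: 'a set) = 0" by (rule hausdorff_outer_empty)
  show "hausdorff_outer s A \<le> hausdorff_outer s B" if "A \<subseteq> B" for A B :: "'a set"
    unfolding hausdorff_outer_def using that by (intro SUP_mono') (rule hausdorff_pre_mono)
  show "hausdorff_outer s (\<Union>i. A i) \<le> (\<Sum>i. hausdorff_outer s (A i))" for A :: "nat \<Rightarrow> 'a set"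
  proof (rule hausdorff_outer_least)
    fix \<eta> :: real assume "\<eta> > 0"
    have "hausdorff_pre s \<eta> (\<Union>i. A i) \<le> (\<Sum>i. hausdorff_pre s \<eta> (A i))" by (rule hausdorff_pre_subadditive)
    also have "\<dots> \<le> (\<Sum>i. hausdorff_outer s (A i))"
      using \<open>\<eta> > 0\<close> by (intro suminf_le summableI allI hausdorff_pre_le_outer)
    finally show "hausdorff_pre s \<eta> (\<Union>i. A i) \<le> (\<Sum>i. hausdorff_outer s (A i))" .
  qed
qed (rule hausdorff_outer_metric)

lemma hausdorff_measure_simps[simp]:
  "space (hausdorff_measure s :: 'a::metric_space measure) = UNIV"
  "sets (hausdorff_measure s :: 'a::metric_space measure) = sets borel"
  unfolding hausdorff_measure_def
  using sets.space_closed[of "borel :: 'a measure"] sets.sigma_sets_eq[of "borel :: 'a measure"] by auto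

lemma emeasure_hausdorff_measure:
  fixes A :: "'a::metric_space set"
  assumes "A \<in> sets borel" shows "emeasure (hausdorff_measure s) A = hausdorff_outer s A"
  unfolding hausdorff_measure_def
proof (rule emeasure_measure_of_sigma)
  show "sigma_algebra (UNIV :: 'a set) (sets borel)" using sets.sigma_algebra_axioms[of "borel :: 'a measure"] by simp
qed (use hausdorff_outer_measure_space[where 'a='a, of s] assms in \<open>auto simp: measure_space_def\<close>)

lemma diameter_similarity_le:
  assumes \<psi>: "similarity \<psi> \<rho>" and C: "bounded C"
  shows "diameter (\<psi> ` C) \<le> \<rho> * diameter C"
proof (rule diameter_le)
  show "\<psi> ` C \<noteq> {} \<or> 0 \<le> \<rho> * diameter C"
    using diameter_ge_0[OF C] \<psi> by (simp add: similarity_def)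
  fix x y assume "x \<in> \<psi> ` C" "y \<in> \<psi> ` C"
  then show "norm (x - y) \<le> \<rho> * diameter C"
    using diameter_bounded_bound[OF C] \<psi> by (auto simp: similarity_def dist_norm[symmetric])
qed

lemma bounded_similarity_image:
  assumes \<psi>: "similarity \<psi> \<rho>" and C: "bounded C" shows "bounded (\<psi> ` C)"
  unfolding bounded_two_points
proof (intro exI ballI)
  fix x y assume "x \<in> \<psi> ` C" "y \<in> \<psi> ` C"
  then show "dist x y \<le> \<rho> * diameter C"
    using diameter_bounded_bound[OF C] \<psi> by (auto simp: similarity_def)
qed

lemma hausdorff_pre_similarity_le:
  assumes \<psi>: "similarity \<psi> \<rho>" and "s > 0" and \<eta>: "\<eta>' \<ge> \<rho> * \<eta>"
  shows "hausdorff_pre s \<eta>' (\<psi> ` A) \<le> ennreal (\<rho> powr s) * hausdorff_pre s \<eta> A"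
proof -
  have \<rho>: "\<rho> > 0" using \<psi> by (simp add: similarity_def)
  have inverse: "ennreal ((1 / \<rho>) powr s) * (ennreal (\<rho> powr s) * x) = x" "ennreal (\<rho> powr s) * (ennreal ((1 / \<rho>) powr s) * x) = x" for x
    using \<rho> by (simp_all add: mult.assoc[symmetric] ennreal_mult[symmetric] powr_mult[symmetric])
  have "ennreal ((1 / \<rho>) powr s) * hausdorff_pre s \<eta>' (\<psi> ` A) \<le> hausdorff_pre s \<eta> A"
  proof (rule hausdorff_pre_greatest)
    fix C :: "nat \<Rightarrow> 'a set" assume C: "A \<subseteq> (\<Union>n. C n)" "\<And>n. bounded (C n)" "\<And>n. diameter (C n) \<le> \<eta>"
    have "hausdorff_pre s \<eta>' (\<psi> ` A) \<le> (\<Sum>n. hausdorff_weight s (\<psi> ` C n))"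
    proof (rule hausdorff_pre_le)
      show "\<psi> ` A \<subseteq> (\<Union>n. \<psi> ` C n)" using C(1) by blast
      show "bounded (\<psi> ` C n)" for n using bounded_similarity_image[OF \<psi> C(2)] .
      show "diameter (\<psi> ` C n) \<le> \<eta>'" for n
        using diameter_similarity_le[OF \<psi> C(2), of n] mult_left_mono[OF C(3), of \<rho> n] \<rho> \<eta> by linarith
    qed
    also have "\<dots> \<le> (\<Sum>n. ennreal (\<rho> powr s) * hausdorff_weight s (C n))"
    proof (intro suminf_le summableI allI)
      fix n
      have "diameter (\<psi> ` C n) powr s \<le> (\<rho> * diameter (C n)) powr s"
        using \<open>s > 0\<close> by (intro powr_mono2 diameter_similarity_le \<psi> C diameter_ge_0 bounded_similarity_image[OF \<psi>]) auto
      also have "\<dots> = \<rho> powr s * diameter (C n) powr s" by (rule powr_mult)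
      finally show "hausdorff_weight s (\<psi> ` C n) \<le> ennreal (\<rho> powr s) * hausdorff_weight s (C n)"
        using \<open>s > 0\<close> by (simp add: hausdorff_weight_eq ennreal_mult[symmetric])
    qed
    also have "\<dots> = ennreal (\<rho> powr s) * (\<Sum>n. hausdorff_weight s (C n))" by simp
    finally have "ennreal ((1 / \<rho>) powr s) * hausdorff_pre s \<eta>' (\<psi> ` A)
      \<le> ennreal ((1 / \<rho>) powr s) * (ennreal (\<rho> powr s) * (\<Sum>n. hausdorff_weight s (C n)))"
      by (rule mult_left_mono) simp
    then show "ennreal ((1 / \<rho>) powr s) * hausdorff_pre s \<eta>' (\<psi> ` A) \<le> (\<Sum>n. hausdorff_weight s (C n))"
      unfolding inverse .
  qed
  then have "ennreal (\<rho> powr s) * (ennreal ((1 / \<rho>) powr s) * hausdorff_pre s \<eta>' (\<psi> ` A)) \<le> ennreal (\<rho> powr s) * hausdorff_pre s \<eta> A"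
    by (rule mult_left_mono) simp
  then show ?thesis unfolding inverse .
qed

lemma hausdorff_outer_similarity:
  assumes \<psi>: "similarity \<psi> \<rho>" and "s > 0"
  shows "hausdorff_outer s (\<psi> ` A) = ennreal (\<rho> powr s) * hausdorff_outer s A"
proof -
  have le: "hausdorff_outer s (\<psi> ` A) \<le> ennreal (\<rho> powr s) * hausdorff_outer s A"
    if "similarity \<psi> \<rho>" for \<psi> :: "'a \<Rightarrow> 'a" and \<rho> A
  proof (rule hausdorff_outer_least)
    fix \<eta> :: real assume "\<eta> > 0"
    have \<rho>: "\<rho> > 0" using that by (simp add: similarity_def)
    have "hausdorff_pre s \<eta> (\<psi> ` A) \<le> ennreal (\<rho> powr s) * hausdorff_pre s (\<eta> / \<rho>) A"
      using \<rho> by (intro hausdorff_pre_similarity_le[OF that \<open>s > 0\<close>]) simp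
    also have "\<dots> \<le> ennreal (\<rho> powr s) * hausdorff_outer s A"
      using \<rho> \<open>\<eta> > 0\<close> by (intro mult_left_mono hausdorff_pre_le_outer) auto
    finally show "hausdorff_pre s \<eta> (\<psi> ` A) \<le> ennreal (\<rho> powr s) * hausdorff_outer s A" .
  qed
  have \<rho>: "\<rho> > 0" using \<psi> by (simp add: similarity_def)
  have "inv \<psi> ` \<psi> ` A = A" using similarity_bij[OF \<psi>] by (simp add: bij_is_inj image_comp)
  then have "hausdorff_outer s A \<le> ennreal ((1 / \<rho>) powr s) * hausdorff_outer s (\<psi> ` A)"
    using le[OF similarity_inv[OF \<psi>], of "\<psi> ` A"] by simp
  then have "ennreal (\<rho> powr s) * hausdorff_outer s A \<le> ennreal (\<rho> powr s) * (ennreal ((1 / \<rho>) powr s) * hausdorff_outer s (\<psi> ` A))"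
    by (rule mult_left_mono) simp
  also have "\<dots> = hausdorff_outer s (\<psi> ` A)"
    using \<rho> by (simp add: mult.assoc[symmetric] ennreal_mult[symmetric] powr_mult[symmetric])
  finally show ?thesis using le[OF \<psi>] by (intro antisym)
qed

section \<open>Self-similar sets with strong separation\<close>

lemma similarity_dimension_exists:
  fixes r :: "'i \<Rightarrow> real"
  assumes "finite I" "card I \<ge> 2" "\<And>i. i \<in> I \<Longrightarrow> 0 < r i" "\<And>i. i \<in> I \<Longrightarrow> r i < 1"
  obtains s where "s > 0" "(\<Sum>i\<in>I. r i powr s) = 1"
proof -
  have nz: "r i \<noteq> 0" if "i \<in> I" for i using assms(3)[OF that] by simp
  define q where "q = Max (r ` I)"
  have ne: "I \<noteq> {}" using assms(2) by auto
  then have q: "0 < q" "q < 1" "\<And>i. i \<in> I \<Longrightarrow> r i \<le> q"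
    using assms unfolding q_def by (auto simp: Max_gr_iff)
  define S where "S = ln (real (card I)) / - ln q"
  have "ln q < 0" using q by simp
  have "S \<ge> 0" unfolding S_def using assms(2) \<open>ln q < 0\<close> by (intro divide_nonneg_pos) auto
  have "q powr S = 1 / real (card I)"
    unfolding powr_def S_def using q \<open>ln q < 0\<close> assms(2) by (simp add: exp_minus inverse_eq_divide)
  moreover have "(\<Sum>i\<in>I. r i powr S) \<le> (\<Sum>i\<in>I. q powr S)"
    using assms(3) q(3) \<open>S \<ge> 0\<close> by (intro sum_mono powr_mono2) (auto intro: less_imp_le)
  ultimately have "(\<Sum>i\<in>I. r i powr S) \<le> 1" using assms(2) by simp
  moreover have at0: "(\<Sum>i\<in>I. r i powr 0) = real (card I)"
  proof -
    have "(\<Sum>i\<in>I. r i powr 0) = (\<Sum>i\<in>I. 1)" using nz by (intro sum.cong) auto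
    then show ?thesis by simp
  qed
  moreover have "isCont (\<lambda>s. \<Sum>i\<in>I. r i powr s) s" for s
    using nz by (intro continuous_intros) auto
  ultimately obtain s where s: "0 \<le> s" "s \<le> S" "(\<Sum>i\<in>I. r i powr s) = 1"
    using IVT2[of "\<lambda>s. \<Sum>i\<in>I. r i powr s" S 1 0] \<open>S \<ge> 0\<close> assms(2) by auto
  have "s \<noteq> 0" using at0 assms(2) s(3) by auto
  show ?thesis by (rule that[of s]) (use s \<open>s \<noteq> 0\<close> in auto)
qed

text \<open>Here \<open>\<delta>\<close> is the similarity dimension; that it is the Minkowski dimension is proved below.\<close>

locale self_similar =
  fixes \<phi> :: "nat \<Rightarrow> real^'d \<Rightarrow> real^'d" and r :: "nat \<Rightarrow> real" and N :: nat and K :: "(real^'d) set" and \<delta> :: real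
  assumes N: "N \<ge> 2"
    and contracting: "\<And>i. i \<in> {1..N} \<Longrightarrow> contracting_similarity (\<phi> i) (r i)"
    and invariant: "invariant_set N \<phi> K"
    and separated: "strong_separation N \<phi> K"
    and \<delta>_pos: "\<delta> > 0" and ratio_sum: "(\<Sum>i\<in>{1..N}. r i powr \<delta>) = 1"
begin

lemma similarity_phi: "i \<in> {1..N} \<Longrightarrow> similarity (\<phi> i) (r i)"
  using contracting unfolding contracting_similarity_def similarity_def by auto

lemma r_pos: "i \<in> {1..N} \<Longrightarrow> 0 < r i" and r_lt_1: "i \<in> {1..N} \<Longrightarrow> r i < 1"
  using contracting unfolding contracting_similarity_def by auto

lemma compact_K: "compact K" and K_nonempty: "K \<noteq> {}" and K_eq: "K = (\<Union>i\<in>{1..N}. \<phi> i ` K)"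
  using invariant unfolding invariant_set_def by auto

lemma pieces_disjoint: "i \<in> {1..N} \<Longrightarrow> j \<in> {1..N} \<Longrightarrow> i \<noteq> j \<Longrightarrow> \<phi> i ` K \<inter> \<phi> j ` K = {}"
  using separated unfolding strong_separation_def by blast

definition V :: "real \<Rightarrow> real" where "V = rescaled_volume K \<delta>"

text \<open>A rate such that \<open>V (t + h) \<le> exp (growth * h) * V t\<close>. The absolute value makes it nonnegative
without a comparison of \<open>\<delta>\<close> with the dimension of the space.\<close>

definition growth :: real where "growth = \<bar>real CARD('d) - \<delta>\<bar>"

lemma volume_renewal_eq:
  obtains t0 where "\<And>t. t \<ge> t0 \<Longrightarrow> V t = (\<Sum>i\<in>{1..N}. r i powr \<delta> * V (t - (- ln (r i))))"
proof -
  obtain T where T: "\<And>t. t \<ge> T \<Longrightarrow> rescaled_volume (\<Union>i\<in>{1..N}. \<phi> i ` K) \<delta> t = (\<Sum>i\<in>{1..N}. rescaled_volume (\<phi> i ` K) \<delta> t)"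
  proof (rule rescaled_integral_split[of "{1..N}" "\<lambda>i. \<phi> i ` K" "\<lambda>_. 1" \<delta>])
    show "disjoint_family_on (\<lambda>i. \<phi> i ` K) {1..N}" unfolding disjoint_family_on_def using pieces_disjoint by blast
    show "compact (\<phi> i ` K)" if "i \<in> {1..N}" for i using similarity_compact[OF similarity_phi[OF that] compact_K] .
  qed (use N K_nonempty in auto)
  show ?thesis
  proof (rule that)
    fix t assume "t \<ge> T"
    then have "V t = (\<Sum>i\<in>{1..N}. rescaled_volume (\<phi> i ` K) \<delta> t)" using T K_eq unfolding V_def by simp
    also have "\<dots> = (\<Sum>i\<in>{1..N}. r i powr \<delta> * V (t - (- ln (r i))))"
      unfolding V_def by (intro sum.cong refl) (simp add: rescaled_volume_similarity[OF similarity_phi compact_K K_nonempty])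
    finally show "V t = (\<Sum>i\<in>{1..N}. r i powr \<delta> * V (t - (- ln (r i))))" .
  qed
qed

lemma nbhd_volume_mono:
  "0 < \<epsilon> \<Longrightarrow> \<epsilon> \<le> \<epsilon>' \<Longrightarrow> measure lborel (parallel_nbhd K \<epsilon>) \<le> measure lborel (parallel_nbhd K \<epsilon>')"
  using compact_K K_nonempty
  by (intro measure_mono_fmeasurable parallel_nbhd_mono fmeasurable_compact parallel_nbhd_compact) auto

lemma nbhd_volume_pos: assumes "\<epsilon> > 0" shows "0 < measure lborel (parallel_nbhd K \<epsilon>)"
proof -
  obtain x where x: "x \<in> K" using K_nonempty by auto
  have "0 < measure lborel (cball x \<epsilon>)"
    using assms by (simp add: measure_def emeasure_cball)
  also have "\<dots> \<le> measure lborel (parallel_nbhd K \<epsilon>)"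
  proof (rule measure_mono_fmeasurable)
    show "cball x \<epsilon> \<subseteq> parallel_nbhd K \<epsilon>" unfolding parallel_nbhd_def using x by (auto intro!: infdist_le2 simp: dist_commute)
  qed (use assms compact_K K_nonempty in \<open>auto intro!: fmeasurable_compact parallel_nbhd_compact\<close>)
  finally show ?thesis .
qed

lemma V_pos: "0 < V t"
  unfolding V_def rescaled_volume_eq using nbhd_volume_pos by simp

lemma V_slow: assumes "h \<ge> 0" shows "V (t + h) \<le> exp (growth * h) * V t"
proof -
  have "(real CARD('d) - \<delta>) * h \<le> growth * h" unfolding growth_def using assms by (intro mult_right_mono) auto
  then have e: "exp ((real CARD('d) - \<delta>) * h) \<le> exp (growth * h)" by simp
  have m: "measure lborel (parallel_nbhd K (exp (- (t + h)))) \<le> measure lborel (parallel_nbhd K (exp (- t)))"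
    using assms by (intro nbhd_volume_mono) auto
  have "V (t + h) = exp ((real CARD('d) - \<delta>) * h) * (exp ((real CARD('d) - \<delta>) * t) * measure lborel (parallel_nbhd K (exp (- (t + h)))))"
    unfolding V_def rescaled_volume_eq by (simp add: distrib_left exp_add)
  also have "\<dots> \<le> exp (growth * h) * (exp ((real CARD('d) - \<delta>) * t) * measure lborel (parallel_nbhd K (exp (- t))))"
    using e m by (intro mult_mono mult_left_mono) auto
  also have "\<dots> = exp (growth * h) * V t" unfolding V_def rescaled_volume_eq ..
  finally show ?thesis .
qed

text \<open>On one initial window bounds follow from \<open>V_slow\<close>, and the maximum principle for \<open>V\<close> and \<open>- V\<close>
extends them.\<close>

lemma V_bounds:
  obtains T c B where "0 < c" "\<And>t. t \<ge> T \<Longrightarrow> c \<le> V t" "\<And>t. t \<ge> T \<Longrightarrow> V t \<le> B"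
proof -
  obtain t0 where eq: "\<And>t. t \<ge> t0 \<Longrightarrow> V t = (\<Sum>i\<in>{1..N}. r i powr \<delta> * V (t - (- ln (r i))))"
    using volume_renewal_eq by blast
  define b where "b = Max ((\<lambda>i. - ln (r i)) ` {1..N})"
  have b: "\<And>i. i \<in> {1..N} \<Longrightarrow> - ln (r i) \<le> b" unfolding b_def by (intro Max_ge) auto
  have ne: "{1..N} \<noteq> {}" using N by auto
  have p: "\<And>i. i \<in> {1..N} \<Longrightarrow> 0 < r i powr \<delta>" using r_pos by (simp add: less_imp_neq[symmetric])
  have a: "\<And>i. i \<in> {1..N} \<Longrightarrow> 0 < - ln (r i)" using r_pos r_lt_1 by simp
  have "b > 0" using a b ne by (meson all_not_in_conv less_le_trans)
  define c where "c = exp (- growth * b) * V t0"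
  define B where "B = exp (growth * b) * V (t0 - b)"
  have "growth \<ge> 0" unfolding growth_def by simp
  have start: "c \<le> V t \<and> V t \<le> B" if t: "t0 - b \<le> t" "t \<le> t0" for t
  proof
    have "V t0 \<le> exp (growth * (t0 - t)) * V t" using V_slow[of "t0 - t" t] t by simp
    also have "\<dots> \<le> exp (growth * b) * V t"
      using t \<open>growth \<ge> 0\<close> V_pos[of t] by (intro mult_right_mono) (auto intro: mult_left_mono)
    finally show "c \<le> V t" unfolding c_def by (simp add: exp_minus field_simps)
    have "V t \<le> exp (growth * (t - (t0 - b))) * V (t0 - b)" using V_slow[of "t - (t0 - b)" "t0 - b"] t by simp
    also have "\<dots> \<le> B" unfolding B_def
      using t \<open>growth \<ge> 0\<close> V_pos[of "t0 - b"] by (intro mult_right_mono) (auto intro: mult_left_mono)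
    finally show "V t \<le> B" .
  qed
  have up: "V t \<le> B" if "t \<ge> t0 - b" for t
    by (rule renewal_maximum_principle[OF finite_atLeastAtMost ne p ratio_sum a b eq _ that]) (use start in auto)
  have low: "- V t \<le> - c" if "t \<ge> t0 - b" for t
    by (rule renewal_maximum_principle[where X = "\<lambda>t. - V t", OF finite_atLeastAtMost ne p ratio_sum a b _ _ that])
      (use start eq in \<open>auto simp: sum_negf\<close>)
  show ?thesis by (rule that[of c "t0 - b" B]) (use up low V_pos in \<open>auto simp: c_def\<close>)
qed

lemma V_tame: "tame V"
proof -
  obtain T B where "\<And>t. t \<ge> T \<Longrightarrow> V t \<le> B" using V_bounds by metis
  then show ?thesis unfolding V_def
    by (intro rescaled_integral_tame[where B=1]) (auto simp: compact_K K_nonempty)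
qed

lemma minkowski_dim_K: "has_minkowski_dim K \<delta>"
proof -
  obtain T c B where "0 < c" "\<And>t. t \<ge> T \<Longrightarrow> c \<le> V t" "\<And>t. t \<ge> T \<Longrightarrow> V t \<le> B" using V_bounds by metis
  then show ?thesis unfolding V_def by (intro minkowski_dim_of_volume_bounds) auto
qed

lemma volume_limit:
  obtains M where "M \<ge> 0" "tends_to True V M" "\<not> lattice_ratios N r \<Longrightarrow> tends_to False V M"
proof -
  obtain t0 where eq: "\<And>t. t \<ge> t0 \<Longrightarrow> V t = (\<Sum>i\<in>{1..N}. r i powr \<delta> * V (t - (- ln (r i))))"
    using volume_renewal_eq by blast
  interpret renewal_equation "{1..N}" "\<lambda>i. r i powr \<delta>" "\<lambda>i. - ln (r i)" V t0 growth
  proof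
    show "V t \<ge> 0" for t using V_pos[of t] by simp
    show "growth \<ge> 0" unfolding growth_def by simp
    show "0 < r i powr \<delta>" if "i \<in> {1..N}" for i using r_pos[OF that] by simp
    show "0 < - ln (r i)" if "i \<in> {1..N}" for i using r_pos[OF that] r_lt_1[OF that] by simp
  qed (use N ratio_sum V_tame V_slow eq in auto)
  have "\<not> (\<exists>c>0. \<forall>i\<in>{1..N}. \<exists>k::int. - ln (r i) = c * of_int k)" if nl: "\<not> lattice_ratios N r"
  proof
    assume "\<exists>c>0. \<forall>i\<in>{1..N}. \<exists>k::int. - ln (r i) = c * of_int k"
    then obtain c where c: "c > 0" "\<And>i. i \<in> {1..N} \<Longrightarrow> \<exists>k::int. - ln (r i) = c * of_int k" by blast
    have "\<exists>k::int. ln (r i) = c * of_int k" if i: "i \<in> {1..N}" for i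
    proof -
      obtain k :: int where "- ln (r i) = c * of_int k" using c(2)[OF i] by blast
      then show ?thesis by (intro exI[of _ "- k"]) (simp add: minus_equation_iff)
    qed
    then show False using nl c(1) unfolding lattice_ratios_def by blast
  qed
  then show ?thesis using that[of limit] limit_nonneg averaged_renewal nonlattice_renewal by blast
qed

primrec word_map :: "nat list \<Rightarrow> real^'d \<Rightarrow> real^'d" where
  "word_map [] = id"
| "word_map (i # w) = \<phi> i \<circ> word_map w"

primrec word_ratio :: "nat list \<Rightarrow> real" where
  "word_ratio [] = 1"
| "word_ratio (i # w) = r i * word_ratio w"

definition words :: "nat \<Rightarrow> nat list set" where
  "words n = {w. set w \<subseteq> {1..N} \<and> length w = n}"

lemma words_0: "words 0 = {[]}" unfolding words_def by auto

lemma words_Suc: "words (Suc n) = (\<lambda>(i, w). i # w) ` ({1..N} \<times> words n)"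
  unfolding words_def by (auto simp: length_Suc_conv image_iff)

lemma finite_words: "finite (words n)"
  unfolding words_def by (intro finite_lists_length_eq) simp

lemma words_nonempty: "words n \<noteq> {}"
  using N by (induction n) (auto simp: words_0 words_Suc)

lemma similarity_word: "w \<in> words n \<Longrightarrow> similarity (word_map w) (word_ratio w)"
proof (induction n arbitrary: w)
  case 0 then show ?case by (simp add: words_0 similarity_id)
next
  case (Suc n) then show ?case by (auto simp: words_Suc intro!: similarity_compose similarity_phi simp del: comp_apply)
qed

lemma word_ratio_le: "w \<in> words n \<Longrightarrow> word_ratio w \<le> (Max (r ` {1..N})) ^ n"
proof (induction n arbitrary: w)
  case 0 then show ?case by (simp add: words_0)
next
  case (Suc n)
  then obtain i v where w: "w = i # v" "i \<in> {1..N}" "v \<in> words n" by (auto simp: words_Suc)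
  have "r i \<le> Max (r ` {1..N})" using w by (intro Max_ge) auto
  moreover have "0 < word_ratio v" using similarity_word[OF w(3)] by (simp add: similarity_def)
  ultimately show ?case using Suc.IH[OF w(3)] r_pos[OF w(2)] w(1) by (auto intro!: mult_mono)
qed

lemma K_words: "K = (\<Union>w\<in>words n. word_map w ` K)"
proof (induction n)
  case 0 then show ?case by (simp add: words_0)
next
  case (Suc n)
  have "K = (\<Union>i\<in>{1..N}. \<phi> i ` (\<Union>w\<in>words n. word_map w ` K))" using K_eq Suc by simp
  also have "\<dots> = (\<Union>w\<in>words (Suc n). word_map w ` K)" unfolding words_Suc by (auto simp: image_iff) (metis atLeastAtMost_iff One_nat_def)+
  finally show ?case .
qed

lemma word_pieces_disjoint: "disjoint_family_on (\<lambda>w. word_map w ` K) (words n)"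
proof (induction n)
  case 0 then show ?case by (simp add: words_0 disjoint_family_on_def)
next
  case (Suc n)
  show ?case unfolding disjoint_family_on_def
  proof (intro ballI impI)
    fix u w assume uw: "u \<in> words (Suc n)" "w \<in> words (Suc n)" "u \<noteq> w"
    obtain i u' where u: "u = i # u'" "i \<in> {1..N}" "u' \<in> words n" using uw by (auto simp: words_Suc)
    obtain j w' where w: "w = j # w'" "j \<in> {1..N}" "w' \<in> words n" using uw by (auto simp: words_Suc)
    have sub: "word_map u' ` K \<subseteq> K" "word_map w' ` K \<subseteq> K" using K_words[of n] u(3) w(3) by blast+
    show "word_map u ` K \<inter> word_map w ` K = {}"
    proof (cases "i = j")
      case True
      then have "word_map u' ` K \<inter> word_map w' ` K = {}"
        using Suc u w uw(3) unfolding disjoint_family_on_def by auto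
      moreover have "inj (\<phi> i)" using similarity_bij[OF similarity_phi[OF u(2)]] by (rule bij_is_inj)
      ultimately have "\<phi> i ` (word_map u' ` K) \<inter> \<phi> i ` (word_map w' ` K) = {}"
        by (simp add: image_Int[symmetric])
      then show ?thesis using True u(1) w(1) by (simp add: image_comp)
    next
      case False
      have "word_map u ` K \<subseteq> \<phi> i ` K" "word_map w ` K \<subseteq> \<phi> j ` K" using sub u(1) w(1) by auto
      then show ?thesis using pieces_disjoint[OF u(2) w(2) False] by blast
    qed
  qed
qed

lemma word_pieces_small:
  assumes "e > 0"
  obtains n where "\<And>w x y. w \<in> words n \<Longrightarrow> x \<in> word_map w ` K \<Longrightarrow> y \<in> word_map w ` K \<Longrightarrow> dist x y < e"
proof -
  define q where "q = Max (r ` {1..N})"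
  have ne: "{1..N} \<noteq> {}" using N by auto
  have q: "0 < q" "q < 1" using ne r_pos r_lt_1 unfolding q_def by (auto simp: Max_gr_iff)
  define D where "D = diameter K"
  have bK: "bounded K" using compact_K by (rule compact_imp_bounded)
  have "D \<ge> 0" unfolding D_def using diameter_ge_0[OF bK] .
  obtain n where n: "q ^ n < e / (D + 1)"
    using real_arch_pow_inv[of "e / (D + 1)" q] q assms \<open>D \<ge> 0\<close> by auto
  show ?thesis
  proof (rule that[of n])
    fix w x y assume w: "w \<in> words n" and "x \<in> word_map w ` K" "y \<in> word_map w ` K"
    then obtain x' y' where xy: "x = word_map w x'" "y = word_map w y'" "x' \<in> K" "y' \<in> K" by blast
    have "dist x y = word_ratio w * dist x' y'" using similarity_word[OF w] xy by (simp add: similarity_def)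
    also have "\<dots> \<le> q ^ n * D"
      using word_ratio_le[OF w] diameter_bounded_bound[OF bK xy(3,4)] q
      unfolding D_def q_def by (intro mult_mono) auto
    also have "\<dots> \<le> q ^ n * (D + 1)" using q by (intro mult_left_mono) auto
    also have "\<dots> < e" using n \<open>D \<ge> 0\<close> by (simp add: field_simps)
    finally show "dist x y < e" .
  qed
qed

end

context self_similar begin

text \<open>Cover each piece \<open>\<phi>\<^sub>i K\<close> by the image of a cover of \<open>K\<close> that may be coarser by the factor \<open>1 / r\<^sub>i\<close>. The
weights \<open>r\<^sub>i^\<delta>\<close> sum to one, so iterating allows arbitrarily coarse covers, such as \<open>K\<close> itself.\<close>

lemma hausdorff_pre_contract:
  assumes "\<eta> > 0" shows "hausdorff_pre \<delta> \<eta> K \<le> hausdorff_pre \<delta> (\<eta> / Max (r ` {1..N})) K"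
proof -
  define q where "q = Max (r ` {1..N})"
  have ne: "{1..N} \<noteq> {}" using N by auto
  have q: "0 < q" "\<And>i. i \<in> {1..N} \<Longrightarrow> r i \<le> q" using ne r_pos unfolding q_def by (auto simp: Max_gr_iff)
  have "hausdorff_pre \<delta> \<eta> K \<le> (\<Sum>i\<in>{1..N}. hausdorff_pre \<delta> \<eta> (\<phi> i ` K))"
    using hausdorff_pre_finite_subadditive[of "{1..N}" \<eta> \<delta> "\<lambda>i. \<phi> i ` K"] assms K_eq by simp
  also have "\<dots> \<le> (\<Sum>i\<in>{1..N}. ennreal (r i powr \<delta>) * hausdorff_pre \<delta> (\<eta> / q) K)"
  proof (rule sum_mono)
    fix i assume i: "i \<in> {1..N}"
    have "r i * (\<eta> / q) \<le> q * (\<eta> / q)" using q(2)[OF i] q(1) assms by (intro mult_right_mono) auto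
    then show "hausdorff_pre \<delta> \<eta> (\<phi> i ` K) \<le> ennreal (r i powr \<delta>) * hausdorff_pre \<delta> (\<eta> / q) K"
      using q(1) by (intro hausdorff_pre_similarity_le[OF similarity_phi[OF i] \<delta>_pos]) simp
  qed
  also have "\<dots> = ennreal (\<Sum>i\<in>{1..N}. r i powr \<delta>) * hausdorff_pre \<delta> (\<eta> / q) K"
    by (simp add: sum_distrib_right[symmetric])
  finally show ?thesis unfolding ratio_sum q_def by simp
qed

lemma hausdorff_outer_K_finite: "hausdorff_outer \<delta> K < \<infinity>"
proof -
  define q where "q = Max (r ` {1..N})"
  have ne: "{1..N} \<noteq> {}" using N by auto
  have q: "0 < q" "q < 1" using ne r_pos r_lt_1 unfolding q_def by (auto simp: Max_gr_iff)
  have bK: "bounded K" using compact_K by (rule compact_imp_bounded)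
  have "hausdorff_pre \<delta> \<eta> K \<le> ennreal (diameter K powr \<delta>)" if \<eta>: "\<eta> > 0" for \<eta>
  proof -
    have iterate: "hausdorff_pre \<delta> \<eta> K \<le> hausdorff_pre \<delta> (\<eta> / q ^ n) K" for n
    proof (induction n)
      case (Suc n)
      have "hausdorff_pre \<delta> (\<eta> / q ^ n) K \<le> hausdorff_pre \<delta> (\<eta> / q ^ n / q) K"
        using \<eta> q hausdorff_pre_contract[of "\<eta> / q ^ n"] unfolding q_def[symmetric] by simp
      then show ?case using Suc by (simp add: mult.commute)
    qed simp
    have "D \<ge> 0 \<Longrightarrow> \<exists>n. D * q ^ n < \<eta>" for D
    proof -
      assume "D \<ge> 0"
      obtain n where "q ^ n < \<eta> / (D + 1)" using real_arch_pow_inv[of "\<eta> / (D + 1)" q] \<eta> \<open>D \<ge> 0\<close> q by auto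
      then have "(D + 1) * q ^ n < \<eta>" using \<open>D \<ge> 0\<close> by (simp add: field_simps)
      moreover have "D * q ^ n \<le> (D + 1) * q ^ n" using q by (intro mult_right_mono) auto
      ultimately show ?thesis by (intro exI[of _ n]) simp
    qed
    then obtain n where "diameter K * q ^ n < \<eta>" using diameter_ge_0[OF bK] by blast
    then have n: "diameter K \<le> \<eta> / q ^ n" using q by (simp add: pos_le_divide_eq less_imp_le)
    have "hausdorff_pre \<delta> (\<eta> / q ^ n) K \<le> (\<Sum>m::nat. hausdorff_weight \<delta> (if m = 0 then K else {}))"
      using n bK \<eta> q by (intro hausdorff_pre_le) auto
    also have "\<dots> = (\<Sum>m\<in>{0::nat}. hausdorff_weight \<delta> (if m = 0 then K else {}))"
      by (rule suminf_finite) (auto simp: hausdorff_weight_def)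
    also have "\<dots> = ennreal (diameter K powr \<delta>)" by (simp add: hausdorff_weight_eq \<delta>_pos)
    finally show ?thesis using iterate[of n] by (rule order_trans[rotated])
  qed
  then have "hausdorff_outer \<delta> K \<le> ennreal (diameter K powr \<delta>)" by (intro hausdorff_outer_least)
  then show ?thesis by (rule le_less_trans) simp
qed

lemma pieces_gap:
  obtains \<Delta> where "\<Delta> > 0"
    "\<And>i j x y. i \<in> {1..N} \<Longrightarrow> j \<in> {1..N} \<Longrightarrow> i \<noteq> j \<Longrightarrow> x \<in> \<phi> i ` K \<Longrightarrow> y \<in> \<phi> j ` K \<Longrightarrow> \<Delta> \<le> dist x y"
proof -
  have "disjoint_family_on (\<lambda>i. \<phi> i ` K) {1..N}" unfolding disjoint_family_on_def using pieces_disjoint by blast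
  moreover have c: "compact (\<phi> i ` K)" if "i \<in> {1..N}" for i using similarity_compact[OF similarity_phi[OF that] compact_K] .
  ultimately obtain e where e: "e > 0" "disjoint_family_on (\<lambda>i. parallel_nbhd (\<phi> i ` K) e) {1..N}"
    using parallel_nbhds_disjoint[of "{1..N}" "\<lambda>i. \<phi> i ` K"] K_nonempty by (metis finite_atLeastAtMost image_is_empty order_refl)
  show ?thesis
  proof (rule that[OF e(1)])
    fix i j x y assume ij: "i \<in> {1..N}" "j \<in> {1..N}" "i \<noteq> j" and xy: "x \<in> \<phi> i ` K" "y \<in> \<phi> j ` K"
    show "e \<le> dist x y"
    proof (rule ccontr)
      assume "\<not> e \<le> dist x y"
      then have "x \<in> parallel_nbhd (\<phi> j ` K) e" unfolding parallel_nbhd_def using xy(2) by (auto intro: infdist_le2)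
      moreover have "x \<in> parallel_nbhd (\<phi> i ` K) e" using parallel_nbhd_superset[of e "\<phi> i ` K"] e(1) xy(1) by (meson less_imp_le subsetD)
      ultimately show False using e(2) ij unfolding disjoint_family_on_def by blast
    qed
  qed
qed

text \<open>A set of diameter below the gap \<open>\<Delta>\<close> between the pieces lies in one of them. Applying the inverse of
the corresponding similarity enlarges it, until its diameter reaches the gap; the composition of
the similarities then has a ratio comparable to the original diameter. The induction parameter
\<open>n\<close> bounds the number of steps.\<close>

lemma small_set_in_small_piece:
  assumes gap: "\<Delta> > 0"
    "\<And>i j x y. i \<in> {1..N} \<Longrightarrow> j \<in> {1..N} \<Longrightarrow> i \<noteq> j \<Longrightarrow> x \<in> \<phi> i ` K \<Longrightarrow> y \<in> \<phi> j ` K \<Longrightarrow> \<Delta> \<le> dist x y"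
    and \<rho>: "\<rho> \<ge> \<Delta> * Max (r ` {1..N}) ^ n" and C: "C \<subseteq> K" "\<And>x y. x \<in> C \<Longrightarrow> y \<in> C \<Longrightarrow> dist x y < \<rho>"
  shows "\<exists>\<psi> \<sigma>. similarity \<psi> \<sigma> \<and> \<sigma> \<le> \<rho> / \<Delta> \<and> C \<subseteq> \<psi> ` K"
  using \<rho> C
proof (induction n arbitrary: \<rho> C)
  case 0
  then show ?case using gap(1) by (intro exI[of _ id] exI[of _ 1]) (auto simp: similarity_id)
next
  case (Suc n)
  define q where "q = Max (r ` {1..N})"
  show ?case
  proof (cases "\<rho> \<ge> \<Delta>")
    case True
    then show ?thesis using gap(1) Suc.prems by (intro exI[of _ id] exI[of _ 1]) (auto simp: similarity_id)
  next
    case False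
    obtain i where i: "i \<in> {1..N}" "C \<subseteq> \<phi> i ` K"
    proof (cases "C = {}")
      case True then show ?thesis using that[of 1] N by auto
    next
      case False
      then obtain x where x: "x \<in> C" by auto
      then obtain i where i: "i \<in> {1..N}" "x \<in> \<phi> i ` K" using Suc.prems(2) K_eq by blast
      have "y \<in> \<phi> i ` K" if y: "y \<in> C" for y
      proof -
        obtain j where j: "j \<in> {1..N}" "y \<in> \<phi> j ` K" using y Suc.prems(2) K_eq by blast
        have "dist x y < \<Delta>" using Suc.prems(3)[OF x y] \<open>\<not> \<Delta> \<le> \<rho>\<close> by simp
        then show ?thesis using gap(2)[OF i(1) j(1) _ i(2) j(2)] j by fastforce
      qed
      then show ?thesis using that i by blast
    qed
    have sim: "similarity (\<phi> i) (r i)" and ri: "r i > 0" using similarity_phi r_pos i by auto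
    define C' where "C' = {x \<in> K. \<phi> i x \<in> C}"
    have C': "C = \<phi> i ` C'" using i(2) unfolding C'_def by auto
    have "r i \<le> q" unfolding q_def using i by (intro Max_ge) auto
    have "q \<ge> 0" using ri \<open>r i \<le> q\<close> by linarith
    have "r i * (\<Delta> * q ^ n) \<le> q * (\<Delta> * q ^ n)" using \<open>r i \<le> q\<close> \<open>q \<ge> 0\<close> gap(1) by (intro mult_right_mono) auto
    also have "\<dots> \<le> \<rho>" using Suc.prems(1) unfolding q_def by (simp add: mult.left_commute)
    finally have \<rho>': "\<rho> / r i \<ge> \<Delta> * q ^ n" using ri by (simp add: pos_le_divide_eq mult.commute)
    have "dist x y < \<rho> / r i" if "x \<in> C'" "y \<in> C'" for x y
    proof -
      have "r i * dist x y < \<rho>" using Suc.prems(3)[of "\<phi> i x" "\<phi> i y"] that sim unfolding C'_def similarity_def by auto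
      then show ?thesis using ri by (simp add: pos_less_divide_eq mult.commute)
    qed
    moreover have "C' \<subseteq> K" unfolding C'_def by auto
    ultimately obtain \<psi> \<sigma> where \<psi>: "similarity \<psi> \<sigma>" "\<sigma> \<le> \<rho> / r i / \<Delta>" "C' \<subseteq> \<psi> ` K"
      using Suc.IH[OF \<rho>'[unfolded q_def]] by blast
    have "r i * \<sigma> \<le> r i * (\<rho> / r i / \<Delta>)" using \<psi>(2) ri by (intro mult_left_mono) auto
    then have "r i * \<sigma> \<le> \<rho> / \<Delta>" using ri by simp
    moreover have "C \<subseteq> (\<phi> i \<circ> \<psi>) ` K" unfolding C' using \<psi>(3) by (auto simp: image_comp[symmetric])
    ultimately show ?thesis using similarity_compose[OF sim \<psi>(1)] by blast
  qed
qed

text \<open>Each set of the cover is replaced by a copy of \<open>K\<close> with comparable ratio. Comparing the volumes of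
neighbourhoods at a scale below all these ratios gives \<open>c \<le> V t \<le> \<Sum>\<^sub>j (\<rho>\<^sub>j/\<Delta>)^\<delta> B\<close>.\<close>

lemma cover_weight_lower_bound:
  obtains \<kappa> where "\<kappa> > 0"
    "\<And>(J :: nat set) Cov \<rho>. finite J \<Longrightarrow> K \<subseteq> (\<Union>j\<in>J. Cov j) \<Longrightarrow> (\<And>j. j \<in> J \<Longrightarrow> \<rho> j > 0) \<Longrightarrow>
      (\<And>j x y. j \<in> J \<Longrightarrow> x \<in> Cov j \<Longrightarrow> y \<in> Cov j \<Longrightarrow> dist x y < \<rho> j) \<Longrightarrow> \<kappa> \<le> (\<Sum>j\<in>J. \<rho> j powr \<delta>)"
proof -
  obtain T c B0 where "0 < c" and V: "\<And>t. t \<ge> T \<Longrightarrow> c \<le> V t" using V_bounds by metis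
  obtain B where B: "B \<ge> 0" "\<And>t. t \<ge> 0 \<Longrightarrow> \<bar>V t\<bar> \<le> B" using tame_bound[OF V_tame] by metis
  obtain \<Delta> where gap: "\<Delta> > 0"
    "\<And>i j x y. i \<in> {1..N} \<Longrightarrow> j \<in> {1..N} \<Longrightarrow> i \<noteq> j \<Longrightarrow> x \<in> \<phi> i ` K \<Longrightarrow> y \<in> \<phi> j ` K \<Longrightarrow> \<Delta> \<le> dist x y"
    using pieces_gap by metis
  have "B > 0" using B(2)[of 0] V_pos[of 0] by simp
  have ne: "{1..N} \<noteq> {}" using N by auto
  define q where "q = Max (r ` {1..N})"
  have q: "0 < q" "q < 1" using ne r_pos r_lt_1 unfolding q_def by (auto simp: Max_gr_iff)
  define \<kappa> where "\<kappa> = c * \<Delta> powr \<delta> / B"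
  show ?thesis
  proof (rule that[of \<kappa>])
    show "\<kappa> > 0" unfolding \<kappa>_def using \<open>0 < c\<close> \<open>B > 0\<close> gap(1) by simp
    fix J :: "nat set" and Cov \<rho>
    assume J: "finite J" "K \<subseteq> (\<Union>j\<in>J. Cov j)" and \<rho>: "\<And>j. j \<in> J \<Longrightarrow> \<rho> j > 0"
      and small: "\<And>j x y. j \<in> J \<Longrightarrow> x \<in> Cov j \<Longrightarrow> y \<in> Cov j \<Longrightarrow> dist x y < \<rho> j"
    have "\<exists>\<psi> \<sigma>. similarity \<psi> \<sigma> \<and> \<sigma> \<le> \<rho> j / \<Delta> \<and> K \<inter> Cov j \<subseteq> \<psi> ` K" if j: "j \<in> J" for j
    proof -
      obtain n where "q ^ n < \<rho> j / \<Delta>" using real_arch_pow_inv[of "\<rho> j / \<Delta>" q] \<rho>[OF j] gap(1) q by auto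
      then have "\<rho> j \<ge> \<Delta> * q ^ n" using gap(1) by (simp add: pos_less_divide_eq mult.commute)
      then show ?thesis unfolding q_def
        by (intro small_set_in_small_piece[OF gap]) (use small[OF j] in auto)
    qed
    then obtain \<psi> \<sigma> where \<psi>: "\<And>j. j \<in> J \<Longrightarrow> similarity (\<psi> j) (\<sigma> j)" "\<And>j. j \<in> J \<Longrightarrow> \<sigma> j \<le> \<rho> j / \<Delta>"
      "\<And>j. j \<in> J \<Longrightarrow> K \<inter> Cov j \<subseteq> \<psi> j ` K" by metis
    have "J \<noteq> {}" using J(2) K_nonempty by auto
    \<comment> \<open>The scale \<open>exp (- t)\<close> is below all ratios \<open>\<sigma> j\<close>, so the upper bound \<open>B\<close> applies to every copy.\<close>
    define t where "t = Max (insert T ((\<lambda>j. - ln (\<sigma> j)) ` J))"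
    have t: "T \<le> t" "\<And>j. j \<in> J \<Longrightarrow> - ln (\<sigma> j) \<le> t" unfolding t_def using J(1) by (auto intro: Max_ge)
    have comp: "compact (\<psi> j ` K)" if "j \<in> J" for j using similarity_compact[OF \<psi>(1)[OF that] compact_K] .
    have cover: "parallel_nbhd K (exp (- t)) \<subseteq> (\<Union>j\<in>J. parallel_nbhd (\<psi> j ` K) (exp (- t)))"
    proof
      fix x assume "x \<in> parallel_nbhd K (exp (- t))"
      then obtain y where y: "y \<in> K" "dist x y \<le> exp (- t)" using parallel_nbhd_iff[OF compact_K K_nonempty] by blast
      then obtain j where j: "j \<in> J" "y \<in> \<psi> j ` K" using J(2) \<psi>(3) by blast
      then have "x \<in> parallel_nbhd (\<psi> j ` K) (exp (- t))"
        unfolding parallel_nbhd_def using y(2) by (auto intro: infdist_le2)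
      then show "x \<in> (\<Union>j\<in>J. parallel_nbhd (\<psi> j ` K) (exp (- t)))" using j(1) by blast
    qed
    have fm: "parallel_nbhd (\<psi> j ` K) (exp (- t)) \<in> fmeasurable lborel" if "j \<in> J" for j
      using comp[OF that] K_nonempty by (intro fmeasurable_compact parallel_nbhd_compact) auto
    have "measure lborel (parallel_nbhd K (exp (- t))) \<le> measure lborel (\<Union>j\<in>J. parallel_nbhd (\<psi> j ` K) (exp (- t)))"
      using cover fm J(1) by (intro measure_mono_fmeasurable fmeasurable.finite_UN) auto
    also have "\<dots> \<le> (\<Sum>j\<in>J. measure lborel (parallel_nbhd (\<psi> j ` K) (exp (- t))))"
      using fm J(1) by (intro measure_UNION_le) (auto simp: fmeasurable_def)
    finally have "V t \<le> (\<Sum>j\<in>J. rescaled_volume (\<psi> j ` K) \<delta> t)"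
      unfolding V_def rescaled_volume_eq sum_distrib_left[symmetric] by (intro mult_left_mono) auto
    also have "\<dots> \<le> (\<Sum>j\<in>J. (\<rho> j / \<Delta>) powr \<delta> * B)"
    proof (rule sum_mono)
      fix j assume j: "j \<in> J"
      have "\<sigma> j > 0" using \<psi>(1)[OF j] by (simp add: similarity_def)
      have "rescaled_volume (\<psi> j ` K) \<delta> t = \<sigma> j powr \<delta> * V (t + ln (\<sigma> j))"
        unfolding V_def by (rule rescaled_volume_similarity[OF \<psi>(1)[OF j] compact_K K_nonempty])
      also have "\<dots> \<le> (\<rho> j / \<Delta>) powr \<delta> * B"
      proof (rule mult_mono)
        show "\<sigma> j powr \<delta> \<le> (\<rho> j / \<Delta>) powr \<delta>" using \<psi>(2)[OF j] \<open>\<sigma> j > 0\<close> \<delta>_pos by (intro powr_mono2) auto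
        show "V (t + ln (\<sigma> j)) \<le> B" using B(2)[of "t + ln (\<sigma> j)"] t(2)[OF j] by simp
      qed (use V_pos[of "t + ln (\<sigma> j)"] in auto)
      finally show "rescaled_volume (\<psi> j ` K) \<delta> t \<le> (\<rho> j / \<Delta>) powr \<delta> * B" .
    qed
    also have "\<dots> = (\<Sum>j\<in>J. \<rho> j powr \<delta>) * (B / \<Delta> powr \<delta>)"
      unfolding sum_distrib_right using \<rho> gap(1) by (intro sum.cong refl) (simp add: powr_divide less_imp_le)
    finally have "c \<le> (\<Sum>j\<in>J. \<rho> j powr \<delta>) * (B / \<Delta> powr \<delta>)" using V[OF t(1)] by linarith
    then show "\<kappa> \<le> (\<Sum>j\<in>J. \<rho> j powr \<delta>)"
      unfolding \<kappa>_def using \<open>B > 0\<close> gap(1) by (simp add: field_simps)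
  qed
qed

text \<open>A countable cover is enlarged slightly to an open one, which costs an arbitrarily small weight, in
order to extract a finite cover by compactness.\<close>

lemma hausdorff_outer_K_pos: "hausdorff_outer \<delta> K > 0"
proof -
  obtain \<kappa> where \<kappa>: "\<kappa> > 0"
    "\<And>(J :: nat set) Cov \<rho>. finite J \<Longrightarrow> K \<subseteq> (\<Union>j\<in>J. Cov j) \<Longrightarrow> (\<And>j. j \<in> J \<Longrightarrow> \<rho> j > 0) \<Longrightarrow>
      (\<And>j x y. j \<in> J \<Longrightarrow> x \<in> Cov j \<Longrightarrow> y \<in> Cov j \<Longrightarrow> dist x y < \<rho> j) \<Longrightarrow> \<kappa> \<le> (\<Sum>j\<in>J. \<rho> j powr \<delta>)"
    using cover_weight_lower_bound by blast
  have "ennreal \<kappa> \<le> hausdorff_pre \<delta> 1 K"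
  proof (rule hausdorff_pre_greatest)
    fix C :: "nat \<Rightarrow> (real^'d) set"
    assume C: "K \<subseteq> (\<Union>n. C n)" "\<And>n. bounded (C n)" "\<And>n. diameter (C n) \<le> 1"
    show "ennreal \<kappa> \<le> (\<Sum>n. hausdorff_weight \<delta> (C n))"
    proof (rule ennreal_le_epsilon)
      fix e :: real assume "e > 0"
      have "\<exists>\<tau>>0. (diameter (C n) + \<tau>) powr \<delta> < diameter (C n) powr \<delta> + e * (1/2) ^ Suc n" for n
      proof -
        have d0: "diameter (C n) \<ge> 0" using diameter_ge_0[OF C(2)] .
        have "((\<lambda>\<tau>. (diameter (C n) + \<tau>) powr \<delta>) \<longlongrightarrow> (diameter (C n) + 0) powr \<delta>) (at_right 0)"
          using d0 \<delta>_pos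
          by (intro tendsto_powr' tendsto_intros) (auto intro!: eventually_mono[OF eventually_at_right_less])
        then have "eventually (\<lambda>\<tau>. (diameter (C n) + \<tau>) powr \<delta> < diameter (C n) powr \<delta> + e * (1/2) ^ Suc n) (at_right 0)"
          using \<open>e > 0\<close> by (intro order_tendstoD) auto
        then have "eventually (\<lambda>\<tau>. (diameter (C n) + \<tau>) powr \<delta> < diameter (C n) powr \<delta> + e * (1/2) ^ Suc n \<and> \<tau> > 0) (at_right 0)"
          using eventually_at_right_less[of "0::real"] by (rule eventually_conj)
        then show ?thesis using eventually_happens'[OF trivial_limit_at_right_real] by blast
      qed
      then obtain \<tau> where \<tau>: "\<And>n. \<tau> n > 0" "\<And>n. (diameter (C n) + \<tau> n) powr \<delta> < diameter (C n) powr \<delta> + e * (1/2) ^ Suc n"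
        by metis
      define Q where "Q n = (\<Union>x\<in>C n. ball x (\<tau> n / 2))" for n
      have "K \<subseteq> (\<Union>n\<in>UNIV. Q n)"
      proof
        fix x assume "x \<in> K"
        then obtain n where n: "x \<in> C n" using C(1) by blast
        moreover have "x \<in> ball x (\<tau> n / 2)" using \<tau>(1)[of n] by simp
        ultimately show "x \<in> (\<Union>n\<in>UNIV. Q n)" unfolding Q_def by blast
      qed
      moreover have "open (Q n)" for n unfolding Q_def by auto
      ultimately obtain J where J: "finite J" "K \<subseteq> (\<Union>n\<in>J. Q n)"
        using compactE_image[OF compact_K, of UNIV Q] by metis
      have "\<kappa> \<le> (\<Sum>n\<in>J. (diameter (C n) + \<tau> n) powr \<delta>)"
      proof (rule \<kappa>(2)[OF J])
        show "0 < diameter (C n) + \<tau> n" for n using diameter_ge_0[OF C(2), of n] \<tau>(1)[of n] by simp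
        fix n x y assume "x \<in> Q n" "y \<in> Q n"
        then obtain a b where ab: "a \<in> C n" "b \<in> C n" "dist a x < \<tau> n / 2" "dist b y < \<tau> n / 2" unfolding Q_def by auto
        have "dist x y \<le> dist a x + dist a b + dist b y"
          using dist_triangle[of x y a] dist_triangle[of a y b] by (simp add: dist_commute)
        then show "dist x y < diameter (C n) + \<tau> n" using ab diameter_bounded_bound[OF C(2) ab(1,2)] by linarith
      qed
      also have "\<dots> \<le> (\<Sum>n\<in>J. diameter (C n) powr \<delta> + e * (1/2) ^ Suc n)"
        using \<tau>(2) by (intro sum_mono less_imp_le)
      finally have "ennreal \<kappa> \<le> ennreal (\<Sum>n\<in>J. diameter (C n) powr \<delta> + e * (1/2) ^ Suc n)" by (rule ennreal_leI)
      also have "\<dots> = (\<Sum>n\<in>J. hausdorff_weight \<delta> (C n) + ennreal e * ennreal ((1/2) ^ Suc n))"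
        using \<open>e > 0\<close> \<delta>_pos by (subst sum_ennreal[symmetric]) (auto simp: hausdorff_weight_eq ennreal_mult[symmetric] simp flip: ennreal_plus)
      also have "\<dots> \<le> (\<Sum>n. hausdorff_weight \<delta> (C n) + ennreal e * ennreal ((1/2) ^ Suc n))"
        by (intro sum_le_suminf J summableI) auto
      also have "\<dots> = (\<Sum>n. hausdorff_weight \<delta> (C n)) + (\<Sum>n. ennreal e * ennreal ((1/2) ^ Suc n))"
        by (intro suminf_add[symmetric] summableI)
      also have "(\<Sum>n. ennreal e * ennreal ((1/2) ^ Suc n)) = ennreal e"
        unfolding ennreal_suminf_cmult
        by (subst suminf_ennreal_eq[OF zero_le_power power_half_series]) auto
      finally show "ennreal \<kappa> \<le> (\<Sum>n. hausdorff_weight \<delta> (C n)) + ennreal e" .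
    qed
  qed
  also have "\<dots> \<le> hausdorff_outer \<delta> K" by (intro hausdorff_pre_le_outer) simp
  finally show ?thesis using \<kappa>(1) by (metis ennreal_less_zero_iff less_le_trans)
qed

definition \<mu> :: "(real^'d) measure" where "\<mu> = uniform_measure (hausdorff_measure \<delta>) K"

lemma K_borel: "K \<in> sets borel" using compact_K by (simp add: borel_compact)

lemma sets_\<mu>[simp, measurable_cong]: "sets \<mu> = sets borel" and space_\<mu>[simp]: "space \<mu> = UNIV"
  unfolding \<mu>_def by auto

lemma emeasure_\<mu>: "A \<in> sets borel \<Longrightarrow> emeasure \<mu> A = hausdorff_outer \<delta> (K \<inter> A) / hausdorff_outer \<delta> K"
  unfolding \<mu>_def using K_borel by (simp add: emeasure_hausdorff_measure)

lemma emeasure_\<mu>_UNIV: "emeasure \<mu> UNIV = 1"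
  using hausdorff_outer_K_pos hausdorff_outer_K_finite K_borel
  by (simp add: emeasure_\<mu> ennreal_divide_self)

lemma finite_measure_\<mu>: "finite_measure \<mu>"
  by (intro finite_measureI) (simp add: emeasure_\<mu>_UNIV)

lemma AE_\<mu>_K: "AE x in \<mu>. x \<in> K"
proof (rule AE_I)
  show "emeasure \<mu> (- K) = 0"
    using K_borel hausdorff_outer_K_pos
    by (simp add: emeasure_\<mu> hausdorff_outer_empty)
  show "- K \<in> sets \<mu>" using K_borel by simp
qed auto

lemma measure_\<mu>_word:
  assumes w: "w \<in> words n" shows "measure \<mu> (word_map w ` K) = word_ratio w powr \<delta>"
proof -
  have sub: "K \<inter> word_map w ` K = word_map w ` K" using K_words[of n] w by blast
  have "compact (word_map w ` K)" using similarity_compact[OF similarity_word[OF w] compact_K] .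
  then have "word_map w ` K \<in> sets borel" by (simp add: borel_compact)
  then have "emeasure \<mu> (word_map w ` K) = ennreal (word_ratio w powr \<delta>) * hausdorff_outer \<delta> K / hausdorff_outer \<delta> K"
    by (simp add: emeasure_\<mu> sub hausdorff_outer_similarity[OF similarity_word[OF w] \<delta>_pos])
  also have "\<dots> = ennreal (word_ratio w powr \<delta>)"
    using hausdorff_outer_K_finite hausdorff_outer_K_pos by (simp add: ennreal_mult_divide_eq less_top[symmetric])
  finally show ?thesis by (simp add: measure_def)
qed

end

section \<open>Conformal diffeomorphisms\<close>

lemma orthogonal_matrix_norm:
  fixes Q :: "real^'n^'n"
  assumes "orthogonal_matrix Q" shows "norm (Q *v v) = norm v"
proof -
  have "(Q *v v) \<bullet> (Q *v v) = v \<bullet> v"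
    using assms unfolding orthogonal_matrix_def
    by (metis dot_lmul_matrix vector_matrix_mul_rid vector_transpose_matrix matrix_vector_mul_assoc transpose_matrix_vector)
  then show ?thesis by (simp add: norm_eq_sqrt_inner)
qed

lemma scaling_ratio_eq:
  assumes Q: "orthogonal_matrix Q" and J: "jacobian g (at x) = f *\<^sub>R Q"
  shows "scaling_ratio g x = \<bar>f\<bar>"
  unfolding scaling_ratio_def
proof (rule the_equality)
  fix c assume "\<exists>f Q. orthogonal_matrix Q \<and> jacobian g (at x) = f *\<^sub>R Q \<and> c = \<bar>f\<bar>"
  then obtain f' Q' where Q': "orthogonal_matrix Q'" "jacobian g (at x) = f' *\<^sub>R Q'" "c = \<bar>f'\<bar>" by blast
  obtain v :: "real^'a" where v: "norm v = 1" using vector_choose_size[of 1] by auto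
  have "norm (jacobian g (at x) *v v) = \<bar>f\<bar>" 
    unfolding J using orthogonal_matrix_norm[OF Q] v by (simp add: scaleR_matrix_vector_assoc[symmetric])
  moreover have "norm (jacobian g (at x) *v v) = \<bar>f'\<bar>"
    unfolding Q'(2) using orthogonal_matrix_norm[OF Q'(1)] v by (simp add: scaleR_matrix_vector_assoc[symmetric])
  ultimately show "c = \<bar>f\<bar>" using Q'(3) by simp
qed (use assms in blast)

lemma local_lipschitz_of_derivative:
  assumes D: "(f has_derivative D) (at x)" and norm: "\<And>v. norm (D v) \<le> c * norm v" and "c < A"
  shows "\<exists>r>0. \<forall>y. dist y x < r \<longrightarrow> dist (f y) (f x) \<le> A * dist y x"
proof -
  obtain r where r: "r > 0" "\<And>y. norm (y - x) < r \<Longrightarrow> norm (f y - f x - D (y - x)) \<le> (A - c) * norm (y - x)"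
    using D \<open>c < A\<close> unfolding has_derivative_at_alt by (meson diff_gt_0_iff_gt)
  show ?thesis
  proof (intro exI[of _ r] conjI allI impI r(1))
    fix y assume "dist y x < r"
    then have "norm (f y - f x - D (y - x)) \<le> (A - c) * norm (y - x)" using r(2) by (simp add: dist_norm)
    moreover have "norm (f y - f x) \<le> norm (f y - f x - D (y - x)) + norm (D (y - x))"
      by (metis add.commute norm_triangle_sub)
    ultimately show "dist (f y) (f x) \<le> A * dist y x"
      using norm[of "y - x"] by (simp add: dist_norm algebra_simps)
  qed
qed

text \<open>A point within \<open>\<epsilon>\<close> of \<open>Z\<close> is mapped by \<open>G\<close> to within \<open>B * \<epsilon>\<close> of \<open>G ` Z\<close>, by the mean value theorem on a
ball. So the neighbourhood of \<open>Z\<close> lies in the image under \<open>g\<close> of a neighbourhood of \<open>G ` Z\<close>. The roles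
of \<open>g\<close> and \<open>G\<close> are interchangeable, which yields upper and lower volume bounds.\<close>

lemma nbhd_volume_image_le:
  fixes g G :: "'a::euclidean_space \<Rightarrow> 'a"
  assumes "open V" "open W" "A > 0" "B > 0"
    and g_lip: "\<And>x. x \<in> V \<Longrightarrow> \<exists>r>0. \<forall>y. dist y x < r \<longrightarrow> dist (g y) (g x) \<le> A * dist y x"
    and G_der: "\<And>y. y \<in> W \<Longrightarrow> \<exists>D. (G has_derivative D) (at y) \<and> onorm D \<le> B"
    and gG: "\<And>y. y \<in> W \<Longrightarrow> g (G y) = y" and GV: "\<And>y. y \<in> W \<Longrightarrow> G y \<in> V"
    and Z: "compact Z" "Z \<noteq> {}" and "\<epsilon> > 0" and sub: "parallel_nbhd Z \<epsilon> \<subseteq> W"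
  shows "measure lborel (parallel_nbhd Z \<epsilon>) \<le> A ^ DIM('a) * measure lborel (parallel_nbhd (G ` Z) (B * \<epsilon>))"
proof -
  have ZW: "Z \<subseteq> W" using sub parallel_nbhd_superset[of \<epsilon> Z] \<open>\<epsilon> > 0\<close> by auto
  have contG: "continuous_on W G"
    using G_der has_derivative_continuous continuous_at_imp_continuous_on by metis
  have cZ: "compact (parallel_nbhd Z \<epsilon>)" using parallel_nbhd_compact[OF Z \<open>\<epsilon> > 0\<close>] .
  have cGZ: "compact (G ` Z)" using Z contG ZW by (intro compact_continuous_image) (auto intro: continuous_on_subset)
  define S where "S = G ` parallel_nbhd Z \<epsilon>"
  have S: "compact S" "S \<subseteq> V" unfolding S_def
    using cZ contG sub GV by (auto intro!: compact_continuous_image intro: continuous_on_subset)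
  have "parallel_nbhd Z \<epsilon> = g ` S" unfolding S_def image_image using gG sub by (auto simp: image_iff subset_iff)
  then have "measure lborel (parallel_nbhd Z \<epsilon>) \<le> A ^ DIM('a) * measure lborel S"
    using measure_locally_lipschitz_image_le[OF \<open>open V\<close> S \<open>A > 0\<close> g_lip] by simp
  also have "\<dots> \<le> A ^ DIM('a) * measure lborel (parallel_nbhd (G ` Z) (B * \<epsilon>))"
  proof (intro mult_left_mono measure_mono_fmeasurable)
    show "S \<subseteq> parallel_nbhd (G ` Z) (B * \<epsilon>)"
    proof
      fix x assume "x \<in> S"
      then obtain y where y: "y \<in> parallel_nbhd Z \<epsilon>" "x = G y" unfolding S_def by blast
      then obtain z where z: "z \<in> Z" "dist y z \<le> \<epsilon>" using parallel_nbhd_iff[OF Z] by blast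
      have ball: "cball z \<epsilon> \<subseteq> W"
        using sub z(1) unfolding parallel_nbhd_def by (auto simp: dist_commute intro!: infdist_le2 dest!: subsetD)
      obtain D where D: "\<And>u. u \<in> W \<Longrightarrow> (G has_derivative D u) (at u)" "\<And>u. u \<in> W \<Longrightarrow> onorm (D u) \<le> B"
        using G_der by metis
      have "norm (G y - G z) \<le> B * norm (y - z)"
      proof (rule differentiable_bound[OF convex_cball, of z \<epsilon> G D])
        show "(G has_derivative D u) (at u within cball z \<epsilon>)" if "u \<in> cball z \<epsilon>" for u
          using D(1) that ball by (blast intro: has_derivative_at_withinI)
        show "onorm (D u) \<le> B" if "u \<in> cball z \<epsilon>" for u using D(2) that ball by blast
      qed (use z \<open>\<epsilon> > 0\<close> in \<open>auto simp: dist_commute\<close>)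
      also have "\<dots> \<le> B * \<epsilon>" using z \<open>B > 0\<close> by (intro mult_left_mono) (auto simp: dist_norm)
      finally have "dist x (G z) \<le> B * \<epsilon>" unfolding y(2) dist_norm .
      then show "x \<in> parallel_nbhd (G ` Z) (B * \<epsilon>)" unfolding parallel_nbhd_def using z(1) by (auto intro: infdist_le2)
    qed
    show "parallel_nbhd (G ` Z) (B * \<epsilon>) \<in> fmeasurable lborel"
      using cGZ Z \<open>B > 0\<close> \<open>\<epsilon> > 0\<close> by (intro fmeasurable_compact parallel_nbhd_compact) auto
    show "S \<in> sets lborel" using S(1) by (simp add: borel_compact)
  qed (use \<open>A > 0\<close> in auto)
  finally show ?thesis .
qed

locale conformal_diffeomorphism =
  fixes U :: "(real^'d) set" and g :: "real^'d \<Rightarrow> real^'d" and \<alpha> :: real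
  assumes diffeo: "diffeomorphism_on U g" and conformal: "conformal_on U g"
    and \<alpha>_pos: "\<alpha> > 0" and holder: "holder_on \<alpha> U (scaling_ratio g)"
begin

abbreviation "G \<equiv> inv_into U g"

lemma open_U: "open U" and inj_g: "inj_on g U" and open_gU: "open (g ` U)"
  using diffeo unfolding diffeomorphism_on_def by auto

lemma G_g: "x \<in> U \<Longrightarrow> G (g x) = x" using inj_g by (rule inv_into_f_f)

lemma g_G: "y \<in> g ` U \<Longrightarrow> g (G y) = y" "y \<in> g ` U \<Longrightarrow> G y \<in> U"
  by (auto simp: f_inv_into_f inv_into_into)

text \<open>The derivative is a multiple \<open>f\<close> of an orthogonal matrix. The inverse map is differentiable, which
forces \<open>f \<noteq> 0\<close> and makes its derivative scale by \<open>1 / \<bar>f\<bar>\<close>.\<close>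

lemma derivative_is_similarity:
  assumes x: "x \<in> U"
  obtains D D' where "(g has_derivative D) (at x)" "\<And>v. norm (D v) = scaling_ratio g x * norm v"
    "(G has_derivative D') (at (g x))" "\<And>v. norm (D' v) = norm v / scaling_ratio g x" "scaling_ratio g x > 0"
proof -
  obtain f Q where g: "g differentiable (at x)" and Q: "orthogonal_matrix Q" "jacobian g (at x) = f *\<^sub>R Q"
    using conformal x unfolding conformal_on_def by blast
  have c: "scaling_ratio g x = \<bar>f\<bar>" using scaling_ratio_eq[OF Q] .
  define D where "D = (*v) (jacobian g (at x))"
  have D: "(g has_derivative D) (at x)" using g unfolding D_def jacobian_works .
  have normD: "norm (D v) = \<bar>f\<bar> * norm v" for v
    unfolding D_def Q(2) using orthogonal_matrix_norm[OF Q(1)] by (simp add: scaleR_matrix_vector_assoc[symmetric])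
  have "C1_on (g ` U) G" using diffeo unfolding diffeomorphism_on_def by blast
  then obtain D' where D': "(G has_derivative D') (at (g x))"
    unfolding C1_on_def differentiable_def using x by blast
  have "(G \<circ> g has_derivative D' \<circ> D) (at x)" using D D' by (rule diff_chain_at)
  moreover have "(G \<circ> g has_derivative id) (at x)"
    using has_derivative_transform_within_open[OF has_derivative_id open_U x, of "G \<circ> g"] G_g by (simp add: id_def)
  ultimately have DD: "D' (D v) = v" for v using has_derivative_unique by (metis comp_apply id_apply)
  have f0: "f \<noteq> 0"
  proof
    assume "f = 0"
    then have "D v = 0" for v using normD[of v] by simp
    then have all0: "v = 0" for v :: "real^'d" using DD[of v] DD[of 0] by metis
    obtain v :: "real^'d" where "norm v = 1" using vector_choose_size[of 1] by auto
    then show False using all0[of v] by simp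
  qed
  have normD': "norm (D' w) = norm w / \<bar>f\<bar>" for w
  proof -
    have "linear D" using D has_derivative_linear by blast
    moreover have "inj D" using DD by (metis injI)
    ultimately have "surj D" using linear_injective_imp_surjective by blast
    then obtain v where "w = D v" by (metis surjD)
    then show ?thesis using DD normD f0 by simp
  qed
  show ?thesis using that[OF D _ D'] normD normD' c f0 by simp
qed

lemma scaling_ratio_pos: "x \<in> U \<Longrightarrow> scaling_ratio g x > 0" using derivative_is_similarity by metis

lemma continuous_scaling_ratio: "continuous_on U (scaling_ratio g)"
proof -
  obtain C where C: "\<And>x y. x \<in> U \<Longrightarrow> y \<in> U \<Longrightarrow> \<bar>scaling_ratio g x - scaling_ratio g y\<bar> \<le> C * dist x y powr \<alpha>"
    using holder unfolding holder_on_def by blast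
  show ?thesis unfolding continuous_on_def
  proof
    fix x assume x: "x \<in> U"
    have "((\<lambda>y. dist y x powr \<alpha>) \<longlongrightarrow> dist x x powr \<alpha>) (at x within U)"
      using \<alpha>_pos by (intro tendsto_powr' tendsto_intros) auto
    then have "((\<lambda>y. dist y x powr \<alpha>) \<longlongrightarrow> 0) (at x within U)" using \<alpha>_pos by simp
    then have "((\<lambda>y. C * dist y x powr \<alpha>) \<longlongrightarrow> 0) (at x within U)" by (rule tendsto_mult_right_zero)
    then have "((\<lambda>y. scaling_ratio g y - scaling_ratio g x) \<longlongrightarrow> 0) (at x within U)"
      by (rule Lim_null_comparison[rotated]) (use C x in \<open>auto simp: eventually_at_filter\<close>)
    then show "(scaling_ratio g \<longlongrightarrow> scaling_ratio g x) (at x within U)" by (simp add: LIM_zero_iff)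
  qed
qed

lemma continuous_g: "continuous_on U g"
  using derivative_is_similarity has_derivative_continuous continuous_at_imp_continuous_on by metis

lemma continuous_G: "continuous_on (g ` U) G"
  unfolding continuous_on_eq_continuous_at[OF open_gU]
proof
  fix y assume "y \<in> g ` U"
  then obtain x where "x \<in> U" "y = g x" by blast
  then show "isCont G y" using derivative_is_similarity[of x] has_derivative_continuous by metis
qed

lemma compact_image: "compact Y \<Longrightarrow> Y \<subseteq> U \<Longrightarrow> compact (g ` Y)"
  using continuous_g by (intro compact_continuous_image) (auto intro: continuous_on_subset)

text \<open>On the open set where the scaling ratio lies strictly between \<open>c / \<theta>\<close> and \<open>\<theta> * c\<close>, the map \<open>g\<close> has
local Lipschitz constant \<open>\<theta> * c\<close> and its inverse \<open>\<theta> / c\<close>.\<close>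

lemma nbhd_volume_distortion:
  assumes Y: "compact Y" "Y \<noteq> {}" "Y \<subseteq> U" and "c > 0" "\<theta> > 1"
    and ratio: "\<And>x. x \<in> Y \<Longrightarrow> c / \<theta> < scaling_ratio g x" "\<And>x. x \<in> Y \<Longrightarrow> scaling_ratio g x < \<theta> * c"
  obtains e where "e > 0"
    "\<And>\<epsilon>. 0 < \<epsilon> \<Longrightarrow> \<epsilon> \<le> e \<Longrightarrow>
      measure lborel (parallel_nbhd (g ` Y) \<epsilon>) \<le> (\<theta> * c) ^ CARD('d) * measure lborel (parallel_nbhd Y (\<theta> / c * \<epsilon>))"
    "\<And>\<epsilon>. 0 < \<epsilon> \<Longrightarrow> \<epsilon> \<le> e \<Longrightarrow>
      measure lborel (parallel_nbhd Y (\<epsilon> / (\<theta> * c))) \<le> (\<theta> / c) ^ CARD('d) * measure lborel (parallel_nbhd (g ` Y) \<epsilon>)"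
proof -
  define V where "V = {x \<in> U. scaling_ratio g x \<in> {c / \<theta><..<\<theta> * c}}"
  define W where "W = g ` V"
  have "\<theta> > 0" using \<open>\<theta> > 1\<close> by simp
  have VU: "V \<subseteq> U" unfolding V_def by auto
  have "V = U \<inter> scaling_ratio g -` {c / \<theta><..<\<theta> * c}" unfolding V_def by auto
  then have oV: "open V" using continuous_open_preimage[OF continuous_scaling_ratio open_U] by simp
  have WV: "W = g ` U \<inter> G -` V" unfolding W_def using VU G_g g_G by (auto simp: image_iff)
  have oW: "open W" unfolding WV using continuous_open_preimage[OF continuous_G open_gU oV] .
  have YV: "Y \<subseteq> V" unfolding V_def using Y ratio by auto
  have gYW: "g ` Y \<subseteq> W" unfolding W_def using YV by auto
  have cgY: "compact (g ` Y)" "g ` Y \<noteq> {}" using compact_image Y by auto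
  have GgY: "G ` g ` Y = Y" using Y G_g by (force simp: image_image)
  obtain e1 where e1: "e1 > 0" "parallel_nbhd (g ` Y) e1 \<subseteq> W" using parallel_nbhd_subset_open[OF cgY oW gYW] by metis
  obtain e2 where e2: "e2 > 0" "parallel_nbhd Y e2 \<subseteq> V" using parallel_nbhd_subset_open[OF Y(1,2) oV YV] by metis
  have pos: "\<theta> * c > 0" "\<theta> / c > 0" using \<open>c > 0\<close> \<open>\<theta> > 1\<close> by auto
  have inv_lt: "1 / scaling_ratio g x < \<theta> / c" if "x \<in> V" for x
  proof -
    have "c / \<theta> < scaling_ratio g x" "scaling_ratio g x > 0" using that scaling_ratio_pos unfolding V_def by auto
    then show ?thesis using \<open>\<theta> > 0\<close> \<open>c > 0\<close> by (simp add: field_simps)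
  qed
  have g_lip: "\<exists>r>0. \<forall>y. dist y x < r \<longrightarrow> dist (g y) (g x) \<le> \<theta> * c * dist y x" if x: "x \<in> V" for x
  proof -
    obtain D where "(g has_derivative D) (at x)" "\<And>v. norm (D v) = scaling_ratio g x * norm v"
      using derivative_is_similarity[of x] x VU by (metis subsetD)
    then show ?thesis using x unfolding V_def by (intro local_lipschitz_of_derivative[of g D x "scaling_ratio g x"]) auto
  qed
  have G_lip: "\<exists>r>0. \<forall>z. dist z y < r \<longrightarrow> dist (G z) (G y) \<le> \<theta> / c * dist z y" if y: "y \<in> W" for y
  proof -
    obtain x where x: "x \<in> V" "y = g x" using y unfolding W_def by blast
    obtain D where "(G has_derivative D) (at y)" "\<And>v. norm (D v) = norm v / scaling_ratio g x"
      using derivative_is_similarity[of x] x VU by (metis subsetD)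
    then show ?thesis using inv_lt[OF x(1)] by (intro local_lipschitz_of_derivative[of G D y "1 / scaling_ratio g x"]) auto
  qed
  have g_der: "\<exists>D. (g has_derivative D) (at x) \<and> onorm D \<le> \<theta> * c" if x: "x \<in> V" for x
  proof -
    obtain D where D: "(g has_derivative D) (at x)" "\<And>v. norm (D v) = scaling_ratio g x * norm v"
      using derivative_is_similarity[of x] x VU by (metis subsetD)
    have "onorm D \<le> \<theta> * c"
    proof (rule onorm_le)
      show "norm (D v) \<le> \<theta> * c * norm v" for v
        unfolding D(2) using x unfolding V_def by (intro mult_right_mono) auto
    qed
    then show ?thesis using D by blast
  qed
  have G_der: "\<exists>D. (G has_derivative D) (at y) \<and> onorm D \<le> \<theta> / c" if y: "y \<in> W" for y
  proof -
    obtain x where x: "x \<in> V" "y = g x" using y unfolding W_def by blast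
    obtain D where D: "(G has_derivative D) (at y)" "\<And>v. norm (D v) = norm v / scaling_ratio g x"
      using derivative_is_similarity[of x] x VU by (metis subsetD)
    have "onorm D \<le> \<theta> / c"
    proof (rule onorm_le)
      fix v
      have "norm (D v) = 1 / scaling_ratio g x * norm v" using D(2) by simp
      also have "\<dots> \<le> \<theta> / c * norm v" using inv_lt[OF x(1)] by (intro mult_right_mono) auto
      finally show "norm (D v) \<le> \<theta> / c * norm v" .
    qed
    then show ?thesis using D by blast
  qed
  define e where "e = min e1 (\<theta> * c * e2)"
  show ?thesis
  proof (rule that[of e])
    show "e > 0" unfolding e_def using e1 e2 pos by auto
    fix \<epsilon> assume \<epsilon>: "0 < \<epsilon>" "\<epsilon> \<le> e"
    have "parallel_nbhd (g ` Y) \<epsilon> \<subseteq> W" using e1(2) parallel_nbhd_mono[of \<epsilon> e1] \<epsilon> unfolding e_def by auto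
    from nbhd_volume_image_le[OF oV oW pos g_lip G_der _ _ cgY \<epsilon>(1) this]
    show "measure lborel (parallel_nbhd (g ` Y) \<epsilon>) \<le> (\<theta> * c) ^ CARD('d) * measure lborel (parallel_nbhd Y (\<theta> / c * \<epsilon>))"
      unfolding GgY using g_G unfolding WV by auto
    have \<epsilon>': "\<epsilon> / (\<theta> * c) > 0" using \<epsilon> pos by simp
    have "\<epsilon> / (\<theta> * c) \<le> e2" using \<epsilon> pos unfolding e_def by (simp add: pos_divide_le_eq mult.commute)
    then have "parallel_nbhd Y (\<epsilon> / (\<theta> * c)) \<subseteq> V" using e2(2) parallel_nbhd_mono by blast
    have inverse: "G (g x) = x" "g x \<in> W" if "x \<in> V" for x using G_g VU that unfolding W_def by auto
    from nbhd_volume_image_le[OF oW oV pos(2,1) G_lip g_der inverse Y(1,2) \<epsilon>' \<open>parallel_nbhd Y (\<epsilon> / (\<theta> * c)) \<subseteq> V\<close>]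
    have "measure lborel (parallel_nbhd Y (\<epsilon> / (\<theta> * c))) \<le> (\<theta> / c) ^ CARD('d) * measure lborel (parallel_nbhd (g ` Y) (\<theta> * c * (\<epsilon> / (\<theta> * c))))"
      by simp
    then show "measure lborel (parallel_nbhd Y (\<epsilon> / (\<theta> * c))) \<le> (\<theta> / c) ^ CARD('d) * measure lborel (parallel_nbhd (g ` Y) \<epsilon>)"
      using \<open>\<theta> > 0\<close> \<open>c > 0\<close> by simp
  qed
qed

text \<open>The exact powers of \<open>\<theta>\<close> are \<open>\<plusminus>(2 * d - s)\<close>; the exponent \<open>2 * d\<close> is coarser but independent of \<open>s\<close>.\<close>

lemma rescaled_volume_distortion:
  assumes Y: "compact Y" "Y \<noteq> {}" "Y \<subseteq> U" and "c > 0" "\<theta> > 1"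
    and ratio: "\<And>x. x \<in> Y \<Longrightarrow> c / \<theta> < scaling_ratio g x" "\<And>x. x \<in> Y \<Longrightarrow> scaling_ratio g x < \<theta> * c"
    and "s > 0"
  shows "eventually (\<lambda>t. rescaled_volume (g ` Y) s t \<le> \<theta> ^ (2 * CARD('d)) * c powr s * rescaled_volume Y s (t - ln (\<theta> / c))) at_top"
    and "eventually (\<lambda>t. c powr s / \<theta> ^ (2 * CARD('d)) * rescaled_volume Y s (t + ln (\<theta> * c)) \<le> rescaled_volume (g ` Y) s t) at_top"
proof -
  let ?d = "real CARD('d)"
  obtain e where e: "e > 0"
    "\<And>\<epsilon>. 0 < \<epsilon> \<Longrightarrow> \<epsilon> \<le> e \<Longrightarrow>
      measure lborel (parallel_nbhd (g ` Y) \<epsilon>) \<le> (\<theta> * c) ^ CARD('d) * measure lborel (parallel_nbhd Y (\<theta> / c * \<epsilon>))"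
    "\<And>\<epsilon>. 0 < \<epsilon> \<Longrightarrow> \<epsilon> \<le> e \<Longrightarrow>
      measure lborel (parallel_nbhd Y (\<epsilon> / (\<theta> * c))) \<le> (\<theta> / c) ^ CARD('d) * measure lborel (parallel_nbhd (g ` Y) \<epsilon>)"
    using nbhd_volume_distortion[OF Y \<open>c > 0\<close> \<open>\<theta> > 1\<close> ratio] by metis
  define T where "T = - ln e"
  have eps: "exp (- t) \<le> e" if "t \<ge> T" for t using that e(1) unfolding T_def by (metis exp_le_cancel_iff exp_ln minus_le_iff)
  have pos: "\<theta> > 0" "\<theta> * c > 0" "\<theta> / c > 0" using \<open>c > 0\<close> \<open>\<theta> > 1\<close> by auto
  have \<theta>s: "\<theta> powr (2 * ?d - s) \<le> \<theta> ^ (2 * CARD('d))"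
    using \<open>\<theta> > 1\<close> \<open>s > 0\<close> by (simp add: powr_realpow[symmetric])
  show "eventually (\<lambda>t. rescaled_volume (g ` Y) s t \<le> \<theta> ^ (2 * CARD('d)) * c powr s * rescaled_volume Y s (t - ln (\<theta> / c))) at_top"
  proof (rule eventually_at_top_linorderI[of T])
    fix t assume t: "t \<ge> T"
    have sh: "\<theta> / c * exp (- t) = exp (- (t - ln (\<theta> / c)))"
    proof -
      have "exp (- (t - ln (\<theta> / c))) = exp (ln (\<theta> / c)) * exp (- t)" by (simp add: exp_add[symmetric])
      then show ?thesis using pos by simp
    qed
    have "rescaled_volume (g ` Y) s t \<le> exp ((?d - s) * t) * ((\<theta> * c) ^ CARD('d) * measure lborel (parallel_nbhd Y (exp (- (t - ln (\<theta> / c))))))"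
      unfolding rescaled_volume_eq sh[symmetric] using e(2)[of "exp (- t)"] eps[OF t] by (intro mult_left_mono) auto
    also have "\<dots> = ((\<theta> * c) ^ CARD('d) * exp ((?d - s) * ln (\<theta> / c))) * rescaled_volume Y s (t - ln (\<theta> / c))"
      unfolding rescaled_volume_eq by (simp add: right_diff_distrib exp_diff)
    also have "(\<theta> * c) ^ CARD('d) * exp ((?d - s) * ln (\<theta> / c)) = \<theta> powr (2 * ?d - s) * c powr s"
      using pos \<open>c > 0\<close> by (simp add: powr_realpow[symmetric] powr_def ln_mult ln_div exp_add[symmetric] algebra_simps)
    also have "\<theta> powr (2 * ?d - s) * c powr s * rescaled_volume Y s (t - ln (\<theta> / c)) \<le> \<theta> ^ (2 * CARD('d)) * c powr s * rescaled_volume Y s (t - ln (\<theta> / c))"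
      using \<theta>s by (intro mult_right_mono) (auto simp: rescaled_volume_eq)
    finally show "rescaled_volume (g ` Y) s t \<le> \<theta> ^ (2 * CARD('d)) * c powr s * rescaled_volume Y s (t - ln (\<theta> / c))" .
  qed
  show "eventually (\<lambda>t. c powr s / \<theta> ^ (2 * CARD('d)) * rescaled_volume Y s (t + ln (\<theta> * c)) \<le> rescaled_volume (g ` Y) s t) at_top"
  proof (rule eventually_at_top_linorderI[of T])
    fix t assume t: "t \<ge> T"
    have sh: "exp (- t) / (\<theta> * c) = exp (- (t + ln (\<theta> * c)))"
    proof -
      have "exp (- (t + ln (\<theta> * c))) = exp (- t) / exp (ln (\<theta> * c))" by (simp add: exp_diff[symmetric])
      then show ?thesis using pos by simp
    qed
    have "rescaled_volume Y s (t + ln (\<theta> * c))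
        \<le> exp ((?d - s) * (t + ln (\<theta> * c))) * ((\<theta> / c) ^ CARD('d) * measure lborel (parallel_nbhd (g ` Y) (exp (- t))))"
      unfolding rescaled_volume_eq sh[symmetric] using e(3)[of "exp (- t)"] eps[OF t] by (intro mult_left_mono) auto
    also have "\<dots> = ((\<theta> / c) ^ CARD('d) * exp ((?d - s) * ln (\<theta> * c))) * rescaled_volume (g ` Y) s t"
      unfolding rescaled_volume_eq by (simp add: distrib_left exp_add)
    also have "(\<theta> / c) ^ CARD('d) * exp ((?d - s) * ln (\<theta> * c)) = \<theta> powr (2 * ?d - s) / c powr s"
      using pos \<open>c > 0\<close> by (simp add: powr_realpow[symmetric] powr_def ln_mult ln_div exp_add[symmetric] exp_diff[symmetric] algebra_simps)
    also have "\<theta> powr (2 * ?d - s) / c powr s * rescaled_volume (g ` Y) s t \<le> \<theta> ^ (2 * CARD('d)) / c powr s * rescaled_volume (g ` Y) s t"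
      using \<theta>s by (intro mult_right_mono divide_right_mono) (auto simp: rescaled_volume_eq)
    finally show "c powr s / \<theta> ^ (2 * CARD('d)) * rescaled_volume Y s (t + ln (\<theta> * c)) \<le> rescaled_volume (g ` Y) s t"
      using pos \<open>c > 0\<close> by (simp add: field_simps)
  qed
qed

end

section \<open>Limits for the conformal image\<close>

text \<open>Uniform continuity of \<open>ln h\<close>. Multiplicative errors fit the sandwich argument, in which volumes and
weights are multiplied.\<close>

lemma uniform_ratio_continuity:
  fixes h :: "'a::metric_space \<Rightarrow> real"
  assumes "compact K" "continuous_on K h" "\<And>x. x \<in> K \<Longrightarrow> h x > 0" "\<theta> > 1"
  obtains e where "e > 0" "\<And>x y. x \<in> K \<Longrightarrow> y \<in> K \<Longrightarrow> dist x y < e \<Longrightarrow> h x < \<theta> * h y"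
proof -
  have nz: "\<forall>x\<in>K. h x \<noteq> 0" using assms(3) by (metis less_irrefl)
  have "continuous_on K (\<lambda>x. ln (h x))" using assms(2) nz by (intro continuous_intros)
  then have "uniformly_continuous_on K (\<lambda>x. ln (h x))" using assms(1) by (rule compact_uniformly_continuous)
  then obtain e where e: "e > 0" "\<And>x y. x \<in> K \<Longrightarrow> y \<in> K \<Longrightarrow> dist y x < e \<Longrightarrow> dist (ln (h y)) (ln (h x)) < ln \<theta>"
    using assms(4) unfolding uniformly_continuous_on_def by (metis ln_gt_zero)
  show ?thesis
  proof (rule that[OF e(1)])
    fix x y assume xy: "x \<in> K" "y \<in> K" "dist x y < e"
    then have "\<bar>ln (h x) - ln (h y)\<bar> < ln \<theta>" using e(2)[of y x] by (simp add: dist_real_def)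
    then have "ln (h x) < ln (\<theta> * h y)" using assms(3)[OF xy(2)] assms(4) by (simp add: ln_mult)
    then show "h x < \<theta> * h y" using assms(3) xy assms(4) by simp
  qed
qed

lemma set_integral_bounds:
  fixes h :: "'a \<Rightarrow> real"
  assumes "A \<in> sets M" "emeasure M A < \<infinity>" "set_integrable M A h" "\<And>x. x \<in> A \<Longrightarrow> m \<le> h x" "\<And>x. x \<in> A \<Longrightarrow> h x \<le> m'"
  shows "m * measure M A \<le> (LINT x:A|M. h x)" "(LINT x:A|M. h x) \<le> m' * measure M A"
proof -
  have const: "set_integrable M A (\<lambda>_. c)" "(LINT x:A|M. c) = c * measure M A" for c :: real
    using assms(1,2) unfolding set_integrable_def set_lebesgue_integral_def by auto
  show "m * measure M A \<le> (LINT x:A|M. h x)"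
    unfolding const(2)[symmetric] using assms by (intro set_integral_mono const) auto
  show "(LINT x:A|M. h x) \<le> m' * measure M A"
    unfolding const(2)[symmetric] using assms by (intro set_integral_mono const) auto
qed

locale conformal_image = self_similar \<phi> r N K \<delta> + conformal_diffeomorphism U g \<alpha>
  for \<phi> :: "nat \<Rightarrow> real^'d \<Rightarrow> real^'d" and r N and K :: "(real^'d) set" and \<delta>
    and U :: "(real^'d) set" and g :: "real^'d \<Rightarrow> real^'d" and \<alpha> +
  assumes K_U: "K \<subseteq> U"
begin

definition F :: "(real^'d) set" where "F = g ` K"

abbreviation ratio :: "real^'d \<Rightarrow> real" where "ratio \<equiv> scaling_ratio g"

definition weighted_integral :: "(real^'d \<Rightarrow> real) \<Rightarrow> real" where
  "weighted_integral f = (LINT x:K|\<mu>. f (g x) * ratio x powr \<delta>)"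

lemma compact_F: "compact F" and F_nonempty: "F \<noteq> {}"
  unfolding F_def using compact_image[OF compact_K K_U] K_nonempty by auto

lemma continuous_weight:
  assumes "continuous_on UNIV f" shows "continuous_on K (\<lambda>x. f (g x) * ratio x powr \<delta>)"
proof (intro continuous_intros)
  show "continuous_on K (\<lambda>x. f (g x))"
    using continuous_on_subset[OF continuous_g K_U] by (rule continuous_on_compose2[OF assms]) auto
  show "continuous_on K ratio" using continuous_on_subset[OF continuous_scaling_ratio K_U] .
  show "\<forall>x\<in>K. ratio x \<noteq> 0" using scaling_ratio_pos K_U by (fastforce dest: less_imp_neq)
qed

lemma set_integrable_continuous_\<mu>:
  fixes h :: "real^'d \<Rightarrow> real"
  assumes "continuous_on K h" "compact A" "A \<subseteq> K" shows "set_integrable \<mu> A h"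
proof -
  have A: "A \<in> sets borel" using assms(2) by (simp add: borel_compact)
  have "bounded (h ` A)" using assms by (intro compact_imp_bounded compact_continuous_image) (auto intro: continuous_on_subset)
  then obtain B where B: "\<And>x. x \<in> A \<Longrightarrow> norm (h x) \<le> B" unfolding bounded_iff by auto
  have "(\<lambda>x. indicator A x *\<^sub>R h x) \<in> borel_measurable borel"
    using A continuous_on_subset[OF assms(1,3)] by (rule borel_measurable_continuous_on_indicator)
  then have meas: "(\<lambda>x. indicator A x *\<^sub>R h x) \<in> borel_measurable \<mu>"
    by (simp cong: measurable_cong_sets)
  show ?thesis unfolding set_integrable_def
  proof (rule integrableI_bounded_set[where A = A and B = B])
    show "emeasure \<mu> A < \<infinity>" using finite_measure.emeasure_finite[OF finite_measure_\<mu>] by (simp only: infinity_ennreal_def less_top)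
    show "AE x in \<mu>. x \<in> A \<longrightarrow> norm (indicator A x *\<^sub>R h x) \<le> B" using B by auto
  qed (use A meas in auto)
qed

lemma word_piece_compact: assumes "w \<in> words n"
  shows "compact (word_map w ` K)" "word_map w ` K \<noteq> {}" "word_map w ` K \<subseteq> K" "word_map w ` K \<subseteq> U"
  using similarity_compact[OF similarity_word[OF assms] compact_K] K_nonempty K_words[of n] assms K_U by blast+

text \<open>The weight of the word \<open>w\<close> is \<open>a w = f (g x\<^sub>w) \<bar>g'(x\<^sub>w)\<bar>^\<delta> r\<^sub>w^\<delta>\<close> for a point \<open>x\<^sub>w\<close> of the piece. Replacing
\<open>f\<close> by its value at \<open>g x\<^sub>w\<close> costs one factor \<open>\<theta>\<close>, and replacing \<open>g\<close> by a similarity costs \<open>2 * d\<close>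
factors. The last two inequalities compare the sum of the weights, as a Riemann sum, with
the integral: \<open>f\<close> contributes one factor \<open>\<theta>\<close> and the power of the scaling ratio contributes \<open>\<theta>^\<delta>\<close>.\<close>

lemma rescaled_integral_sandwich:
  fixes f :: "real^'d \<Rightarrow> real"
  assumes f: "continuous_on UNIV f" and f1: "\<And>x. f x \<ge> 1" and \<theta>: "\<theta> > 1"
  defines "E \<equiv> 2 * CARD('d) + 1"
  shows "\<exists>n a b c. (\<forall>w\<in>words n. a w > 0)
    \<and> eventually (\<lambda>t. rescaled_integral f F \<delta> t \<le> (\<Sum>w\<in>words n. \<theta> ^ E * a w * V (t - b w))) at_top
    \<and> eventually (\<lambda>t. (\<Sum>w\<in>words n. a w / \<theta> ^ E * V (t - c w)) \<le> rescaled_integral f F \<delta> t) at_top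
    \<and> (\<Sum>w\<in>words n. a w) \<le> \<theta> powr (1 + \<delta>) * weighted_integral f
    \<and> weighted_integral f \<le> \<theta> powr (1 + \<delta>) * (\<Sum>w\<in>words n. a w)"
proof -
  have rc: "continuous_on K ratio" using continuous_on_subset[OF continuous_scaling_ratio K_U] .
  have rp: "ratio x > 0" if "x \<in> K" for x using scaling_ratio_pos that K_U by blast
  have fg: "continuous_on K (\<lambda>x. f (g x))"
    using continuous_on_subset[OF continuous_g K_U] by (rule continuous_on_compose2[OF f]) auto
  have fp: "f x > 0" for x using f1[of x] by linarith
  obtain e1 where e1: "e1 > 0" "\<And>x y. x \<in> K \<Longrightarrow> y \<in> K \<Longrightarrow> dist x y < e1 \<Longrightarrow> ratio x < \<theta> * ratio y"
    using uniform_ratio_continuity[OF compact_K rc rp \<theta>] by blast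
  obtain e2 where e2: "e2 > 0" "\<And>x y. x \<in> K \<Longrightarrow> y \<in> K \<Longrightarrow> dist x y < e2 \<Longrightarrow> f (g x) < \<theta> * f (g y)"
    using uniform_ratio_continuity[OF compact_K fg fp \<theta>] by blast
  have "min e1 e2 > 0" using e1 e2 by simp
  then obtain n where n: "\<And>w x y. w \<in> words n \<Longrightarrow> x \<in> word_map w ` K \<Longrightarrow> y \<in> word_map w ` K \<Longrightarrow> dist x y < min e1 e2"
    using word_pieces_small by blast
  define P where "P w = word_map w ` K" for w
  have P: "compact (P w)" "P w \<noteq> {}" "P w \<subseteq> K" "P w \<subseteq> U" if "w \<in> words n" for w
    using word_piece_compact[OF that] unfolding P_def by auto
  define x where "x w = (SOME x. x \<in> P w)" for w
  have x: "x w \<in> P w" if "w \<in> words n" for w using P(2)[OF that] unfolding x_def by (auto intro: someI_ex)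
  have near_r: "ratio (x w) / \<theta> < ratio y" "ratio y < \<theta> * ratio (x w)"
    and near_f: "f (g (x w)) / \<theta> < f (g y)" "f (g y) < \<theta> * f (g (x w))" if "w \<in> words n" "y \<in> P w" for w y
  proof -
    have k: "x w \<in> K" "y \<in> K" "dist (x w) y < min e1 e2" "dist y (x w) < min e1 e2"
      using n[OF that(1)] x[OF that(1)] that P(3) unfolding P_def[symmetric] by blast+
    show "ratio y < \<theta> * ratio (x w)" "f (g y) < \<theta> * f (g (x w))" using k e1(2) e2(2) by auto
    have "ratio (x w) < \<theta> * ratio y" "f (g (x w)) < \<theta> * f (g y)" using k e1(2) e2(2) by auto
    then show "ratio (x w) / \<theta> < ratio y" "f (g (x w)) / \<theta> < f (g y)" using \<theta> by (auto simp: field_simps)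
  qed
  define p where "p w = word_ratio w powr \<delta>" for w
  define a where "a w = f (g (x w)) * ratio (x w) powr \<delta> * p w" for w
  have rw: "word_ratio w > 0" if "w \<in> words n" for w using similarity_word[OF that] by (simp add: similarity_def)
  have c: "ratio (x w) > 0" if "w \<in> words n" for w using rp x[OF that] P(3)[OF that] by blast
  have p: "p w > 0" if "w \<in> words n" for w using rw[OF that] unfolding p_def by simp
  have a: "a w > 0" if "w \<in> words n" for w using fp c[OF that] p[OF that] unfolding a_def by simp
  have vol: "rescaled_volume (P w) \<delta> t = p w * V (t + ln (word_ratio w))" if "w \<in> words n" for w t
    unfolding P_def p_def V_def by (rule rescaled_volume_similarity[OF similarity_word[OF that] compact_K K_nonempty])
  have cgP: "compact (g ` P w)" "g ` P w \<noteq> {}" if "w \<in> words n" for w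
    using compact_image P[OF that] by auto
  have F_eq: "F = (\<Union>w\<in>words n. g ` P w)" unfolding F_def P_def by (subst K_words[of n]) (rule image_UN)
  obtain T where split: "\<And>t. t \<ge> T \<Longrightarrow> rescaled_integral f F \<delta> t = (\<Sum>w\<in>words n. rescaled_integral f (g ` P w) \<delta> t)"
  proof -
    have "disjoint_family_on (\<lambda>w. g ` P w) (words n)"
      unfolding disjoint_family_on_def
    proof (intro ballI impI)
      fix u w assume uw: "u \<in> words n" "w \<in> words n" "u \<noteq> w"
      then have "P u \<inter> P w = {}" using word_pieces_disjoint unfolding disjoint_family_on_def P_def by blast
      then show "g ` P u \<inter> g ` P w = {}"
        using inj_on_image_Int[OF inj_g P(4)[OF uw(1)] P(4)[OF uw(2)]] by simp
    qed
    from rescaled_integral_split[OF finite_words words_nonempty cgP this f] show ?thesis using that F_eq by metis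
  qed
  have near: "eventually (\<lambda>t. \<forall>y\<in>parallel_nbhd (g ` P w) (exp (- t)). f (g (x w)) / \<theta> < f y \<and> f y < \<theta> * f (g (x w))) at_top"
    if w: "w \<in> words n" for w
  proof -
    define Q where "Q = f -` {f (g (x w)) / \<theta><..<\<theta> * f (g (x w))}"
    have "open Q" unfolding Q_def using f by (intro continuous_open_vimage[unfolded continuous_on_eq_continuous_at[OF open_UNIV]]) (auto simp: continuous_on_eq_continuous_at)
    moreover have "g ` P w \<subseteq> Q" unfolding Q_def using near_f[OF w] by auto
    ultimately obtain e where e: "e > 0" "parallel_nbhd (g ` P w) e \<subseteq> Q"
      using parallel_nbhd_subset_open[OF cgP[OF w]] by metis
    show ?thesis
    proof (rule eventually_at_top_linorderI[of "- ln e"])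
      fix t assume "t \<ge> - ln e"
      then have "exp (- t) \<le> e" using e(1) by (metis exp_le_cancel_iff exp_ln minus_le_iff)
      then show "\<forall>y\<in>parallel_nbhd (g ` P w) (exp (- t)). f (g (x w)) / \<theta> < f y \<and> f y < \<theta> * f (g (x w))"
        using e(2) parallel_nbhd_mono[of "exp (- t)" e "g ` P w"] unfolding Q_def by auto
    qed
  qed
  have distortion:
    "eventually (\<lambda>t. rescaled_volume (g ` P w) \<delta> t
      \<le> \<theta> ^ (2 * CARD('d)) * ratio (x w) powr \<delta> * rescaled_volume (P w) \<delta> (t - ln (\<theta> / ratio (x w)))) at_top"
    "eventually (\<lambda>t. ratio (x w) powr \<delta> / \<theta> ^ (2 * CARD('d)) * rescaled_volume (P w) \<delta> (t + ln (\<theta> * ratio (x w)))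
      \<le> rescaled_volume (g ` P w) \<delta> t) at_top" if w: "w \<in> words n" for w
    by (rule rescaled_volume_distortion[OF P(1,2,4)[OF w] c[OF w] \<theta> _ _ \<delta>_pos]; use near_r[OF w] in blast)+
  \<comment> \<open>On the logarithmic scale: the Lipschitz constant of the inverse (or of \<open>g\<close>) and the ratio of the
    piece relative to \<open>K\<close>.\<close>
  define b where "b w = ln (\<theta> / ratio (x w)) - ln (word_ratio w)" for w
  define d where "d w = - ln (\<theta> * ratio (x w)) - ln (word_ratio w)" for w
  have up: "eventually (\<lambda>t. rescaled_integral f (g ` P w) \<delta> t \<le> \<theta> ^ E * a w * V (t - b w)) at_top" if w: "w \<in> words n" for w
    using near[OF w] distortion(1)[OF w]
  proof eventually_elim
    case (elim t)
    have "rescaled_integral f (g ` P w) \<delta> t \<le> rescaled_integral (\<lambda>_. (\<theta> * f (g (x w))) * 1) (g ` P w) \<delta> t"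
      using elim(1) by (intro rescaled_integral_mono cgP[OF w] f) (auto intro: less_imp_le)
    also have "\<dots> = (\<theta> * f (g (x w))) * rescaled_volume (g ` P w) \<delta> t" by (rule rescaled_integral_cmult)
    also have "\<dots> \<le> (\<theta> * f (g (x w))) * (\<theta> ^ (2 * CARD('d)) * ratio (x w) powr \<delta> * rescaled_volume (P w) \<delta> (t - ln (\<theta> / ratio (x w))))"
      using elim(2) fp[of "g (x w)"] \<theta> by (intro mult_left_mono) auto
    also have "\<dots> = \<theta> ^ E * a w * V (t - b w)"
      unfolding vol[OF w] a_def b_def E_def by (simp add: algebra_simps)
    finally show ?case .
  qed
  have low: "eventually (\<lambda>t. a w / \<theta> ^ E * V (t - d w) \<le> rescaled_integral f (g ` P w) \<delta> t) at_top" if w: "w \<in> words n" for w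
    using near[OF w] distortion(2)[OF w]
  proof eventually_elim
    case (elim t)
    have "a w / \<theta> ^ E * V (t - d w) = (f (g (x w)) / \<theta>) * (ratio (x w) powr \<delta> / \<theta> ^ (2 * CARD('d)) * rescaled_volume (P w) \<delta> (t + ln (\<theta> * ratio (x w))))"
      unfolding vol[OF w] a_def d_def E_def by (simp add: algebra_simps)
    also have "\<dots> \<le> (f (g (x w)) / \<theta>) * rescaled_volume (g ` P w) \<delta> t"
      using elim(2) fp[of "g (x w)"] \<theta> by (intro mult_left_mono) auto
    also have "\<dots> = rescaled_integral (\<lambda>_. (f (g (x w)) / \<theta>) * 1) (g ` P w) \<delta> t" by (rule rescaled_integral_cmult[symmetric])
    also have "\<dots> \<le> rescaled_integral f (g ` P w) \<delta> t"
      using elim(1) by (intro rescaled_integral_mono cgP[OF w] f) (auto intro: less_imp_le)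
    finally show ?case .
  qed
  have up_sum: "eventually (\<lambda>t. rescaled_integral f F \<delta> t \<le> (\<Sum>w\<in>words n. \<theta> ^ E * a w * V (t - b w))) at_top"
  proof -
    have "eventually (\<lambda>t. \<forall>w\<in>words n. rescaled_integral f (g ` P w) \<delta> t \<le> \<theta> ^ E * a w * V (t - b w)) at_top"
      using up by (intro eventually_ball_finite finite_words) blast
    then show ?thesis using eventually_ge_at_top[of T]
    proof eventually_elim
      case (elim t)
      show ?case unfolding split[OF elim(2)] using elim(1) by (intro sum_mono) blast
    qed
  qed
  have low_sum: "eventually (\<lambda>t. (\<Sum>w\<in>words n. a w / \<theta> ^ E * V (t - d w)) \<le> rescaled_integral f F \<delta> t) at_top"
  proof -
    have "eventually (\<lambda>t. \<forall>w\<in>words n. a w / \<theta> ^ E * V (t - d w) \<le> rescaled_integral f (g ` P w) \<delta> t) at_top"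
      using low by (intro eventually_ball_finite finite_words) blast
    then show ?thesis using eventually_ge_at_top[of T]
    proof eventually_elim
      case (elim t)
      show ?case unfolding split[OF elim(2)] using elim(1) by (intro sum_mono) blast
    qed
  qed
  define \<Psi> where "\<Psi> y = f (g y) * ratio y powr \<delta>" for y
  have \<Psi>: "continuous_on K \<Psi>" unfolding \<Psi>_def using continuous_weight[OF f] .
  have Pb: "P w \<in> sets \<mu>" if "w \<in> words n" for w using P(1)[OF that] by (simp add: borel_compact)
  have W: "weighted_integral f = (\<Sum>w\<in>words n. LINT y:P w|\<mu>. \<Psi> y)"
  proof -
    have "weighted_integral f = (LINT y:(\<Union>w\<in>words n. P w)|\<mu>. \<Psi> y)"
      unfolding weighted_integral_def \<Psi>_def P_def K_words[of n, symmetric] ..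
    also have "\<dots> = (\<Sum>w\<in>words n. LINT y:P w|\<mu>. \<Psi> y)"
      using word_pieces_disjoint[of n] Pb unfolding P_def[symmetric]
      by (intro set_integral_finite_Union finite_words set_integrable_continuous_\<mu> \<Psi> P) auto
    finally show ?thesis .
  qed
  have piece: "a w / \<theta> powr (1 + \<delta>) \<le> (LINT y:P w|\<mu>. \<Psi> y)" "(LINT y:P w|\<mu>. \<Psi> y) \<le> \<theta> powr (1 + \<delta>) * a w" if w: "w \<in> words n" for w
  proof -
    have m: "measure \<mu> (P w) = p w" unfolding P_def p_def by (rule measure_\<mu>_word[OF w])
    define A where "A = f (g (x w)) * ratio (x w) powr \<delta>"
    have \<theta>1: "\<theta> powr (1 + \<delta>) = \<theta> * \<theta> powr \<delta>" using \<theta> by (simp add: powr_add)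
    have bounds: "A / \<theta> powr (1 + \<delta>) \<le> \<Psi> y" "\<Psi> y \<le> \<theta> powr (1 + \<delta>) * A" if y: "y \<in> P w" for y
    proof -
      have ry: "ratio y > 0" using rp P(3)[OF w] y by blast
      have "0 \<le> ratio (x w) / \<theta>" "0 \<le> \<theta> * ratio (x w)" using c[OF w] \<theta> by auto
      then have "(ratio (x w) / \<theta>) powr \<delta> \<le> ratio y powr \<delta>" "ratio y powr \<delta> \<le> (\<theta> * ratio (x w)) powr \<delta>"
        using near_r[OF w y] ry \<delta>_pos by (simp_all add: powr_mono2)
      then have r: "ratio (x w) powr \<delta> / \<theta> powr \<delta> \<le> ratio y powr \<delta>" "ratio y powr \<delta> \<le> \<theta> powr \<delta> * ratio (x w) powr \<delta>"
        using c[OF w] \<theta> by (auto simp: powr_divide powr_mult)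
      have "f (g (x w)) / \<theta> * (ratio (x w) powr \<delta> / \<theta> powr \<delta>) \<le> \<Psi> y"
        unfolding \<Psi>_def using less_imp_le[OF near_f(1)[OF w y]] r(1)
      proof (rule mult_mono)
        show "0 \<le> f (g y)" using fp[of "g y"] by simp
        show "0 \<le> ratio (x w) powr \<delta> / \<theta> powr \<delta>" by simp
      qed
      then show "A / \<theta> powr (1 + \<delta>) \<le> \<Psi> y" unfolding A_def \<theta>1 by simp
      have "\<Psi> y \<le> (\<theta> * f (g (x w))) * (\<theta> powr \<delta> * ratio (x w) powr \<delta>)"
        unfolding \<Psi>_def using less_imp_le[OF near_f(2)[OF w y]] r(2)
      proof (rule mult_mono)
        show "0 \<le> \<theta> * f (g (x w))" using fp[of "g (x w)"] \<theta> by simp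
        show "0 \<le> ratio y powr \<delta>" by simp
      qed
      then show "\<Psi> y \<le> \<theta> powr (1 + \<delta>) * A" unfolding A_def \<theta>1 by (simp add: algebra_simps)
    qed
    have fin: "emeasure \<mu> (P w) < \<infinity>" using finite_measure.emeasure_finite[OF finite_measure_\<mu>] by (simp only: infinity_ennreal_def less_top)
    have int: "set_integrable \<mu> (P w) \<Psi>" by (rule set_integrable_continuous_\<mu>[OF \<Psi> P(1)[OF w] P(3)[OF w]])
    have B: "A / \<theta> powr (1 + \<delta>) * measure \<mu> (P w) \<le> (LINT y:P w|\<mu>. \<Psi> y)"
      "(LINT y:P w|\<mu>. \<Psi> y) \<le> \<theta> powr (1 + \<delta>) * A * measure \<mu> (P w)"
      by (rule set_integral_bounds[OF Pb[OF w] fin int bounds]; assumption)+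
    show "a w / \<theta> powr (1 + \<delta>) \<le> (LINT y:P w|\<mu>. \<Psi> y)" using B(1) unfolding m a_def A_def by simp
    show "(LINT y:P w|\<mu>. \<Psi> y) \<le> \<theta> powr (1 + \<delta>) * a w" using B(2) unfolding m a_def A_def by (simp add: mult.assoc)
  qed
  have \<theta>p: "\<theta> powr (1 + \<delta>) > 0" using \<theta> by simp
  have "(\<Sum>w\<in>words n. a w) / \<theta> powr (1 + \<delta>) \<le> weighted_integral f"
    unfolding W sum_divide_distrib using piece by (intro sum_mono)
  then have "(\<Sum>w\<in>words n. a w) \<le> \<theta> powr (1 + \<delta>) * weighted_integral f" using \<theta>p by (simp add: field_simps)
  moreover have "weighted_integral f \<le> \<theta> powr (1 + \<delta>) * (\<Sum>w\<in>words n. a w)"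
    unfolding W sum_distrib_left using piece by (intro sum_mono)
  ultimately show ?thesis using a up_sum low_sum
    by (intro exI[of _ n] exI[of _ a] exI[of _ b] exI[of _ d] conjI ballI)
qed

text \<open>The sandwich with \<open>f = 1\<close> and the arbitrary value \<open>\<theta> = 2\<close>.\<close>

lemma F_volume_bounds:
  obtains T c B where "0 < c" "\<And>t. t \<ge> T \<Longrightarrow> c \<le> rescaled_volume F \<delta> t" "\<And>t. t \<ge> T \<Longrightarrow> rescaled_volume F \<delta> t \<le> B"
proof -
  obtain T0 c0 B0 where "0 < c0" and V: "\<And>t. t \<ge> T0 \<Longrightarrow> c0 \<le> V t" "\<And>t. t \<ge> T0 \<Longrightarrow> V t \<le> B0" using V_bounds by metis
  have shift: "eventually (\<lambda>t. \<forall>w\<in>words n. t - b w \<ge> T0) at_top" for b n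
  proof (intro eventually_ball_finite finite_words ballI)
    show "eventually (\<lambda>t. t - b w \<ge> T0) at_top" for w
      by (rule eventually_at_top_linorderI[of "T0 + b w"]) simp
  qed
  define E where "E = 2 * CARD('d) + 1"
  have one_less_two: "(1::real) < 2" by simp
  obtain n a b c where s: "\<forall>w\<in>words n. a w > 0"
    "eventually (\<lambda>t. rescaled_volume F \<delta> t \<le> (\<Sum>w\<in>words n. 2 ^ E * a w * V (t - b w))) at_top"
    "eventually (\<lambda>t. (\<Sum>w\<in>words n. a w / 2 ^ E * V (t - c w)) \<le> rescaled_volume F \<delta> t) at_top"
    using rescaled_integral_sandwich[of "\<lambda>_. 1" 2, OF continuous_on_const order_refl one_less_two] unfolding E_def by blast
  have 1: "eventually (\<lambda>t. rescaled_volume F \<delta> t \<le> (\<Sum>w\<in>words n. 2 ^ E * a w * B0)) at_top"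
    using s(2) shift[of n b]
  proof eventually_elim
    case (elim t)
    have "(\<Sum>w\<in>words n. 2 ^ E * a w * V (t - b w)) \<le> (\<Sum>w\<in>words n. 2 ^ E * a w * B0)"
      using s(1) elim(2) V(2) by (intro sum_mono mult_left_mono) (auto intro: less_imp_le)
    then show ?case using elim(1) by linarith
  qed
  have 2: "eventually (\<lambda>t. (\<Sum>w\<in>words n. a w / 2 ^ E * c0) \<le> rescaled_volume F \<delta> t) at_top"
    using s(3) shift[of n c]
  proof eventually_elim
    case (elim t)
    have "(\<Sum>w\<in>words n. a w / 2 ^ E * c0) \<le> (\<Sum>w\<in>words n. a w / 2 ^ E * V (t - c w))"
      using s(1) elim(2) V(1) by (intro sum_mono mult_left_mono) (auto intro: less_imp_le)
    then show ?case using elim(1) by linarith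
  qed
  have "(\<Sum>w\<in>words n. a w / 2 ^ E * c0) > 0"
    using s(1) \<open>0 < c0\<close> finite_words words_nonempty by (intro sum_pos) auto
  moreover obtain T where "\<And>t. t \<ge> T \<Longrightarrow> rescaled_volume F \<delta> t \<le> (\<Sum>w\<in>words n. 2 ^ E * a w * B0) \<and> (\<Sum>w\<in>words n. a w / 2 ^ E * c0) \<le> rescaled_volume F \<delta> t"
    using eventually_conj[OF 1 2] unfolding eventually_at_top_linorder by blast
  ultimately show ?thesis using that by blast
qed

lemma minkowski_dim_F: "has_minkowski_dim F \<delta>"
proof -
  obtain T c B where "0 < c" "\<And>t. t \<ge> T \<Longrightarrow> c \<le> rescaled_volume F \<delta> t" "\<And>t. t \<ge> T \<Longrightarrow> rescaled_volume F \<delta> t \<le> B"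
    using F_volume_bounds by metis
  then show ?thesis by (intro minkowski_dim_of_volume_bounds[of c T F \<delta> B]) auto
qed

lemma tame_F:
  assumes "continuous_on UNIV f" "\<And>x. \<bar>f x\<bar> \<le> B" shows "tame (rescaled_integral f F \<delta>)"
proof -
  obtain T b where "\<And>t. t \<ge> T \<Longrightarrow> rescaled_volume F \<delta> t \<le> b" using F_volume_bounds by metis
  then show ?thesis using rescaled_integral_tame[OF compact_F F_nonempty assms] by blast
qed

lemma weighted_integral_diff:
  assumes "continuous_on UNIV f" "continuous_on UNIV h"
  shows "weighted_integral (\<lambda>x. f x - h x) = weighted_integral f - weighted_integral h"
proof -
  note i = set_integrable_continuous_\<mu>[OF continuous_weight compact_K order_refl]
  show ?thesis unfolding weighted_integral_def using set_integral_diff(2)[OF i[OF assms(1)] i[OF assms(2)]]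
    by (simp add: left_diff_distrib)
qed

text \<open>All errors of the sandwich combine to the factor \<open>\<theta>^(E + 1 + \<delta>)\<close>, so the given \<open>\<theta>'\<close> is met by its
root of that order.\<close>

lemma tends_to_weighted_integral_ge_1:
  assumes M: "tends_to av V M" "M \<ge> 0"
    and f: "continuous_on UNIV f" "\<And>x. \<bar>f x\<bar> \<le> B" "\<And>x. f x \<ge> 1"
  shows "tends_to av (rescaled_integral f F \<delta>) (M * weighted_integral f)"
proof (rule tends_to_sandwich[OF tame_F[OF f(1,2)]])
  fix \<theta>' :: real assume "\<theta>' > 1"
  define E where "E = 2 * CARD('d) + 1"
  define e where "e = real E + (1 + \<delta>)"
  have "e > 0" unfolding e_def using \<delta>_pos by simp
  define \<theta> where "\<theta> = \<theta>' powr (1 / e)"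
  have \<theta>: "\<theta> > 1" unfolding \<theta>_def using \<open>\<theta>' > 1\<close> \<open>e > 0\<close> by simp
  have \<theta>': "\<theta> ^ E * \<theta> powr (1 + \<delta>) = \<theta>'"
  proof -
    have "\<theta> ^ E * \<theta> powr (1 + \<delta>) = \<theta> powr e" unfolding e_def powr_add using \<theta> by (simp add: powr_realpow)
    also have "\<dots> = \<theta>'" unfolding \<theta>_def powr_powr using \<open>e > 0\<close> \<open>\<theta>' > 1\<close> by simp
    finally show ?thesis .
  qed
  obtain n a b c where s: "\<forall>w\<in>words n. a w > 0"
    "eventually (\<lambda>t. rescaled_integral f F \<delta> t \<le> (\<Sum>w\<in>words n. \<theta> ^ E * a w * V (t - b w))) at_top"
    "eventually (\<lambda>t. (\<Sum>w\<in>words n. a w / \<theta> ^ E * V (t - c w)) \<le> rescaled_integral f F \<delta> t) at_top"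
    "(\<Sum>w\<in>words n. a w) \<le> \<theta> powr (1 + \<delta>) * weighted_integral f"
    "weighted_integral f \<le> \<theta> powr (1 + \<delta>) * (\<Sum>w\<in>words n. a w)"
    using rescaled_integral_sandwich[OF f(1,3) \<theta>] unfolding E_def by blast
  have tame: "tame (\<lambda>t. k w * V (t - b w))" for k b :: "nat list \<Rightarrow> real" and w
    by (intro tame_cmult tame_shift V_tame)
  have lim: "tends_to av (\<lambda>t. \<Sum>w\<in>words n. k w * V (t - b w)) (\<Sum>w\<in>words n. k w * M)" for k b
    by (intro tends_to_sum tame tends_to_cmult tends_to_shift V_tame M)
  let ?S = "\<Sum>w\<in>words n. a w"
  have up: "(\<Sum>w\<in>words n. \<theta> ^ E * a w * M) \<le> \<theta>' * (M * weighted_integral f)"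
  proof -
    have "(\<Sum>w\<in>words n. \<theta> ^ E * a w * M) = \<theta> ^ E * M * ?S" by (simp add: sum_distrib_left mult_ac)
    also have "\<dots> \<le> \<theta> ^ E * M * (\<theta> powr (1 + \<delta>) * weighted_integral f)"
      using s(4) M(2) \<theta> by (intro mult_left_mono) auto
    also have "\<dots> = (\<theta> ^ E * \<theta> powr (1 + \<delta>)) * (M * weighted_integral f)" by (simp add: mult_ac)
    finally show ?thesis unfolding \<theta>' .
  qed
  have low: "M * weighted_integral f / \<theta>' \<le> (\<Sum>w\<in>words n. a w / \<theta> ^ E * M)"
  proof -
    have "M * weighted_integral f / \<theta>' \<le> M * (\<theta> powr (1 + \<delta>) * ?S) / \<theta>'"
      using s(5) M(2) \<open>\<theta>' > 1\<close> by (intro divide_right_mono mult_left_mono) auto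
    also have "\<dots> = M * ?S / \<theta> ^ E" unfolding \<theta>'[symmetric] using \<theta> by simp
    also have "\<dots> = (\<Sum>w\<in>words n. a w / \<theta> ^ E * M)" by (simp add: sum_distrib_left sum_divide_distrib mult_ac)
    finally show ?thesis .
  qed
  show "\<exists>h1 h2 l1 l2. tame h1 \<and> tame h2 \<and> tends_to av h1 l1 \<and> tends_to av h2 l2
        \<and> eventually (\<lambda>t. h1 t \<le> rescaled_integral f F \<delta> t) at_top \<and> eventually (\<lambda>t. rescaled_integral f F \<delta> t \<le> h2 t) at_top
        \<and> M * weighted_integral f / \<theta>' \<le> l1 \<and> l2 \<le> \<theta>' * (M * weighted_integral f)"
    by (intro exI conjI, rule tame_sum[OF tame], rule tame_sum[OF tame], rule lim, rule lim,
      rule s(3), rule s(2), rule low, rule up)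
qed

text \<open>A bounded \<open>f\<close> is the difference of \<open>f + c\<close> and \<open>c\<close>, both at least \<open>1\<close> for large \<open>c\<close>.\<close>

theorem tends_to_weighted_integral:
  assumes M: "tends_to av V M" "M \<ge> 0"
    and f: "continuous_on UNIV f" "\<And>x. \<bar>f x\<bar> \<le> B"
  shows "tends_to av (rescaled_integral f F \<delta>) (M * weighted_integral f)"
proof -
  define c where "c = \<bar>B\<bar> + 1"
  define h where "h x = f x + c" for x
  have h: "continuous_on UNIV h" "\<And>x. \<bar>h x\<bar> \<le> \<bar>B\<bar> + c" "\<And>x. h x \<ge> 1"
  proof -
    show "continuous_on UNIV h" unfolding h_def by (intro continuous_intros f)
    fix x show "\<bar>h x\<bar> \<le> \<bar>B\<bar> + c" "h x \<ge> 1" unfolding h_def c_def using f(2)[of x] by auto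
  qed
  have k: "continuous_on UNIV (\<lambda>_::real^'d. c)" "\<And>x::real^'d. \<bar>c\<bar> \<le> c" "\<And>x::real^'d. c \<ge> 1" unfolding c_def by auto
  have "tends_to av (\<lambda>t. rescaled_integral h F \<delta> t + (-1) * rescaled_integral (\<lambda>_. c) F \<delta> t)
      (M * weighted_integral h + (-1) * (M * weighted_integral (\<lambda>_. c)))"
    by (intro tends_to_add tends_to_cmult tame_cmult tends_to_weighted_integral_ge_1[OF M h]
        tends_to_weighted_integral_ge_1[OF M k] tame_F[OF h(1,2)] tame_F[OF k(1,2)])
  moreover have "rescaled_integral h F \<delta> t + (-1) * rescaled_integral (\<lambda>_. c) F \<delta> t = rescaled_integral f F \<delta> t" for t
    using rescaled_integral_diff[OF compact_F F_nonempty h(1) k(1), of \<delta> t] unfolding h_def by simp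
  moreover have "M * weighted_integral h + (-1) * (M * weighted_integral (\<lambda>_. c)) = M * weighted_integral f"
  proof -
    have "weighted_integral h - weighted_integral (\<lambda>_. c) = weighted_integral f"
      using weighted_integral_diff[OF h(1) k(1), symmetric] by (simp add: h_def)
    then show ?thesis by (simp add: right_diff_distrib[symmetric])
  qed
  ultimately show ?thesis by simp
qed

end

section \<open>Averaged and rescaled measures\<close>

text \<open>The substitution \<open>\<epsilon> = exp (-t)\<close> turns the average with respect to \<open>d\<epsilon> / \<epsilon>\<close> into a mean over \<open>t\<close>.\<close>

lemma log_average_eq:
  assumes H: "tame H" and T: "0 < T" "T < 1"
  shows "set_integrable lborel {T..1} (\<lambda>\<epsilon>. H (- ln \<epsilon>) / \<epsilon>)"
    and "(LINT \<epsilon>:{T..1}|lborel. H (- ln \<epsilon>) / \<epsilon>) = integral {0..- ln T} H"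
proof -
  obtain B where B: "B \<ge> 0" "\<And>t. t \<ge> 0 \<Longrightarrow> \<bar>H t\<bar> \<le> B" using tame_bound[OF H] by metis
  have [measurable]: "H \<in> borel_measurable borel" using tame_measurable[OF H] .
  have m: "(\<lambda>\<epsilon>. H (- ln \<epsilon>) / \<epsilon>) \<in> borel_measurable borel" by measurable
  have bound: "norm (H (- ln \<epsilon>) / \<epsilon>) \<le> B / T" if "\<epsilon> \<in> {T..1}" for \<epsilon>
  proof -
    have e: "0 < \<epsilon>" "T \<le> \<epsilon>" "0 \<le> - ln \<epsilon>" using that T by auto
    have "\<bar>H (- ln \<epsilon>)\<bar> / \<epsilon> \<le> B / T" using B e T by (intro frac_le) auto
    then show ?thesis using e by (simp add: abs_div)
  qed
  show int: "set_integrable lborel {T..1} (\<lambda>\<epsilon>. H (- ln \<epsilon>) / \<epsilon>)"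
    unfolding set_integrable_def
    using bound m by (intro integrableI_bounded_set_indicator[where B="B / T"]) (auto simp: emeasure_lborel_Icc_eq)
  have "ln T \<le> 0" using T by simp
  have subst: "(LBINT x. H (- ln x) / x * indicator {exp (ln T)..exp 0} x) = (LBINT x. H (- ln (exp x)) / exp x * exp x * indicator {ln T..0} x)"
    using int T \<open>ln T \<le> 0\<close> by (intro integral_substitution) (auto intro!: derivative_eq_intros continuous_intros)
  have "(LINT \<epsilon>:{T..1}|lborel. H (- ln \<epsilon>) / \<epsilon>) = (LBINT x. H (- ln x) / x * indicator {exp (ln T)..exp 0} x)"
    unfolding set_lebesgue_integral_def using T by (simp add: mult.commute)
  also have "\<dots> = (LINT x:{ln T..0}|lborel. H (- x))"
    unfolding subst set_lebesgue_integral_def by (simp add: mult.commute)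
  also have "\<dots> = integral {ln T..0} (\<lambda>x. H (- x))"
  proof (rule set_borel_integral_eq_integral)
    show "set_integrable lborel {ln T..0} (\<lambda>x. H (- x))"
      unfolding set_integrable_def
      using B by (intro integrableI_bounded_set_indicator[where B=B]) (auto simp: emeasure_lborel_Icc_eq)
  qed
  also have "\<dots> = integral {0..- ln T} H" using Henstock_Kurzweil_Integration.integral_reflect_real[of "- ln T" "0" H] by simp
  finally show "(LINT \<epsilon>:{T..1}|lborel. H (- ln \<epsilon>) / \<epsilon>) = integral {0..- ln T} H" .
qed

lemma neg_ln_at_right_0: "filterlim (\<lambda>T::real. - ln T) at_top (at_right 0)"
  using ln_at_0 by (simp add: filterlim_uminus_at_bot)

lemma tends_to_True_log:
  assumes "tame H" "tends_to True H l"
  shows "((\<lambda>T. 1 / \<bar>ln T\<bar> * (LINT \<epsilon>:{T..1}|lborel. H (- ln \<epsilon>) / \<epsilon>)) \<longlongrightarrow> l) (at_right 0)"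
proof (rule Lim_transform_eventually)
  show "((\<lambda>T. integral {0..- ln T} H / (- ln T)) \<longlongrightarrow> l) (at_right 0)"
  proof -
    have "((\<lambda>L. integral {0..L} H / L) \<longlongrightarrow> l) at_top" using assms(2) unfolding tends_to_def by simp
    from filterlim_compose[OF this neg_ln_at_right_0] show ?thesis .
  qed
  show "eventually (\<lambda>T. integral {0..- ln T} H / (- ln T) = 1 / \<bar>ln T\<bar> * (LINT \<epsilon>:{T..1}|lborel. H (- ln \<epsilon>) / \<epsilon>)) (at_right 0)"
    using eventually_at_right_real[of 0 "1::real"] 
  proof (rule eventually_mono)
    fix T :: real assume "T \<in> {0<..<1}"
    then show "integral {0..- ln T} H / (- ln T) = 1 / \<bar>ln T\<bar> * (LINT \<epsilon>:{T..1}|lborel. H (- ln \<epsilon>) / \<epsilon>)"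
      using log_average_eq(2)[OF assms(1), of T] by simp
  qed simp
qed

lemma tends_to_False_log:
  assumes "tends_to False H l" shows "((\<lambda>\<epsilon>. H (- ln \<epsilon>)) \<longlongrightarrow> l) (at_right 0)"
  using assms neg_ln_at_right_0 unfolding tends_to_def by (auto intro: filterlim_compose)

lemma rescaled_integral_at:
  fixes Y :: "(real^'d) set"
  assumes "\<epsilon> > 0"
  shows "rescaled_integral f Y s (- ln \<epsilon>) = \<epsilon> powr (s - real CARD('d)) * (LINT x:parallel_nbhd Y \<epsilon>|lborel. f x)"
  unfolding rescaled_integral_def powr_def using assms by (simp add: algebra_simps)

text \<open>Nonnegative test functions suffice, so integrals can be computed as nonnegative integrals.\<close>

lemma weak_limit_nonnegI:
  fixes \<nu> :: "'a::topological_space measure"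
  assumes ev: "eventually (\<lambda>t. finite_measure (M t) \<and> sets (M t) = sets borel) L"
    and \<nu>: "finite_measure \<nu>" "sets \<nu> = sets borel"
    and lim: "\<And>f :: 'a \<Rightarrow> real. continuous_on UNIV f \<Longrightarrow> bounded (range f) \<Longrightarrow> (\<And>x. f x \<ge> 0) \<Longrightarrow>
      ((\<lambda>t. \<integral>x. f x \<partial>M t) \<longlongrightarrow> (\<integral>x. f x \<partial>\<nu>)) L"
  shows "weak_limit M \<nu> L"
  unfolding weak_limit_def
proof (intro conjI allI impI ev \<nu>)
  fix f :: "'a \<Rightarrow> real" assume f: "continuous_on UNIV f \<and> bounded (range f)"
  then obtain B where B: "\<And>x. \<bar>f x\<bar> \<le> B" unfolding bounded_iff by auto
  define c where "c = \<bar>B\<bar>"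
  define h where "h x = f x + c" for x
  have h: "continuous_on UNIV h" "\<And>x. h x \<ge> 0" "\<And>x. \<bar>h x\<bar> \<le> 2 * c"
  proof -
    show "continuous_on UNIV h" unfolding h_def using f by (intro continuous_intros) auto
    fix x show "h x \<ge> 0" "\<bar>h x\<bar> \<le> 2 * c" unfolding h_def c_def using B[of x] by auto
  qed
  have hb: "bounded (range h)" unfolding bounded_iff using h(3) by auto
  have kb: "bounded (range (\<lambda>_::'a. c))" "\<And>x::'a. c \<ge> 0" unfolding c_def by auto
  have diff: "(\<integral>x. h x \<partial>N) - (\<integral>x. c \<partial>N) = (\<integral>x. f x \<partial>N)" if N: "finite_measure N" "sets N = sets borel" for N :: "'a measure"
  proof -
    interpret N: finite_measure N by fact
    have "h \<in> borel_measurable N" using h(1) N(2) by (simp add: borel_measurable_continuous_onI cong: measurable_cong_sets)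
    then have "integrable N h" using h(3) by (intro N.integrable_const_bound[where B="2 * c"]) auto
    then have "(\<integral>x. h x \<partial>N) - (\<integral>x. c \<partial>N) = (\<integral>x. h x - c \<partial>N)" by (intro Bochner_Integration.integral_diff[symmetric]) auto
    then show ?thesis unfolding h_def by simp
  qed
  have "((\<lambda>t. (\<integral>x. h x \<partial>M t) - (\<integral>x. c \<partial>M t)) \<longlongrightarrow> (\<integral>x. h x \<partial>\<nu>) - (\<integral>x. c \<partial>\<nu>)) L"
    by (intro tendsto_diff lim h hb continuous_on_const kb)
  moreover have "eventually (\<lambda>t. (\<integral>x. h x \<partial>M t) - (\<integral>x. c \<partial>M t) = (\<integral>x. f x \<partial>M t)) L"
    using ev
  proof eventually_elim
    case (elim t)
    then show ?case by (intro diff) auto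
  qed
  ultimately show "((\<lambda>t. \<integral>x. f x \<partial>M t) \<longlongrightarrow> (\<integral>x. f x \<partial>\<nu>)) L"
    unfolding diff[OF \<nu>] by (rule Lim_transform_eventually)
qed

lemma measure_of_emeasure_eq:
  assumes "sets M = sets borel" "\<And>B. B \<in> sets borel \<Longrightarrow> \<mu> B = emeasure M B"
  shows "measure_of UNIV (sets borel) \<mu> = (M :: 'a::topological_space measure)"
proof -
  have sp: "space M = UNIV" using sets_eq_imp_space_eq[OF assms(1)] by simp
  have "measure_of UNIV (sets borel) \<mu> = measure_of UNIV (sets borel) (emeasure M)"
  proof (rule measure_of_eq)
    show "sets borel \<subseteq> Pow (UNIV :: 'a set)" by simp
    show "\<mu> B = emeasure M B" if "B \<in> sigma_sets UNIV (sets (borel :: 'a measure))" for B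
      using that assms(2) sets.sigma_sets_eq[of "borel :: 'a measure"] by simp
  qed
  also have "\<dots> = M" using measure_of_of_measure[of M] unfolding sp assms(1) .
  finally show ?thesis .
qed

lemma rescaled_measure_eq_density:
  fixes Y :: "(real^'d) set"
  shows "rescaled_measure s Y \<epsilon> = density lborel (\<lambda>x. ennreal (\<epsilon> powr (s - real CARD('d))) * indicator (parallel_nbhd Y \<epsilon>) x)"
  unfolding rescaled_measure_def
proof (rule measure_of_emeasure_eq)
  fix B :: "(real^'d) set" assume B: "B \<in> sets borel"
  have "emeasure (density lborel (\<lambda>x. ennreal (\<epsilon> powr (s - real CARD('d))) * indicator (parallel_nbhd Y \<epsilon>) x)) B
    = (\<integral>\<^sup>+x. ennreal (\<epsilon> powr (s - real CARD('d))) * indicator (parallel_nbhd Y \<epsilon> \<inter> B) x \<partial>lborel)"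
    using B by (subst emeasure_density) (auto intro!: nn_integral_cong simp: indicator_def)
  also have "\<dots> = ennreal (\<epsilon> powr (s - real CARD('d))) * emeasure lborel (parallel_nbhd Y \<epsilon> \<inter> B)"
    using B by (intro nn_integral_cmult_indicator) auto
  finally show "ennreal (\<epsilon> powr (s - real CARD('d))) * emeasure lborel (parallel_nbhd Y \<epsilon> \<inter> B)
    = emeasure (density lborel (\<lambda>x. ennreal (\<epsilon> powr (s - real CARD('d))) * indicator (parallel_nbhd Y \<epsilon>) x)) B" ..
qed simp

lemma nn_integral_parallel_nbhd:
  fixes f :: "'a::euclidean_space \<Rightarrow> real"
  assumes "compact Y" "Y \<noteq> {}" "\<epsilon> > 0" "continuous_on UNIV f" "\<And>x. f x \<ge> 0"
  shows "(\<integral>\<^sup>+x. ennreal (f x) * indicator (parallel_nbhd Y \<epsilon>) x \<partial>lborel) = ennreal (LINT x:parallel_nbhd Y \<epsilon>|lborel. f x)"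
proof -
  have "ennreal (LINT x:parallel_nbhd Y \<epsilon>|lborel. f x) = (\<integral>\<^sup>+x. ennreal (indicator (parallel_nbhd Y \<epsilon>) x *\<^sub>R f x) \<partial>lborel)"
    unfolding set_lebesgue_integral_def using set_integrable_parallel_nbhd[OF assms(1-4)] assms(5)
    by (intro nn_integral_eq_integral[symmetric]) (auto simp: set_integrable_def)
  also have "\<dots> = (\<integral>\<^sup>+x. ennreal (f x) * indicator (parallel_nbhd Y \<epsilon>) x \<partial>lborel)"
    by (intro nn_integral_cong) (simp add: indicator_def)
  finally show ?thesis ..
qed

lemma integral_rescaled_measure:
  fixes Y :: "(real^'d) set" and f :: "real^'d \<Rightarrow> real"
  assumes Y: "compact Y" "Y \<noteq> {}" and \<epsilon>: "\<epsilon> > 0" and f: "continuous_on UNIV f" "\<And>x. f x \<ge> 0"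
  shows "(\<integral>\<^sup>+x. ennreal (f x) \<partial>rescaled_measure s Y \<epsilon>) = ennreal (rescaled_integral f Y s (- ln \<epsilon>))"
    and "(\<integral>x. f x \<partial>rescaled_measure s Y \<epsilon>) = rescaled_integral f Y s (- ln \<epsilon>)"
proof -
  have [measurable]: "f \<in> borel_measurable borel" using f by (intro borel_measurable_continuous_onI)
  have nn: "(LINT x:parallel_nbhd Y \<epsilon>|lborel. f x) \<ge> 0"
    unfolding set_lebesgue_integral_def using f(2) by (intro Bochner_Integration.integral_nonneg) auto
  have "(\<integral>\<^sup>+x. ennreal (f x) \<partial>rescaled_measure s Y \<epsilon>)
    = (\<integral>\<^sup>+x. ennreal (\<epsilon> powr (s - real CARD('d))) * (ennreal (f x) * indicator (parallel_nbhd Y \<epsilon>) x) \<partial>lborel)"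
    unfolding rescaled_measure_eq_density by (subst nn_integral_density) (auto intro!: nn_integral_cong simp: mult_ac)
  also have "\<dots> = ennreal (\<epsilon> powr (s - real CARD('d))) * ennreal (LINT x:parallel_nbhd Y \<epsilon>|lborel. f x)"
    by (subst nn_integral_cmult) (auto simp: nn_integral_parallel_nbhd[OF Y \<epsilon> f])
  also have "\<dots> = ennreal (rescaled_integral f Y s (- ln \<epsilon>))"
    using nn by (simp add: rescaled_integral_at[OF \<epsilon>] ennreal_mult)
  finally show n: "(\<integral>\<^sup>+x. ennreal (f x) \<partial>rescaled_measure s Y \<epsilon>) = ennreal (rescaled_integral f Y s (- ln \<epsilon>))" .
  have nonneg: "rescaled_integral f Y s (- ln \<epsilon>) \<ge> 0" unfolding rescaled_integral_at[OF \<epsilon>] using nn by simp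
  have "f \<in> borel_measurable (rescaled_measure s Y \<epsilon>)" unfolding rescaled_measure_eq_density by simp
  then show "(\<integral>x. f x \<partial>rescaled_measure s Y \<epsilon>) = rescaled_integral f Y s (- ln \<epsilon>)"
    using f(2) n nonneg by (subst integral_eq_nn_integral) auto
qed

definition averaged_density :: "real \<Rightarrow> (real^'d) set \<Rightarrow> real \<Rightarrow> real^'d \<Rightarrow> ennreal" where
  "averaged_density s Y T x = ennreal (1 / \<bar>ln T\<bar>) *
     (\<integral>\<^sup>+\<epsilon>. ennreal (\<epsilon> powr (s - real CARD('d) - 1)) * indicator {T..1} \<epsilon> * indicator (parallel_nbhd Y \<epsilon>) x \<partial>lborel)"

text \<open>By Tonelli's theorem averaging over \<open>\<epsilon>\<close> commutes with integration in space; this makes the average a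
measure with a Lebesgue density and reduces its integrals to averages of those over \<open>Y\<^sub>\<epsilon>\<close>.\<close>

lemma averaged_measure_eq_density:
  fixes Y :: "(real^'d) set"
  shows "averaged_measure s Y T = density lborel (averaged_density s Y T)"
    and "averaged_density s Y T \<in> borel_measurable borel"
    and "\<And>f :: real^'d \<Rightarrow> ennreal. f \<in> borel_measurable borel \<Longrightarrow> (\<integral>\<^sup>+x. f x \<partial>density lborel (averaged_density s Y T)) =
       ennreal (1 / \<bar>ln T\<bar>) * (\<integral>\<^sup>+\<epsilon>. ennreal (\<epsilon> powr (s - real CARD('d) - 1)) * indicator {T..1} \<epsilon> * (\<integral>\<^sup>+x. f x * indicator (parallel_nbhd Y \<epsilon>) x \<partial>lborel) \<partial>lborel)"
proof -
  have [measurable]: "(\<lambda>x. infdist x Y) \<in> borel_measurable borel"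
    by (intro borel_measurable_continuous_onI continuous_intros)
  have ind: "indicator (parallel_nbhd Y \<epsilon>) x = (if infdist x Y \<le> \<epsilon> then 1 else 0 :: ennreal)" for \<epsilon> x
    unfolding parallel_nbhd_def by (simp add: indicator_def)
  show meas[measurable]: "averaged_density s Y T \<in> borel_measurable borel"
    unfolding averaged_density_def[abs_def] ind by measurable
  show nn: "(\<integral>\<^sup>+x. f x \<partial>density lborel (averaged_density s Y T)) =
       ennreal (1 / \<bar>ln T\<bar>) * (\<integral>\<^sup>+\<epsilon>. ennreal (\<epsilon> powr (s - real CARD('d) - 1)) * indicator {T..1} \<epsilon> * (\<integral>\<^sup>+x. f x * indicator (parallel_nbhd Y \<epsilon>) x \<partial>lborel) \<partial>lborel)"
    if f[measurable]: "f \<in> borel_measurable borel" for f :: "real^'d \<Rightarrow> ennreal"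
  proof -
    let ?k = "\<lambda>\<epsilon>. ennreal (\<epsilon> powr (s - real CARD('d) - 1)) * indicator {T..1} \<epsilon>"
    have "(\<integral>\<^sup>+x. f x \<partial>density lborel (averaged_density s Y T)) = (\<integral>\<^sup>+x. averaged_density s Y T x * f x \<partial>lborel)"
      by (rule nn_integral_density) auto
    also have "\<dots> = (\<integral>\<^sup>+x. ennreal (1 / \<bar>ln T\<bar>) * (\<integral>\<^sup>+\<epsilon>. ?k \<epsilon> * (f x * indicator (parallel_nbhd Y \<epsilon>) x) \<partial>lborel) \<partial>lborel)"
    proof (rule nn_integral_cong)
      fix x
      have "(\<integral>\<^sup>+\<epsilon>. ?k \<epsilon> * (f x * indicator (parallel_nbhd Y \<epsilon>) x) \<partial>lborel) = (\<integral>\<^sup>+\<epsilon>. ?k \<epsilon> * indicator (parallel_nbhd Y \<epsilon>) x \<partial>lborel) * f x"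
        unfolding ind by (subst nn_integral_multc[symmetric]) (auto intro!: nn_integral_cong simp: mult_ac)
      then show "averaged_density s Y T x * f x = ennreal (1 / \<bar>ln T\<bar>) * (\<integral>\<^sup>+\<epsilon>. ?k \<epsilon> * (f x * indicator (parallel_nbhd Y \<epsilon>) x) \<partial>lborel)"
        unfolding averaged_density_def by (simp add: mult.assoc)
    qed
    also have "\<dots> = ennreal (1 / \<bar>ln T\<bar>) * (\<integral>\<^sup>+x. (\<integral>\<^sup>+\<epsilon>. ?k \<epsilon> * (f x * indicator (parallel_nbhd Y \<epsilon>) x) \<partial>lborel) \<partial>lborel)"
      unfolding ind by (rule nn_integral_cmult) measurable
    also have "(\<integral>\<^sup>+x. (\<integral>\<^sup>+\<epsilon>. ?k \<epsilon> * (f x * indicator (parallel_nbhd Y \<epsilon>) x) \<partial>lborel) \<partial>lborel)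
      = (\<integral>\<^sup>+\<epsilon>. (\<integral>\<^sup>+x. ?k \<epsilon> * (f x * indicator (parallel_nbhd Y \<epsilon>) x) \<partial>lborel) \<partial>lborel)"
      unfolding ind by (rule lborel_pair.Fubini') measurable
    also have "\<dots> = (\<integral>\<^sup>+\<epsilon>. ?k \<epsilon> * (\<integral>\<^sup>+x. f x * indicator (parallel_nbhd Y \<epsilon>) x \<partial>lborel) \<partial>lborel)"
      by (intro nn_integral_cong nn_integral_cmult) measurable
    finally show ?thesis .
  qed
  show "averaged_measure s Y T = density lborel (averaged_density s Y T)"
    unfolding averaged_measure_def
  proof (rule measure_of_emeasure_eq)
    fix B :: "(real^'d) set" assume B: "B \<in> sets borel"
    have "emeasure (density lborel (averaged_density s Y T)) B = (\<integral>\<^sup>+x. indicator B x \<partial>density lborel (averaged_density s Y T))"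
      using B by (intro nn_integral_indicator[symmetric]) auto
    also have "\<dots> = ennreal (1 / \<bar>ln T\<bar>) * (\<integral>\<^sup>+\<epsilon>. ennreal (\<epsilon> powr (s - real CARD('d) - 1)) * indicator {T..1} \<epsilon> * (\<integral>\<^sup>+x. indicator B x * indicator (parallel_nbhd Y \<epsilon>) x \<partial>lborel) \<partial>lborel)"
      using B by (intro nn) auto
    also have "\<dots> = ennreal (1 / \<bar>ln T\<bar>) * (\<integral>\<^sup>+\<epsilon>\<in>{T..1}. ennreal (\<epsilon> powr (s - real CARD('d) - 1)) * emeasure lborel (parallel_nbhd Y \<epsilon> \<inter> B) \<partial>lborel)"
    proof -
      have "(\<integral>\<^sup>+x. indicator B x * indicator (parallel_nbhd Y \<epsilon>) x \<partial>lborel) = emeasure lborel (parallel_nbhd Y \<epsilon> \<inter> B)" for \<epsilon>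
      proof -
        have "(\<integral>\<^sup>+x. indicator B x * indicator (parallel_nbhd Y \<epsilon>) x \<partial>lborel) = (\<integral>\<^sup>+x. indicator (parallel_nbhd Y \<epsilon> \<inter> B) x \<partial>(lborel :: (real^'d) measure))"
          by (intro nn_integral_cong) (auto simp: indicator_def)
        then show ?thesis using B by (simp only: nn_integral_indicator sets.Int sets_lborel parallel_nbhd_borel)
      qed
      then show ?thesis by (simp add: mult_ac)
    qed
    finally show "ennreal (1 / \<bar>ln T\<bar>) * (\<integral>\<^sup>+\<epsilon>\<in>{T..1}. ennreal (\<epsilon> powr (s - real CARD('d) - 1)) * emeasure lborel (parallel_nbhd Y \<epsilon> \<inter> B) \<partial>lborel)
      = emeasure (density lborel (averaged_density s Y T)) B" ..
  qed simp
qed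

lemma integral_averaged_measure:
  fixes Y :: "(real^'d) set" and f :: "real^'d \<Rightarrow> real"
  assumes Y: "compact Y" "Y \<noteq> {}" and T: "0 < T" "T < 1" and f: "continuous_on UNIV f" "\<And>x. f x \<ge> 0"
    and tame: "tame (rescaled_integral f Y s)"
  defines "A \<equiv> 1 / \<bar>ln T\<bar> * (LINT \<epsilon>:{T..1}|lborel. rescaled_integral f Y s (- ln \<epsilon>) / \<epsilon>)"
  shows "(\<integral>\<^sup>+x. ennreal (f x) \<partial>averaged_measure s Y T) = ennreal A"
    and "(\<integral>x. f x \<partial>averaged_measure s Y T) = A"
proof -
  have [measurable]: "f \<in> borel_measurable borel" using f by (intro borel_measurable_continuous_onI)
  have nonneg: "rescaled_integral f Y s t \<ge> 0" for t
    unfolding rescaled_integral_def set_lebesgue_integral_def using f(2) by (intro mult_nonneg_nonneg Bochner_Integration.integral_nonneg) auto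
  have Inn: "(LINT \<epsilon>:{T..1}|lborel. rescaled_integral f Y s (- ln \<epsilon>) / \<epsilon>) \<ge> 0"
    unfolding set_lebesgue_integral_def using nonneg T by (intro Bochner_Integration.integral_nonneg) (auto simp: indicator_def)
  then have "A \<ge> 0" unfolding A_def by simp
  have "(\<integral>\<^sup>+x. ennreal (f x) \<partial>averaged_measure s Y T) = ennreal (1 / \<bar>ln T\<bar>) *
     (\<integral>\<^sup>+\<epsilon>. ennreal (\<epsilon> powr (s - real CARD('d) - 1)) * indicator {T..1} \<epsilon> * (\<integral>\<^sup>+x. ennreal (f x) * indicator (parallel_nbhd Y \<epsilon>) x \<partial>lborel) \<partial>lborel)"
    unfolding averaged_measure_eq_density(1) by (rule averaged_measure_eq_density(3)) simp
  also have "\<dots> = ennreal (1 / \<bar>ln T\<bar>) * (\<integral>\<^sup>+\<epsilon>. ennreal (indicator {T..1} \<epsilon> *\<^sub>R (rescaled_integral f Y s (- ln \<epsilon>) / \<epsilon>)) \<partial>lborel)"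
  proof (intro arg_cong2[of _ _ _ _ "(*)"] refl nn_integral_cong)
    fix \<epsilon> :: real
    show "ennreal (\<epsilon> powr (s - real CARD('d) - 1)) * indicator {T..1} \<epsilon> * (\<integral>\<^sup>+x. ennreal (f x) * indicator (parallel_nbhd Y \<epsilon>) x \<partial>lborel)
      = ennreal (indicator {T..1} \<epsilon> *\<^sub>R (rescaled_integral f Y s (- ln \<epsilon>) / \<epsilon>))"
    proof (cases "\<epsilon> \<in> {T..1}")
      case True
      then have \<epsilon>: "\<epsilon> > 0" using T by simp
      have "\<epsilon> powr (s - real CARD('d) - 1) * (LINT x:parallel_nbhd Y \<epsilon>|lborel. f x) = rescaled_integral f Y s (- ln \<epsilon>) / \<epsilon>"
        unfolding rescaled_integral_at[OF \<epsilon>] using \<epsilon> by (simp add: powr_diff)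
      then show ?thesis using True by (simp add: nn_integral_parallel_nbhd[OF Y \<epsilon> f] ennreal_mult'[symmetric])
    qed simp
  qed
  also have "(\<integral>\<^sup>+\<epsilon>. ennreal (indicator {T..1} \<epsilon> *\<^sub>R (rescaled_integral f Y s (- ln \<epsilon>) / \<epsilon>)) \<partial>lborel)
      = ennreal (LINT \<epsilon>:{T..1}|lborel. rescaled_integral f Y s (- ln \<epsilon>) / \<epsilon>)"
    unfolding set_lebesgue_integral_def
    using log_average_eq(1)[OF tame T] nonneg T
    by (intro nn_integral_eq_integral) (auto simp: set_integrable_def indicator_def)
  also have "ennreal (1 / \<bar>ln T\<bar>) * \<dots> = ennreal A" unfolding A_def using Inn by (subst ennreal_mult[symmetric]) auto
  finally show n: "(\<integral>\<^sup>+x. ennreal (f x) \<partial>averaged_measure s Y T) = ennreal A" .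
  have "f \<in> borel_measurable (averaged_measure s Y T)" unfolding averaged_measure_eq_density(1) by simp
  then show "(\<integral>x. f x \<partial>averaged_measure s Y T) = A"
    using f(2) n \<open>A \<ge> 0\<close> by (subst integral_eq_nn_integral) auto
qed

section \<open>The contents of the conformal image\<close>

context conformal_image begin

definition push :: "(real^'d) measure" where "push = push_forward U g \<mu>"

lemma sets_push[simp, measurable_cong]: "sets push = sets borel" and space_push[simp]: "space push = UNIV"
  unfolding push_def push_forward_def by simp_all

lemma g_measurable: "g \<in> measurable (restrict_space \<mu> U) borel"
proof -
  have "g \<in> borel_measurable (restrict_space borel U)"
    by (rule borel_measurable_continuous_on_restrict[OF continuous_g])
  moreover have "sets (restrict_space \<mu> U) = sets (restrict_space borel U)"
    by (rule sets_restrict_space_cong) simp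
  ultimately show ?thesis by (simp cong: measurable_cong_sets)
qed

lemma U_borel: "U \<in> sets borel" using open_U by simp

lemma emeasure_push: 
  assumes "B \<in> sets borel" shows "emeasure push B = emeasure \<mu> (g -` B \<inter> U)"
proof -
  have "emeasure push B = emeasure (restrict_space \<mu> U) (g -` B \<inter> space (restrict_space \<mu> U))"
    unfolding push_def push_forward_def by (rule emeasure_distr[OF g_measurable assms])
  also have "g -` B \<inter> space (restrict_space \<mu> U) = g -` B \<inter> U" by (simp add: space_restrict_space)
  also have "emeasure (restrict_space \<mu> U) (g -` B \<inter> U) = emeasure \<mu> (g -` B \<inter> U)"
    using U_borel by (intro emeasure_restrict_space) auto
  finally show ?thesis .
qed

lemma finite_measure_push: "finite_measure push"
proof (rule finite_measureI)
  show "emeasure push (space push) \<noteq> \<infinity>"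
    using finite_measure.emeasure_finite[OF finite_measure_\<mu>] by (simp add: emeasure_push)
qed

lemma F_borel: "F \<in> sets borel" using compact_F by (simp add: borel_compact)

lemma AE_push_F: "AE y in push. y \<in> F"
proof (rule AE_I)
  have "emeasure push (- F) = emeasure \<mu> (g -` (- F) \<inter> U)" using F_borel by (intro emeasure_push) auto
  also have "\<dots> \<le> emeasure \<mu> (- K)"
    using K_borel by (intro emeasure_mono) (auto simp: F_def)
  also have "\<dots> = 0" using AE_\<mu>_K K_borel by (subst (asm) AE_iff_measurable[of "- K"]) auto
  finally show "emeasure push (- F) = 0" by simp
  show "- F \<in> sets push" using F_borel by simp
qed auto

lemma integral_push:
  fixes h :: "real^'d \<Rightarrow> real"
  assumes h: "h \<in> borel_measurable borel"
  shows "(\<integral>y. h y \<partial>push) = (LINT x:K|\<mu>. h (g x))"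
proof -
  have "(\<integral>y. h y \<partial>push) = (\<integral>x. h (g x) \<partial>restrict_space \<mu> U)"
    unfolding push_def push_forward_def using g_measurable h by (rule integral_distr)
  also have "\<dots> = (LINT x:U|\<mu>. h (g x))"
    unfolding set_lebesgue_integral_def using U_borel by (intro integral_restrict_space) auto
  also have "\<dots> = (LINT x:K|\<mu>. h (g x))"
  proof -
    have m: "(\<lambda>x. indicator U x *\<^sub>R h (g x)) \<in> borel_measurable \<mu>"
    proof -
      have "(\<lambda>x. h (g x)) \<in> borel_measurable (restrict_space \<mu> U)" using measurable_compose[OF g_measurable h] .
      then show ?thesis using U_borel by (subst (asm) borel_measurable_restrict_space_iff) auto
    qed
    have eq: "indicator K x *\<^sub>R h (g x) = indicator K x *\<^sub>R (indicator U x *\<^sub>R h (g x))" for x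
      using K_U by (auto simp: indicator_def)
    have m': "(\<lambda>x. indicator K x *\<^sub>R h (g x)) \<in> borel_measurable \<mu>"
      unfolding eq using m K_borel by measurable
    show ?thesis unfolding set_lebesgue_integral_def
      using m m' AE_\<mu>_K K_U by (intro integral_cong_AE) (auto elim!: eventually_mono simp: indicator_def)
  qed
  finally show ?thesis .
qed

text \<open>The indicator of \<open>F\<close> makes the function Borel measurable: outside \<open>g ` U\<close> the inverse \<open>G\<close> is arbitrary.\<close>

definition weight :: "real^'d \<Rightarrow> real" where
  "weight y = indicator F y * ratio (G y) powr \<delta>"

lemma weight_g: "x \<in> K \<Longrightarrow> weight (g x) = ratio x powr \<delta>"
  unfolding weight_def F_def using G_g K_U by (auto simp: indicator_def)

lemma weight_nonneg: "weight y \<ge> 0" unfolding weight_def by simp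

lemma continuous_ratio_G: "continuous_on F (\<lambda>y. ratio (G y) powr \<delta>)"
proof (intro continuous_intros)
  have FU: "F \<subseteq> g ` U" unfolding F_def using K_U by blast
  then have "continuous_on F G" using continuous_on_subset[OF continuous_G] by blast
  moreover have "G ` F \<subseteq> U" using FU g_G(2) by blast
  ultimately show "continuous_on F (\<lambda>y. ratio (G y))" by (intro continuous_on_compose2[OF continuous_scaling_ratio])
  show "\<forall>y\<in>F. ratio (G y) \<noteq> 0" using scaling_ratio_pos FU g_G(2) by (metis less_irrefl subsetD)
qed

lemma weight_measurable[measurable]: "weight \<in> borel_measurable borel"
proof -
  have "(\<lambda>y. indicator F y *\<^sub>R (ratio (G y) powr \<delta>)) \<in> borel_measurable borel"
    using F_borel continuous_ratio_G by (rule borel_measurable_continuous_on_indicator)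
  then show ?thesis unfolding weight_def[abs_def] by simp
qed

lemma weight_bounded: obtains B where "B \<ge> 0" "\<And>y. weight y \<le> B"
proof -
  have "bounded ((\<lambda>y. ratio (G y) powr \<delta>) ` F)"
    using continuous_ratio_G compact_F by (intro compact_imp_bounded compact_continuous_image)
  then obtain B where B: "\<And>y. y \<in> F \<Longrightarrow> \<bar>ratio (G y) powr \<delta>\<bar> \<le> B" unfolding bounded_iff by auto
  then have "weight y \<le> \<bar>B\<bar>" for y unfolding weight_def using B[of y] by (cases "y \<in> F") (auto intro: order_trans[OF _ abs_ge_self])
  then show ?thesis using that[of "\<bar>B\<bar>"] by simp
qed

text \<open>The local content, where \<open>M\<close> is the limit of the rescaled volumes of \<open>K\<close>.\<close>

definition content_measure :: "real \<Rightarrow> (real^'d) measure" where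
  "content_measure M = density push (\<lambda>y. ennreal (M * weight y))"

lemma sets_content_measure[simp]: "sets (content_measure M) = sets borel"
  unfolding content_measure_def by simp

lemma finite_content_measure: assumes "M \<ge> 0" shows "finite_measure (content_measure M)"
proof (rule finite_measureI)
  obtain B where B: "B \<ge> 0" "\<And>y. weight y \<le> B" using weight_bounded by blast
  have "emeasure (content_measure M) (space (content_measure M)) = (\<integral>\<^sup>+y. ennreal (M * weight y) * indicator UNIV y \<partial>push)"
    unfolding content_measure_def by (subst emeasure_density) auto
  also have "\<dots> \<le> (\<integral>\<^sup>+y. ennreal (M * B) \<partial>push)"
    using B assms by (intro nn_integral_mono) (auto intro!: ennreal_leI mult_left_mono)
  also have "\<dots> = ennreal (M * B) * emeasure push UNIV" by simp
  also have "\<dots> < \<infinity>" using finite_measure.emeasure_finite[OF finite_measure_push, of UNIV]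
    by (simp add: ennreal_mult_less_top top.not_eq_extremum)
  finally show "emeasure (content_measure M) (space (content_measure M)) \<noteq> \<infinity>" by simp
qed

lemma integral_content_measure:
  fixes f :: "real^'d \<Rightarrow> real"
  assumes M: "M \<ge> 0" and f: "continuous_on UNIV f"
  shows "(\<integral>y. f y \<partial>content_measure M) = M * weighted_integral f"
proof -
  have [measurable]: "f \<in> borel_measurable borel" using f by (rule borel_measurable_continuous_onI)
  have "(\<integral>y. f y \<partial>content_measure M) = (\<integral>y. (M * weight y) *\<^sub>R f y \<partial>push)"
    unfolding content_measure_def using M weight_nonneg by (intro integral_density) auto
  also have "\<dots> = (LINT x:K|\<mu>. (M * weight (g x)) *\<^sub>R f (g x))" by (rule integral_push) simp
  also have "\<dots> = (LINT x:K|\<mu>. M * (f (g x) * ratio x powr \<delta>))"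
    unfolding set_lebesgue_integral_def
    by (intro Bochner_Integration.integral_cong) (auto simp: indicator_def weight_g)
  also have "\<dots> = M * weighted_integral f" unfolding weighted_integral_def by simp
  finally show ?thesis .
qed

lemma bounded_range_abs_bound:
  fixes f :: "'a \<Rightarrow> real"
  assumes "bounded (range f)"
  obtains B where "\<And>x. \<bar>f x\<bar> \<le> B"
  using assms unfolding bounded_iff by auto

lemma local_average_content:
  assumes M: "tends_to True V M" "M \<ge> 0"
  shows "has_local_avg_minkowski_content F (content_measure M)"
  unfolding has_local_avg_minkowski_content_def
proof (intro exI[of _ \<delta>] conjI minkowski_dim_F weak_limit_nonnegI finite_content_measure M(2) sets_content_measure)
  have ev: "eventually (\<lambda>T. 0 < T \<and> T < 1) (at_right (0::real))"
    using eventually_at_right_real[of 0 "1::real"] by simp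
  have one: "continuous_on UNIV (\<lambda>_::real^'d. 1::real)" "\<And>x::real^'d. \<bar>1::real\<bar> \<le> 1" by auto
  show "eventually (\<lambda>T. finite_measure (averaged_measure \<delta> F T) \<and> sets (averaged_measure \<delta> F T) = sets borel) (at_right 0)"
    using ev
  proof eventually_elim
    case (elim T)
    have sets: "sets (averaged_measure \<delta> F T) = sets borel" unfolding averaged_measure_eq_density(1) by simp
    have "(\<integral>\<^sup>+x. ennreal 1 \<partial>averaged_measure \<delta> F T) < \<infinity>"
      using integral_averaged_measure(1)[OF compact_F F_nonempty _ _ one(1) _ tame_F[OF one]] elim by simp
    then have "finite_measure (averaged_measure \<delta> F T)" by (intro finite_measureI) simp
    then show ?case using sets by blast
  qed
  fix f :: "real^'d \<Rightarrow> real" assume f: "continuous_on UNIV f" "bounded (range f)" "\<And>x. f x \<ge> 0"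
  obtain B where B: "\<And>x. \<bar>f x\<bar> \<le> B" using bounded_range_abs_bound[OF f(2)] by blast
  have "((\<lambda>T. 1 / \<bar>ln T\<bar> * (LINT \<epsilon>:{T..1}|lborel. rescaled_integral f F \<delta> (- ln \<epsilon>) / \<epsilon>)) \<longlongrightarrow> M * weighted_integral f) (at_right 0)"
    by (intro tends_to_True_log tame_F[OF f(1) B] tends_to_weighted_integral[OF M f(1) B])
  moreover have "eventually (\<lambda>T. 1 / \<bar>ln T\<bar> * (LINT \<epsilon>:{T..1}|lborel. rescaled_integral f F \<delta> (- ln \<epsilon>) / \<epsilon>) = (\<integral>x. f x \<partial>averaged_measure \<delta> F T)) (at_right 0)"
    using ev by eventually_elim (simp add: integral_averaged_measure(2)[OF compact_F F_nonempty _ _ f(1,3) tame_F[OF f(1) B]])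
  ultimately show "((\<lambda>T. \<integral>x. f x \<partial>averaged_measure \<delta> F T) \<longlongrightarrow> (\<integral>x. f x \<partial>content_measure M)) (at_right 0)"
    unfolding integral_content_measure[OF M(2) f(1)] by (rule Lim_transform_eventually)
qed

lemma local_content:
  assumes M: "tends_to False V M" "M \<ge> 0"
  shows "has_local_minkowski_content F (content_measure M)"
  unfolding has_local_minkowski_content_def
proof (intro exI[of _ \<delta>] conjI minkowski_dim_F weak_limit_nonnegI finite_content_measure M(2) sets_content_measure)
  have ev: "eventually (\<lambda>T. 0 < T \<and> T < 1) (at_right (0::real))"
    using eventually_at_right_real[of 0 "1::real"] by simp
  have one: "continuous_on UNIV (\<lambda>_::real^'d. 1::real)" "\<And>x::real^'d. \<bar>1::real\<bar> \<le> 1" by auto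
  show "eventually (\<lambda>\<epsilon>. finite_measure (rescaled_measure \<delta> F \<epsilon>) \<and> sets (rescaled_measure \<delta> F \<epsilon>) = sets borel) (at_right 0)"
    using ev
  proof eventually_elim
    case (elim \<epsilon>)
    have sets: "sets (rescaled_measure \<delta> F \<epsilon>) = sets borel" unfolding rescaled_measure_eq_density by simp
    have "(\<integral>\<^sup>+x. ennreal 1 \<partial>rescaled_measure \<delta> F \<epsilon>) < \<infinity>"
      using integral_rescaled_measure(1)[OF compact_F F_nonempty _ one(1)] elim by simp
    then have "finite_measure (rescaled_measure \<delta> F \<epsilon>)" by (intro finite_measureI) simp
    then show ?case using sets by blast
  qed
  fix f :: "real^'d \<Rightarrow> real" assume f: "continuous_on UNIV f" "bounded (range f)" "\<And>x. f x \<ge> 0"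
  obtain B where B: "\<And>x. \<bar>f x\<bar> \<le> B" using bounded_range_abs_bound[OF f(2)] by blast
  have "((\<lambda>\<epsilon>. rescaled_integral f F \<delta> (- ln \<epsilon>)) \<longlongrightarrow> M * weighted_integral f) (at_right 0)"
    by (intro tends_to_False_log tends_to_weighted_integral[OF M f(1) B])
  moreover have "eventually (\<lambda>\<epsilon>. rescaled_integral f F \<delta> (- ln \<epsilon>) = (\<integral>x. f x \<partial>rescaled_measure \<delta> F \<epsilon>)) (at_right 0)"
    using ev by eventually_elim (simp add: integral_rescaled_measure(2)[OF compact_F F_nonempty _ f(1,3)])
  ultimately show "((\<lambda>\<epsilon>. \<integral>x. f x \<partial>rescaled_measure \<delta> F \<epsilon>) \<longlongrightarrow> (\<integral>x. f x \<partial>content_measure M)) (at_right 0)"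
    unfolding integral_content_measure[OF M(2) f(1)] by (rule Lim_transform_eventually)
qed

lemma average_content:
  assumes M: "tends_to True V M" "M \<ge> 0"
  shows "has_avg_minkowski_content F (M * weighted_integral (\<lambda>_. 1))"
  unfolding has_avg_minkowski_content_def
proof (intro exI[of _ \<delta>] conjI minkowski_dim_F)
  have one: "continuous_on UNIV (\<lambda>_::real^'d. 1::real)" "\<And>x::real^'d. \<bar>1::real\<bar> \<le> 1" by auto
  have "((\<lambda>T. 1 / \<bar>ln T\<bar> * (LINT \<epsilon>:{T..1}|lborel. rescaled_volume F \<delta> (- ln \<epsilon>) / \<epsilon>)) \<longlongrightarrow> M * weighted_integral (\<lambda>_. 1)) (at_right 0)"
    by (intro tends_to_True_log tame_F[OF one] tends_to_weighted_integral[OF M one])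
  moreover have "eventually (\<lambda>T. 1 / \<bar>ln T\<bar> * (LINT \<epsilon>:{T..1}|lborel. rescaled_volume F \<delta> (- ln \<epsilon>) / \<epsilon>)
    = 1 / \<bar>ln T\<bar> * (LINT \<epsilon>:{T..1}|lborel. \<epsilon> powr (\<delta> - real CARD('d)) * measure lborel (parallel_nbhd F \<epsilon>) / \<epsilon>)) (at_right 0)"
    using eventually_at_right_less[of "0::real"]
  proof eventually_elim
    case (elim T)
    have "(LINT \<epsilon>:{T..1}|lborel. rescaled_volume F \<delta> (- ln \<epsilon>) / \<epsilon>) = (LINT \<epsilon>:{T..1}|lborel. \<epsilon> powr (\<delta> - real CARD('d)) * measure lborel (parallel_nbhd F \<epsilon>) / \<epsilon>)"
      using elim by (intro set_lebesgue_integral_cong) (auto simp: rescaled_integral_at set_lebesgue_integral_def)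
    then show ?case by simp
  qed
  ultimately show "((\<lambda>T. 1 / \<bar>ln T\<bar> * (LINT \<epsilon>:{T..1}|lborel. \<epsilon> powr (\<delta> - real CARD('d)) * measure lborel (parallel_nbhd F \<epsilon>) / \<epsilon>))
    \<longlongrightarrow> M * weighted_integral (\<lambda>_. 1)) (at_right 0)"
    by (rule Lim_transform_eventually)
qed

lemma weighted_integral_1_pos: "weighted_integral (\<lambda>_. 1) > 0"
proof -
  have one_less_two: "(1::real) < 2" by simp
  obtain n and a :: "nat list \<Rightarrow> real" where a: "\<forall>w\<in>words n. a w > 0" "(\<Sum>w\<in>words n. a w) \<le> 2 powr (1 + \<delta>) * weighted_integral (\<lambda>_. 1)"
    using rescaled_integral_sandwich[of "\<lambda>_. 1" 2, OF continuous_on_const order_refl one_less_two] by blast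
  have "(\<Sum>w\<in>words n. a w) > 0" using a(1) finite_words words_nonempty by (intro sum_pos) auto
  then have "0 < 2 powr (1 + \<delta>) * weighted_integral (\<lambda>_. 1)" using a(2) by linarith
  then show ?thesis by (simp add: zero_less_mult_iff)
qed

text \<open>With \<open>W = \<integral> \<bar>g'\<bar>^\<delta> d\<mu>\<close> the average content is \<open>c = M * W\<close>, so that the density \<open>M \<bar>g'\<bar>^\<delta>\<close> equals
\<open>\<bar>g'\<bar>^\<delta> / W * c\<close>, as \<open>W > 0\<close>.\<close>

lemma content_density:
  assumes M: "M \<ge> 0"
  defines "c \<equiv> M * weighted_integral (\<lambda>_. 1)"
  shows "absolutely_continuous push (content_measure M)"
    and "AE y in push. RN_deriv push (content_measure M) y
      = ennreal (ratio (G y) powr \<delta> / (LINT x:K|\<mu>. ratio x powr \<delta>) * c)"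
proof -
  interpret push: finite_measure push by (rule finite_measure_push)
  have m: "(\<lambda>y. ennreal (M * weight y)) \<in> borel_measurable push" by measurable
  show "absolutely_continuous push (content_measure M)"
    unfolding content_measure_def using m by (rule absolutely_continuousI_density)
  have W: "(LINT x:K|\<mu>. ratio x powr \<delta>) = weighted_integral (\<lambda>_. 1)" unfolding weighted_integral_def by simp
  have "AE y in push. ennreal (M * weight y) = RN_deriv push (content_measure M) y"
    by (rule push.RN_deriv_unique[OF m]) (simp add: content_measure_def)
  then show "AE y in push. RN_deriv push (content_measure M) y
      = ennreal (ratio (G y) powr \<delta> / (LINT x:K|\<mu>. ratio x powr \<delta>) * c)"
    using AE_push_F
  proof eventually_elim
    case (elim y)
    have "M * weight y = ratio (G y) powr \<delta> / (LINT x:K|\<mu>. ratio x powr \<delta>) * c"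
      unfolding W c_def weight_def using elim(2) weighted_integral_1_pos by simp
    then show ?case using elim(1) by simp
  qed
qed

end

text \<open>The given dimension \<open>\<delta>\<close> coincides with the similarity dimension, by uniqueness of the Minkowski
dimension; this is what makes the results above applicable to it.\<close>

theorem corollary1p15:
  fixes \<phi> :: "nat \<Rightarrow> real^'d \<Rightarrow> real^'d"
    and r :: "nat \<Rightarrow> real"
    and N :: nat
    and K F U :: "(real^'d) set"
    and g :: "real^'d \<Rightarrow> real^'d"
    and \<alpha> \<delta> :: real
    and \<mu> :: "(real^'d) measure"
  assumes "N \<ge> 2"
    and "\<And>i. i \<in> {1..N} \<Longrightarrow> contracting_similarity (\<phi> i) (r i)"
    and "invariant_set N \<phi> K"
    and "strong_separation N \<phi> K"
    and "open U"
    and "parallel_nbhd K (1/2) \<subseteq> U"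
    and "diffeomorphism_on U g"
    and "conformal_on U g"
    and "\<alpha> > 0"
    and "holder_on \<alpha> U (scaling_ratio g)"
    and "F = g ` K"
    and "has_minkowski_dim K \<delta>"
    and "\<mu> = uniform_measure (hausdorff_measure \<delta>) K"
  shows "\<exists>c \<nu>. has_avg_minkowski_content F c
      \<and> has_local_avg_minkowski_content F \<nu>
      \<and> absolutely_continuous (push_forward U g \<mu>) \<nu>
      \<and> (AE y in push_forward U g \<mu>.
           RN_deriv (push_forward U g \<mu>) \<nu> y =
           ennreal (scaling_ratio g (inv_into U g y) powr \<delta>
                    / (LINT x:K|\<mu>. scaling_ratio g x powr \<delta>) * c))
      \<and> (\<not> lattice_ratios N r \<longrightarrow> has_local_minkowski_content F \<nu>)"
proof -
  have r: "0 < r i" "r i < 1" if "i \<in> {1..N}" for i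
    using assms(2)[OF that] unfolding contracting_similarity_def by auto
  obtain s where s: "s > 0" "(\<Sum>i\<in>{1..N}. r i powr s) = 1"
    using similarity_dimension_exists[of "{1..N}" r] r assms(1) by auto
  interpret S: self_similar \<phi> r N K s
    using assms(1-4) s by unfold_locales auto
  have "s = \<delta>" using minkowski_dim_unique[OF S.minkowski_dim_K assms(12)] .
  interpret C: conformal_image \<phi> r N K \<delta> U g \<alpha>
  proof unfold_locales
    show "K \<subseteq> U" using parallel_nbhd_superset[of "1/2" K] assms(6) by auto
  qed (use assms s \<open>s = \<delta>\<close> in auto)
  have \<mu>: "\<mu> = C.\<mu>" unfolding assms(13) C.\<mu>_def ..
  have F: "F = C.F" unfolding assms(11) C.F_def ..
  obtain M where M: "M \<ge> 0" "tends_to True C.V M" "\<not> lattice_ratios N r \<Longrightarrow> tends_to False C.V M"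
    using C.volume_limit by blast
  show ?thesis
    unfolding \<mu> F C.push_def[symmetric]
    by (intro exI[of _ "M * C.weighted_integral (\<lambda>_. 1)"] exI[of _ "C.content_measure M"] conjI impI
        C.average_content C.local_average_content C.content_density C.local_content M)
qed

end
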